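(* The $\mathbb Z$-subalgebra $\widehat{\mathcal U}_{\mathbb Z}$ of $\widehat{\mathcal U}$ generated by $\{(x_r^\pm)^{(k)}\mid r\in\mathbb Z,k\in\mathbb N\}$ is an integral form of $\widehat{\mathcal U}$. More precisely, multiplication in $\widehat{\mathcal U}$ induces isomorphisms of $\mathbb Z$-modules (tensor products over $\mathbb Z$) $$\widehat{\mathcal U}_{\mathbb Z}\cong\widehat{\mathcal U}_{\mathbb Z}^-\otimes\widehat{\mathcal U}_{\mathbb Z}^0\otimes\widehat{\mathcal U}_{\mathbb Z}^+\cong\widehat{\mathcal U}_{\mathbb Z}^-\otimes\widehat{\mathcal U}_{\mathbb Z}^{0,-}\otimes\widehat{\mathcal U}_{\mathbb Z}^{0,0}\otimes\widehat{\mathcal U}_{\mathbb Z}^{0,+}\otimes\widehat{\mathcal U}_{\mathbb Z}^+$$ and a $\mathbb Z$-basis of $\widehat{\mathcal U}_{\mathbb Z}$ is given by the product $B^-B^{0,-}B^{0,0}B^{0,+}B^+$, where $B^\pm$, $B^{0,\pm}$, $B^{0,0}$ are the $\mathbb Z$-bases respectively of $\widehat{\mathcal U}_{\mathbb Z}^\pm$, $\widehat{\mathcal U}_{\mathbb Z}^{0,\pm}$, $\widehat{\mathcal U}_{\mathbb Z}^{0,0}$ given by $$B^\pm=\Big\{\prod_{r\in\mathbb Z}(x_r^\pm)^{(k_r)}\ \Big|\ {\bf k}:\mathbb Z\to\mathbb N\text{ finitely supported}\Big\},$$ $$B^{0,\pm}=\Big\{\prod_{l\in\mathbb Z_+}\hat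 h_{\pm l}^{k_l}\ \Big|\ {\bf k}:\mathbb Z_+\to\mathbb N\text{ finitely supported}\Big\},\qquad B^{0,0}=\Big\{\binom{h_0}{k}\binom{c}{\tilde k}\ \Big|\ k,\tilde k\in\mathbb N\Big\}.$$
   Context: $\mathbb N=\{0,1,2,\dots\}$, $\mathbb Z_+=\{1,2,\dots\}$. For $a$ in a unital $\mathbb Q$-algebra: $a^{(k)}=a^k/k!$, $\binom ak=a(a-1)\cdots(a-k+1)/k!$. An integral form of a $\mathbb Q$-algebra $U$ is a $\mathbb Z$-subalgebra $U_{\mathbb Z}$ which is a free $\mathbb Z$-module with $U=\mathbb Q\otimes_{\mathbb Z}U_{\mathbb Z}$. $\widehat{\mathcal U}$ is the enveloping algebra of $\widehat{\mathfrak{sl}_2}$, i.e. the associative $\mathbb Q$-algebra generated by $\{x_r^+,x_r^-,h_r,c\mid r\in\mathbb Z\}$ with relations: $c$ central; $[h_r,h_s]=2r\delta_{r+s,0}c$; $[h_r,x_s^\pm]=\pm2x_{r+s}^\pm$; $[x_r^+,x_s^+]=0=[x_r^-,x_s^-]$; $[x_r^+,x_s^-]=h_{r+s}+r\delta_{r+s,0}c$. Elements $\hat h_{\pm k}$ are defined by $\hat h_\pm(u)=\sum_{k\ge0}\hat h_{\pm k}u^k=\exp\big(\sum_{r>0}(-1)^{r-1}\frac{h_{\pm r}}{r}u^r\big)$. $\mathbb Z$-subalgebras of $\widehat{\mathcal U}$: $\widehat{\mathcal U}_{\mathbb Z}^\pm$ is generated by $(x_r^\pm)^{(k)}$ ($r\in\mathbb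 Z,k\in\mathbb N$); $\widehat{\mathcal U}_{\mathbb Z}^{0,0}$ by $\binom{h_0}{k},\binom ck$ ($k\in\mathbb N$); $\widehat{\mathcal U}_{\mathbb Z}^{0,\pm}$ by $\hat h_{\pm k}$ ($k>0$); $\widehat{\mathcal U}_{\mathbb Z}^0$ by $\widehat{\mathcal U}_{\mathbb Z}^{0,-}$, $\widehat{\mathcal U}_{\mathbb Z}^{0,0}$ and $\widehat{\mathcal U}_{\mathbb Z}^{0,+}$. *)

theory Defs
  imports
    Complex_Main
    "HOL-Library.Poly_Mapping"
    "HOL-Algebra.Free_Abelian_Groups"
    "HOL-Computational_Algebra.Formal_Power_Series"
begin

section \<open>Unital algebras over the rationals\<close>

class rat_algebra_1 = ring_1 +
  fixes scaleQ :: "rat \<Rightarrow> 'a \<Rightarrow> 'a"  (infixr \<open>*\<^sub>Q\<close> 75)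
  assumes scaleQ_add_right: "q *\<^sub>Q (a + b) = q *\<^sub>Q a + q *\<^sub>Q b"
    and scaleQ_add_left: "(p + q) *\<^sub>Q a = p *\<^sub>Q a + q *\<^sub>Q a"
    and scaleQ_scaleQ: "p *\<^sub>Q (q *\<^sub>Q a) = (p * q) *\<^sub>Q a"
    and scaleQ_one: "1 *\<^sub>Q a = a"
    and mult_scaleQ_left: "(q *\<^sub>Q a) * b = q *\<^sub>Q (a * b)"
    and mult_scaleQ_right: "a * (q *\<^sub>Q b) = q *\<^sub>Q (a * b)"

definition div_power :: "'a::rat_algebra_1 \<Rightarrow> nat \<Rightarrow> 'a"
  where "div_power a k = (1 / fact k) *\<^sub>Q a ^ k"

definition binomQ :: "'a::rat_algebra_1 \<Rightarrow> nat \<Rightarrow> 'a"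
  where "binomQ a k = (1 / fact k) *\<^sub>Q prod_list (map (\<lambda>i. a - of_nat i) [0..<k])"

text \<open>The exponential of a formal power series without constant term (only such series are used
  below): \<open>F ^ n\<close> has no term of order less than \<open>n\<close>, so that the sum for the \<open>k\<close>-th
  coefficient stops at \<open>n = k\<close>.\<close>

definition expQ_fps :: "'a::rat_algebra_1 fps \<Rightarrow> 'a fps"
  where "expQ_fps F = Abs_fps (\<lambda>k. \<Sum>n\<le>k. (1 / fact n) *\<^sub>Q fps_nth (F ^ n) k)"

section \<open>Tensor products over the integers\<close>

text \<open>Abelian groups, i.e. \<open>\<int>\<close>-modules, are taken in the multiplicative notation of HOL-Algebra;
  \<open>add_grp S\<close> is an additive subgroup \<open>S\<close> of a type class ring in that format.\<close>

definition add_grp :: "'a::ab_group_add set \<Rightarrow> 'a monoid"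
  where "add_grp S = \<lparr>carrier = S, monoid.mult = (+), one = 0\<rparr>"

inductive_set tensor_relators :: "'a monoid \<Rightarrow> 'b monoid \<Rightarrow> ('a \<times> 'b \<Rightarrow>\<^sub>0 int) set"
  for G H where
  left: "\<lbrakk>a \<in> carrier G; a' \<in> carrier G; b \<in> carrier H\<rbrakk> \<Longrightarrow>
    frag_of (a \<otimes>\<^bsub>G\<^esub> a', b) - frag_of (a, b) - frag_of (a', b) \<in> tensor_relators G H"
| right: "\<lbrakk>a \<in> carrier G; b \<in> carrier H; b' \<in> carrier H\<rbrakk> \<Longrightarrow>
    frag_of (a, b \<otimes>\<^bsub>H\<^esub> b') - frag_of (a, b) - frag_of (a, b') \<in> tensor_relators G H"

definition tensor_kernel :: "'a monoid \<Rightarrow> 'b monoid \<Rightarrow> ('a \<times> 'b \<Rightarrow>\<^sub>0 int) set"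
  where "tensor_kernel G H =
    generate (free_Abelian_group (carrier G \<times> carrier H)) (tensor_relators G H)"

definition tensor :: "'a monoid \<Rightarrow> 'b monoid \<Rightarrow> ('a \<times> 'b \<Rightarrow>\<^sub>0 int) set monoid"  (infixr \<open>\<boxtimes>\<close> 70)
  where "G \<boxtimes> H = free_Abelian_group (carrier G \<times> carrier H) Mod tensor_kernel G H"

definition pure_tensor ::
    "'a monoid \<Rightarrow> 'b monoid \<Rightarrow> 'a \<Rightarrow> 'b \<Rightarrow> ('a \<times> 'b \<Rightarrow>\<^sub>0 int) set"
  where "pure_tensor G H a b =
    tensor_kernel G H #>\<^bsub>free_Abelian_group (carrier G \<times> carrier H)\<^esub> frag_of (a, b)"

definition free_lift :: "'c monoid \<Rightarrow> ('p \<Rightarrow> 'c) \<Rightarrow> ('p \<Rightarrow>\<^sub>0 int) \<Rightarrow> 'c"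
  where "free_lift K f z =
    finprod K (\<lambda>p. f p [^]\<^bsub>K\<^esub> Poly_Mapping.lookup z p) (Poly_Mapping.keys z)"

text \<open>The homomorphism from \<open>G \<boxtimes> H\<close> to \<open>K\<close> induced by a biadditive \<open>f\<close>: for such \<open>f\<close>
  the extension of \<open>f\<close> to the free abelian group is constant on cosets.\<close>

definition tensor_lift :: "'c monoid \<Rightarrow> ('a \<Rightarrow> 'b \<Rightarrow> 'c) \<Rightarrow> ('a \<times> 'b \<Rightarrow>\<^sub>0 int) set \<Rightarrow> 'c"
  where "tensor_lift K f X = the_elem (free_lift K (\<lambda>(a, b). f a b) ` X)"

definition tensor_map :: "'c monoid \<Rightarrow> 'd monoid \<Rightarrow> ('a \<Rightarrow> 'c) \<Rightarrow> ('b \<Rightarrow> 'd) \<Rightarrow>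
    ('a \<times> 'b \<Rightarrow>\<^sub>0 int) set \<Rightarrow> ('c \<times> 'd \<Rightarrow>\<^sub>0 int) set"
  where "tensor_map G' H' f g = tensor_lift (G' \<boxtimes> H') (\<lambda>a b. pure_tensor G' H' (f a) (g b))"

text \<open>\<open>tensor_mult f g\<close> sends \<open>a \<otimes> b\<close> to \<open>f a * g b\<close>.  In nested form it is the multiplication
  map on a bracketed tensor product of several subgroups of a ring.\<close>

definition tensor_mult :: "('a \<Rightarrow> 'r::ring_1) \<Rightarrow> ('b \<Rightarrow> 'r) \<Rightarrow> ('a \<times> 'b \<Rightarrow>\<^sub>0 int) set \<Rightarrow> 'r"
  where "tensor_mult f g = tensor_lift (add_grp UNIV) (\<lambda>a b. f a * g b)"

lemma free_lift_hom:
  assumes K: "comm_group K" and f: "f \<in> P \<rightarrow> carrier K"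
  shows "free_lift K f \<in> hom (free_Abelian_group P) K"
proof -
  interpret K: comm_group K by (fact K)
  let ?L = "Poly_Mapping.lookup"
  have ext: "free_lift K f z = finprod K (\<lambda>p. f p [^]\<^bsub>K\<^esub> ?L z p) A"
    if "finite A" "Poly_Mapping.keys z \<subseteq> A" "A \<subseteq> P" for z A
    unfolding free_lift_def
    by (rule K.finprod_mono_neutral_cong_left)
       (use that f in \<open>auto simp: in_keys_iff intro!: K.int_pow_closed\<close>)
  show ?thesis
  proof (rule homI)
    fix z assume "z \<in> carrier (free_Abelian_group P)"
    then show "free_lift K f z \<in> carrier K"
      using f unfolding free_lift_def
      by (auto simp: carrier_free_Abelian_group_iff intro!: K.finprod_closed K.int_pow_closed)
  next
    fix y z assume yz: "y \<in> carrier (free_Abelian_group P)" "z \<in> carrier (free_Abelian_group P)"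
    let ?A = "Poly_Mapping.keys y \<union> Poly_Mapping.keys z"
    have A: "finite ?A" "?A \<subseteq> P"
      using yz by (auto simp: carrier_free_Abelian_group_iff)
    have fA: "f p \<in> carrier K" if "p \<in> ?A" for p
      using that A f by blast
    have "free_lift K f (y + z) = finprod K (\<lambda>p. f p [^]\<^bsub>K\<^esub> ?L (y + z) p) ?A"
      by (rule ext) (use A Poly_Mapping.keys_add[of y z] in blast)+
    also have "\<dots> = finprod K (\<lambda>p. f p [^]\<^bsub>K\<^esub> ?L y p \<otimes>\<^bsub>K\<^esub> f p [^]\<^bsub>K\<^esub> ?L z p) ?A"
      by (rule K.finprod_cong')
         (use fA in \<open>auto simp: lookup_add K.int_pow_mult\<close>)
    also have "\<dots> = finprod K (\<lambda>p. f p [^]\<^bsub>K\<^esub> ?L y p) ?A \<otimes>\<^bsub>K\<^esub> finprod K (\<lambda>p. f p [^]\<^bsub>K\<^esub> ?L z p) ?A"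
      by (rule K.finprod_multf) (use fA in \<open>auto intro!: K.int_pow_closed\<close>)
    also have "\<dots> = free_lift K f y \<otimes>\<^bsub>K\<^esub> free_lift K f z"
      using ext[of ?A y] ext[of ?A z] A by auto
    finally show "free_lift K f (y \<otimes>\<^bsub>free_Abelian_group P\<^esub> z) = free_lift K f y \<otimes>\<^bsub>K\<^esub> free_lift K f z"
      by simp
  qed
qed

lemma tensor_lift_pure_tensor:
  assumes K: "comm_group K"
    and f: "\<And>a b. \<lbrakk>a \<in> carrier G; b \<in> carrier H\<rbrakk> \<Longrightarrow> f a b \<in> carrier K"
    and left: "\<And>a a' b. \<lbrakk>a \<in> carrier G; a' \<in> carrier G; b \<in> carrier H\<rbrakk> \<Longrightarrow>
      f (a \<otimes>\<^bsub>G\<^esub> a') b = f a b \<otimes>\<^bsub>K\<^esub> f a' b"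
    and right: "\<And>a b b'. \<lbrakk>a \<in> carrier G; b \<in> carrier H; b' \<in> carrier H\<rbrakk> \<Longrightarrow>
      f a (b \<otimes>\<^bsub>H\<^esub> b') = f a b \<otimes>\<^bsub>K\<^esub> f a b'"
    and G: "group G" and H: "group H"
    and ab: "a \<in> carrier G" "b \<in> carrier H"
  shows "tensor_lift K f (pure_tensor G H a b) = f a b"
proof -
  interpret K: comm_group K by (fact K)
  interpret G: group G by (fact G)
  interpret H: group H by (fact H)
  let ?P = "carrier G \<times> carrier H"
  let ?F = "free_Abelian_group ?P"
  let ?l = "free_lift K (\<lambda>(a, b). f a b)"
  have "?l \<in> hom ?F K"
    by (rule free_lift_hom) (use K f in auto)
  then interpret l: group_hom ?F K ?l
    by (simp add: group_hom_def group_hom_axioms_def K.is_group)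
  have of: "?l (frag_of (a, b)) = f a b" if "a \<in> carrier G" "b \<in> carrier H" for a b
    using f that by (simp add: free_lift_def keys_frag_of K.int_pow_1)
  have rel: "u \<in> carrier ?F \<and> ?l u = \<one>\<^bsub>K\<^esub>" if "u \<in> tensor_relators G H" for u
  proof -
    have *: "frag_of p - frag_of q - frag_of r \<in> carrier ?F \<and>
        ?l (frag_of p - frag_of q - frag_of r) = \<one>\<^bsub>K\<^esub>"
      if "p \<in> ?P" "q \<in> ?P" "r \<in> ?P" "(\<lambda>(a, b). f a b) p = (\<lambda>(a, b). f a b) q \<otimes>\<^bsub>K\<^esub> (\<lambda>(a, b). f a b) r"
      for p q r
    proof -
      have car: "frag_of p \<in> carrier ?F" "frag_of q \<in> carrier ?F" "frag_of r \<in> carrier ?F"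
        using that by (simp_all add: carrier_free_Abelian_group_iff keys_frag_of)
      let ?u = "frag_of p - frag_of q - frag_of r"
      have u: "?u \<in> carrier ?F"
        using car keys_diff[of "frag_of p - frag_of q" "frag_of r"] keys_diff[of "frag_of p" "frag_of q"]
        by (auto simp: carrier_free_Abelian_group_iff)
      have "?l (frag_of p) = ?l (?u \<otimes>\<^bsub>?F\<^esub> (frag_of q \<otimes>\<^bsub>?F\<^esub> frag_of r))"
        by simp
      also have "\<dots> = ?l ?u \<otimes>\<^bsub>K\<^esub> (?l (frag_of q) \<otimes>\<^bsub>K\<^esub> ?l (frag_of r))"
        using u car by (simp only: l.hom_mult l.G.m_closed)
      also have "?l (frag_of q) \<otimes>\<^bsub>K\<^esub> ?l (frag_of r) = ?l (frag_of p)"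
        using of that by (cases p; cases q; cases r) auto
      finally have "?l ?u = \<one>\<^bsub>K\<^esub>"
        using K.r_cancel_one' l.hom_closed[OF u] l.hom_closed[OF car(1)] by metis
      with u show ?thesis by simp
    qed
    from that show ?thesis
    proof cases
      case (left a a' b)
      then show ?thesis
        using *[of "(a \<otimes>\<^bsub>G\<^esub> a', b)" "(a, b)" "(a', b)"] assms(3) by simp
    next
      case (right a b b')
      then show ?thesis
        using *[of "(a, b \<otimes>\<^bsub>H\<^esub> b')" "(a, b)" "(a, b')"] assms(4) by simp
    qed
  qed
  have ker: "u \<in> carrier ?F \<and> ?l u = \<one>\<^bsub>K\<^esub>" if "u \<in> tensor_kernel G H" for u
    using that unfolding tensor_kernel_def
  proof (induction rule: generate.induct)
    case one
    show ?case using l.hom_one l.G.one_closed by blast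
  next
    case (incl u)
    then show ?case by (rule rel)
  next
    case (inv u)
    then show ?case using rel[of u] by (metis l.G.inv_closed l.hom_inv K.inv_one)
  next
    case (eng u v)
    then show ?case by (metis l.G.m_closed l.hom_mult K.one_closed K.r_one)
  qed
  have car: "frag_of (a, b) \<in> carrier ?F"
    using ab by (simp add: carrier_free_Abelian_group_iff keys_frag_of)
  have "?l ` pure_tensor G H a b = {f a b}"
  proof
    show "?l ` pure_tensor G H a b \<subseteq> {f a b}"
    proof
      fix y assume "y \<in> ?l ` pure_tensor G H a b"
      then obtain u where u: "u \<in> tensor_kernel G H" and y: "y = ?l (u \<otimes>\<^bsub>?F\<^esub> frag_of (a, b))"
        unfolding pure_tensor_def r_coset_def by blast
      have "y = ?l u \<otimes>\<^bsub>K\<^esub> ?l (frag_of (a, b))"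
        unfolding y using ker[OF u] car by (intro l.hom_mult) auto
      then show "y \<in> {f a b}"
        using ker[OF u] of[OF ab] f[OF ab] by simp
    qed
    have "\<one>\<^bsub>?F\<^esub> \<in> tensor_kernel G H"
      unfolding tensor_kernel_def by (rule generate.one)
    then have "frag_of (a, b) \<in> pure_tensor G H a b"
      unfolding pure_tensor_def r_coset_def by force
    with of[OF ab] show "{f a b} \<subseteq> ?l ` pure_tensor G H a b"
      by force
  qed
  then show ?thesis
    by (simp add: tensor_lift_def)
qed

section \<open>Subrings, bases and integral forms\<close>

definition Z_subalgebra :: "'a::ring_1 set \<Rightarrow> bool"
  where "Z_subalgebra S \<longleftrightarrow> 1 \<in> S \<and> (\<forall>a\<in>S. \<forall>b\<in>S. a - b \<in> S \<and> a * b \<in> S)"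

abbreviation scaleZ :: "int \<Rightarrow> 'a::ring_1 \<Rightarrow> 'a"
  where "scaleZ \<equiv> \<lambda>n a. of_int n * a"

lemma module_scaleZ: "module (scaleZ :: int \<Rightarrow> 'a::ring_1 \<Rightarrow> 'a)"
  by unfold_locales (simp_all add: algebra_simps)

text \<open>The family \<open>b\<close>, indexed by \<open>I\<close>, is a basis of the \<open>\<int>\<close>-module \<open>M\<close>; in particular different
  indices give different basis elements.\<close>

definition is_Z_basis :: "('i \<Rightarrow> 'a::ring_1) \<Rightarrow> 'i set \<Rightarrow> 'a set \<Rightarrow> bool"
  where "is_Z_basis b I M \<longleftrightarrow>
    inj_on b I \<and> \<not> module.dependent scaleZ (b ` I) \<and> module.span scaleZ (b ` I) = M"

definition integral_form :: "'a::rat_algebra_1 set \<Rightarrow> bool"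
  where "integral_form S \<longleftrightarrow>
    Z_subalgebra S \<and>
    (\<exists>B. is_Z_basis (\<lambda>b. b) B S) \<and>
    tensor_lift (add_grp UNIV) (*\<^sub>Q) \<in> iso (add_grp (UNIV :: rat set) \<boxtimes> add_grp S) (add_grp UNIV)"

section \<open>Free monoids\<close>

text \<open>The monoid algebra \<open>'a free_monoid \<Rightarrow>\<^sub>0 rat\<close>, with the convolution product of
  \<^theory>\<open>HOL-Library.Poly_Mapping\<close>, is the free associative \<open>\<rat>\<close>-algebra on \<open>'a\<close>.\<close>

datatype 'a free_monoid = Monomial (letters: "'a list")

instantiation free_monoid :: (type) monoid_add
begin

definition zero_free_monoid :: "'a free_monoid"
  where "zero_free_monoid = Monomial []"

definition plus_free_monoid :: "'a free_monoid \<Rightarrow> 'a free_monoid \<Rightarrow> 'a free_monoid"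
  where "plus_free_monoid v w = Monomial (letters v @ letters w)"

instance
  by standard (simp_all add: zero_free_monoid_def plus_free_monoid_def)

end

definition free_const :: "rat \<Rightarrow> 'a free_monoid \<Rightarrow>\<^sub>0 rat"
  where "free_const q = Poly_Mapping.single 0 q"

definition free_gen :: "'a \<Rightarrow> 'a free_monoid \<Rightarrow>\<^sub>0 rat"
  where "free_gen g = Poly_Mapping.single (Monomial [g]) 1"

lemma free_const_add: "free_const (p + q) = free_const p + free_const q"
  by (simp add: free_const_def single_add)

lemma free_const_mult: "free_const (p * q) = free_const p * free_const q"
  by (simp add: free_const_def mult_single)

lemma free_const_1: "free_const 1 = 1"
  by (simp add: free_const_def)

lemma free_monoid_add_eq_0_iff: "v + w = 0 \<longleftrightarrow> v = 0 \<and> w = (0 :: 'a free_monoid)"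
  by (cases v; cases w) (auto simp: zero_free_monoid_def plus_free_monoid_def)

lemma free_const_commute:
  fixes a :: "'a free_monoid \<Rightarrow>\<^sub>0 rat"
  shows "a * free_const q = free_const q * a"
proof (rule poly_mapping_eqI)
  fix k :: "'a free_monoid"
  have right: "(\<Sum>r. Poly_Mapping.lookup (free_const q) r when k = l + r) = (q when l = k)"
    for l :: "'a free_monoid"
  proof -
    have "(Poly_Mapping.lookup (free_const q) r when k = l + r) = ((q when l = k) when r = 0)" for r
      by (cases "r = 0") (auto simp: when_def free_const_def lookup_single)
    then show ?thesis by simp
  qed
  have left: "Poly_Mapping.lookup (free_const q) l * z = (q * z when l = 0)"
    for l :: "'a free_monoid" and z
    by (cases "l = 0") (simp_all add: free_const_def lookup_single when_def)
  have "Poly_Mapping.lookup (a * free_const q) k = Poly_Mapping.lookup a k * q"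
    unfolding lookup_mult right mult_when by simp
  moreover have "Poly_Mapping.lookup (free_const q * a) k = q * Poly_Mapping.lookup a k"
    unfolding lookup_mult left by simp
  ultimately show "Poly_Mapping.lookup (a * free_const q) k = Poly_Mapping.lookup (free_const q * a) k"
    by (simp add: mult.commute)
qed

lemma lookup_mult_0:
  fixes f g :: "'a free_monoid \<Rightarrow>\<^sub>0 rat"
  shows "Poly_Mapping.lookup (f * g) 0 = Poly_Mapping.lookup f 0 * Poly_Mapping.lookup g 0"
proof -
  have "(\<Sum>q. Poly_Mapping.lookup g q when 0 = l + q) = (Poly_Mapping.lookup g 0 when l = 0)"
    for l :: "'a free_monoid"
  proof -
    have "(Poly_Mapping.lookup g q when 0 = l + q)
        = ((Poly_Mapping.lookup g q when l = 0) when q = 0)" for q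
      using free_monoid_add_eq_0_iff[of l q] by (auto simp: when_def)
    then show ?thesis by simp
  qed
  then show ?thesis
    by (simp add: lookup_mult mult_when)
qed

section \<open>The enveloping algebra of affine \<open>sl\<^sub>2\<close>\<close>

datatype pm = Pos | Neg

fun pm_sign :: "pm \<Rightarrow> int"
  where "pm_sign Pos = 1" | "pm_sign Neg = -1"

datatype gen = Gen_x pm int | Gen_h int | Gen_c

definition bracket :: "'a::ring \<Rightarrow> 'a \<Rightarrow> 'a"
  where "bracket a b = a * b - b * a"

inductive_set uhat_relators :: "(gen free_monoid \<Rightarrow>\<^sub>0 rat) set" where
  c: "bracket (free_gen Gen_c) (free_gen g) \<in> uhat_relators"
| hh: "bracket (free_gen (Gen_h r)) (free_gen (Gen_h s))
        - of_int (if r + s = 0 then 2 * r else 0) * free_gen Gen_c \<in> uhat_relators"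
| hx: "bracket (free_gen (Gen_h r)) (free_gen (Gen_x e s))
        - of_int (2 * pm_sign e) * free_gen (Gen_x e (r + s)) \<in> uhat_relators"
| xx: "bracket (free_gen (Gen_x e r)) (free_gen (Gen_x e s)) \<in> uhat_relators"
| xpxm: "bracket (free_gen (Gen_x Pos r)) (free_gen (Gen_x Neg s))
        - (free_gen (Gen_h (r + s)) + of_int (if r + s = 0 then r else 0) * free_gen Gen_c)
        \<in> uhat_relators"

inductive_set uhat_ideal :: "(gen free_monoid \<Rightarrow>\<^sub>0 rat) set" where
  zero: "0 \<in> uhat_ideal"
| relator: "u \<in> uhat_relators \<Longrightarrow> a * u * b \<in> uhat_ideal"
| add: "\<lbrakk>u \<in> uhat_ideal; v \<in> uhat_ideal\<rbrakk> \<Longrightarrow> u + v \<in> uhat_ideal"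

lemma uhat_ideal_mult_left: "u \<in> uhat_ideal \<Longrightarrow> w * u \<in> uhat_ideal"
proof (induction rule: uhat_ideal.induct)
  case (relator u a b)
  then show ?case
    using uhat_ideal.relator[of u "w * a" b] by (simp add: mult.assoc)
qed (simp_all add: distrib_left uhat_ideal.intros)

lemma uhat_ideal_mult_right: "u \<in> uhat_ideal \<Longrightarrow> u * w \<in> uhat_ideal"
proof (induction rule: uhat_ideal.induct)
  case (relator u a b)
  then show ?case
    using uhat_ideal.relator[of u a "b * w"] by (simp add: mult.assoc)
qed (simp_all add: distrib_right uhat_ideal.intros)

lemma uhat_ideal_uminus: "u \<in> uhat_ideal \<Longrightarrow> - u \<in> uhat_ideal"
  using uhat_ideal_mult_left[of u "-1"] by simp

lemma uhat_ideal_diff: "u \<in> uhat_ideal \<Longrightarrow> v \<in> uhat_ideal \<Longrightarrow> u - v \<in> uhat_ideal"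
  using uhat_ideal.add[of u "- v"] uhat_ideal_uminus[of v] by simp

lemma lookup_uhat_ideal_0: "u \<in> uhat_ideal \<Longrightarrow> Poly_Mapping.lookup u 0 = 0"
proof (induction rule: uhat_ideal.induct)
  case (relator u a b)
  have [simp]: "Poly_Mapping.lookup (free_gen g) 0 = 0" for g :: gen
    by (simp add: free_gen_def lookup_single when_def zero_free_monoid_def)
  from relator have "Poly_Mapping.lookup u 0 = 0"
    by (cases rule: uhat_relators.cases)
       (simp_all add: bracket_def lookup_add lookup_minus lookup_mult_0)
  then show ?case
    by (simp add: lookup_mult_0)
qed (simp_all add: lookup_add)

definition uhat_eq :: "(gen free_monoid \<Rightarrow>\<^sub>0 rat) \<Rightarrow> (gen free_monoid \<Rightarrow>\<^sub>0 rat) \<Rightarrow> bool"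
  where "uhat_eq u v \<longleftrightarrow> u - v \<in> uhat_ideal"

lemma uhat_eq_refl: "uhat_eq u u"
  by (simp add: uhat_eq_def uhat_ideal.zero)

quotient_type uhat = "gen free_monoid \<Rightarrow>\<^sub>0 rat" / uhat_eq
proof (rule equivpI)
  show "reflp uhat_eq"
    by (simp add: reflp_def uhat_eq_refl)
  show "symp uhat_eq"
  proof (rule sympI)
    fix u v assume "uhat_eq u v"
    then show "uhat_eq v u"
      using uhat_ideal_uminus[of "u - v"] by (simp add: uhat_eq_def)
  qed
  show "transp uhat_eq"
  proof (rule transpI)
    fix u v w assume "uhat_eq u v" "uhat_eq v w"
    then show "uhat_eq u w"
      using uhat_ideal.add[of "u - v" "v - w"] by (simp add: uhat_eq_def)
  qed
qed

instantiation uhat :: rat_algebra_1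
begin

lift_definition zero_uhat :: uhat is 0 .

lift_definition one_uhat :: uhat is 1 .

lift_definition plus_uhat :: "uhat \<Rightarrow> uhat \<Rightarrow> uhat" is "(+)"
proof -
  fix a a' b b' assume "uhat_eq a a'" "uhat_eq b b'"
  then have "(a - a') + (b - b') \<in> uhat_ideal"
    by (simp add: uhat_eq_def uhat_ideal.add)
  then show "uhat_eq (a + b) (a' + b')"
    by (simp add: uhat_eq_def algebra_simps)
qed

lift_definition uminus_uhat :: "uhat \<Rightarrow> uhat" is uminus
proof -
  fix a a' assume "uhat_eq a a'"
  then have "- (a - a') \<in> uhat_ideal"
    unfolding uhat_eq_def by (rule uhat_ideal_uminus)
  then show "uhat_eq (- a) (- a')"
    by (simp add: uhat_eq_def)
qed

lift_definition minus_uhat :: "uhat \<Rightarrow> uhat \<Rightarrow> uhat" is "(-)"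
proof -
  fix a a' b b' assume "uhat_eq a a'" "uhat_eq b b'"
  then have "(a - a') - (b - b') \<in> uhat_ideal"
    by (simp add: uhat_eq_def uhat_ideal_diff)
  then show "uhat_eq (a - b) (a' - b')"
    by (simp add: uhat_eq_def algebra_simps)
qed

lift_definition times_uhat :: "uhat \<Rightarrow> uhat \<Rightarrow> uhat" is "(*)"
proof -
  fix a a' b b' assume "uhat_eq a a'" "uhat_eq b b'"
  then have "(a - a') * b + a' * (b - b') \<in> uhat_ideal"
    by (simp add: uhat_eq_def uhat_ideal.add uhat_ideal_mult_left uhat_ideal_mult_right)
  then show "uhat_eq (a * b) (a' * b')"
    by (simp add: uhat_eq_def algebra_simps)
qed

lift_definition scaleQ_uhat :: "rat \<Rightarrow> uhat \<Rightarrow> uhat" is "\<lambda>q u. free_const q * u"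
proof -
  fix q :: rat and a a' assume "uhat_eq a a'"
  then have "free_const q * (a - a') \<in> uhat_ideal"
    by (simp add: uhat_eq_def uhat_ideal_mult_left)
  then show "uhat_eq (free_const q * a) (free_const q * a')"
    by (simp add: uhat_eq_def right_diff_distrib)
qed

instance
proof
  fix a b d :: uhat and p q :: rat
  show "a + b + d = a + (b + d)"
    by transfer (simp add: uhat_eq_refl add.assoc)
  show "a + b = b + a"
    by transfer (simp add: uhat_eq_refl add.commute)
  show "0 + a = a" and "- a + a = 0" and "a - b = a + - b" and "1 * a = a" and "a * 1 = a"
    by (transfer; simp add: uhat_eq_refl)+
  show "a * b * d = a * (b * d)"
    by transfer (simp add: uhat_eq_refl mult.assoc)
  show "(a + b) * d = a * d + b * d"
    by transfer (simp add: uhat_eq_refl distrib_right)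
  show "a * (b + d) = a * b + a * d"
    by transfer (simp add: uhat_eq_refl distrib_left)
  show "(0 :: uhat) \<noteq> 1"
  proof
    assume "(0 :: uhat) = 1"
    then have "0 - 1 \<in> uhat_ideal"
      by transfer (simp only: uhat_eq_def)
    then show False
      using lookup_uhat_ideal_0[of "0 - 1"] by (simp add: lookup_minus lookup_one)
  qed
  show "q *\<^sub>Q (a + b) = q *\<^sub>Q a + q *\<^sub>Q b"
    by transfer (simp add: uhat_eq_refl distrib_left)
  show "(p + q) *\<^sub>Q a = p *\<^sub>Q a + q *\<^sub>Q a"
    by transfer (simp add: uhat_eq_refl free_const_add distrib_right)
  show "p *\<^sub>Q q *\<^sub>Q a = (p * q) *\<^sub>Q a"
    by transfer (simp add: uhat_eq_refl free_const_mult mult.assoc)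
  show "1 *\<^sub>Q a = a"
    by transfer (simp add: uhat_eq_refl free_const_1)
  show "(q *\<^sub>Q a) * b = q *\<^sub>Q (a * b)"
    by transfer (simp add: uhat_eq_refl mult.assoc)
  show "a * (q *\<^sub>Q b) = q *\<^sub>Q (a * b)"
  proof transfer
    fix a b :: "gen free_monoid \<Rightarrow>\<^sub>0 rat" and q
    have "a * (free_const q * b) = free_const q * (a * b)"
      by (simp only: mult.assoc[symmetric] free_const_commute)
    then show "uhat_eq (a * (free_const q * b)) (free_const q * (a * b))"
      by (simp add: uhat_eq_refl)
  qed
qed

end

lift_definition uhat_gen :: "gen \<Rightarrow> uhat" is free_gen .

definition x_el :: "pm \<Rightarrow> int \<Rightarrow> uhat"
  where "x_el e r = uhat_gen (Gen_x e r)"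

definition h_el :: "int \<Rightarrow> uhat"
  where "h_el r = uhat_gen (Gen_h r)"

definition c_el :: uhat
  where "c_el = uhat_gen Gen_c"

definition hhat :: "pm \<Rightarrow> nat \<Rightarrow> uhat"
  where "hhat e k = fps_nth (expQ_fps (Abs_fps (\<lambda>r.
    if r = 0 then 0 else ((- 1) ^ (r - 1) / of_nat r) *\<^sub>Q h_el (pm_sign e * int r)))) k"

section \<open>The subrings and the bases\<close>

definition UZ :: "uhat set"
  where "UZ = Z_subalgebra hull {div_power (x_el e r) k | e r k. True}"

definition UZ_pm :: "pm \<Rightarrow> uhat set"
  where "UZ_pm e = Z_subalgebra hull {div_power (x_el e r) k | r k. True}"

definition UZ_00 :: "uhat set"
  where "UZ_00 = Z_subalgebra hull ({binomQ (h_el 0) k | k. True} \<union> {binomQ c_el k | k. True})"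

definition UZ_0pm :: "pm \<Rightarrow> uhat set"
  where "UZ_0pm e = Z_subalgebra hull {hhat e k | k. k > 0}"

definition UZ_0 :: "uhat set"
  where "UZ_0 = Z_subalgebra hull (UZ_0pm Neg \<union> UZ_00 \<union> UZ_0pm Pos)"

text \<open>The factors of the following two products commute; they are multiplied in the order of
  increasing indices.\<close>

definition x_monomial :: "pm \<Rightarrow> (int \<Rightarrow>\<^sub>0 nat) \<Rightarrow> uhat"
  where "x_monomial e k = prod_list (map (\<lambda>r. div_power (x_el e r) (Poly_Mapping.lookup k r))
    (sorted_list_of_set (Poly_Mapping.keys k)))"

definition hhat_monomial :: "pm \<Rightarrow> (nat \<Rightarrow>\<^sub>0 nat) \<Rightarrow> uhat"
  where "hhat_monomial e k = prod_list (map (\<lambda>l. hhat e l ^ Poly_Mapping.lookup k l)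
    (sorted_list_of_set (Poly_Mapping.keys k)))"

definition binom_monomial :: "nat \<times> nat \<Rightarrow> uhat"
  where "binom_monomial = (\<lambda>(k, k'). binomQ (h_el 0) k * binomQ c_el k')"

text \<open>Finitely supported exponent functions on the positive integers.\<close>

definition pos_exponents :: "(nat \<Rightarrow>\<^sub>0 nat) set"
  where "pos_exponents = {k. 0 \<notin> Poly_Mapping.keys k}"

definition B_pm :: "pm \<Rightarrow> uhat set"
  where "B_pm e = range (x_monomial e)"

definition B_0pm :: "pm \<Rightarrow> uhat set"
  where "B_0pm e = hhat_monomial e ` pos_exponents"

definition B_00 :: "uhat set"
  where "B_00 = range binom_monomial"

end

theory Submission
  imports Defs
begin

text \<open>The straightening formula
  \<open>(x\<^sub>r\<^sup>+)\<^sup>(\<^sup>k\<^sup>) (x\<^sub>s\<^sup>-)\<^sup>(\<^sup>l\<^sup>) = \<Sum>\<^sub>i [w\<^sup>i] \<xi>\<^sup>(\<^sup>l\<^sup>-\<^sup>i\<^sup>) K \<eta>\<^sup>(\<^sup>k\<^sup>-\<^sup>i\<^sup>)\<close>, where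
  \<open>\<xi> = \<Sum> (-1)\<^sup>j x\<^sup>-\<^bsub>s+jm\<^esub> w\<^sup>j\<close> and \<open>\<eta> = \<Sum> (-1)\<^sup>j x\<^sup>+\<^bsub>r+jm\<^esub> w\<^sup>j\<close> with \<open>m = r + s\<close> and \<open>K\<close> is the
  exponential series of the brackets \<open>[x\<^sup>+\<^sub>r, x\<^sup>-\<^bsub>s+jm\<^esub>]\<close>, follows from the differential equation of \<open>K\<close>.
  For \<open>m = 0\<close> the coefficients of \<open>K\<close> are binomials of \<open>h\<^sub>0 + rc\<close>; for \<open>m \<noteq> 0\<close> the series \<open>K\<close> arises from
  \<open>hhat\<close> by passing from the power sums \<open>p\<^sub>n\<close> to \<open>p\<^bsub>mn\<^esub>\<close>, which preserves integrality.  With the exchange rules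
  for the Cartan part this gives the triangular decomposition and the spanning sets.  Their independence is
  the Poincare-Birkhoff-Witt theorem, used in this form: a word sorted along the
  triangular decomposition may be evaluated in a commutative algebra, where the images of the \<open>hhat\<close> can be
  chosen as independent variables.  Finally, a tensor product of free abelian groups is free on the
  products of the bases.\<close>

section \<open>Algebras over the rationals\<close>

text \<open>The coefficients of the series do not commute, so identities are not derived by taking
  logarithms: both sides are shown to solve one linear differential equation with the same constant
  term. Heuristically the exchange rules come from one computation. If \<open>T\<close> raises the
  index of a sequence \<open>x\<close> on which the Cartan elements act with weight 2, then the
  bracket with \<open>log K\<close> is \<open>2 log (1 + uT)\<close>, so conjugation by
  \<open>K\<close> is multiplication by \<open>(1 + uT)^2\<close>, which has integral coefficients.
  Two obstacles shape the rest. Exchanging a positive with a negative factor creates new factors of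
  both kinds; the process ends because the total degree of the positive factors never grows, and
  this degree must be carried through all exchange rules for the positive part. In the independence
  proof, binomials in \<open>h_el 0\<close> and \<open>c_el\<close> are not monomials; these two
  elements are therefore evaluated at natural numbers adapted to the given relation, where the
  unwanted binomials vanish.\<close>

lemma scaleQ_zero_right [simp]: "q *\<^sub>Q (0 :: 'a::rat_algebra_1) = 0"
  using scaleQ_add_right[of q "0::'a" 0] by simp

lemma scaleQ_zero_left [simp]: "0 *\<^sub>Q (a :: 'a::rat_algebra_1) = 0"
  using scaleQ_add_left[of 0 0 a] by simp

lemma scaleQ_minus_right [simp]: "q *\<^sub>Q (- a) = - (q *\<^sub>Q (a :: 'a::rat_algebra_1))"
  using scaleQ_add_right[of q a "- a"] by (simp add: add_eq_0_iff)

lemma scaleQ_minus_left [simp]: "(- q) *\<^sub>Q a = - (q *\<^sub>Q (a :: 'a::rat_algebra_1))"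
  using scaleQ_add_left[of q "- q" a] by (simp add: add_eq_0_iff)

lemma scaleQ_diff_right: "q *\<^sub>Q (a - b) = q *\<^sub>Q a - q *\<^sub>Q (b :: 'a::rat_algebra_1)"
  using scaleQ_add_right[of q a "- b"] by simp

lemma scaleQ_diff_left: "(p - q) *\<^sub>Q a = p *\<^sub>Q a - q *\<^sub>Q (a :: 'a::rat_algebra_1)"
  using scaleQ_add_left[of p "- q" a] by simp

lemma scaleQ_sum_right: "q *\<^sub>Q sum f A = (\<Sum>i\<in>A. q *\<^sub>Q (f i :: 'a::rat_algebra_1))"
  by (induction A rule: infinite_finite_induct) (simp_all add: scaleQ_add_right)

lemma of_nat_scaleQ: "of_nat n * a = of_nat n *\<^sub>Q (a :: 'a::rat_algebra_1)"
  by (induction n) (simp_all add: scaleQ_add_left scaleQ_one distrib_right)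

lemma of_int_scaleQ: "of_int n * a = of_int n *\<^sub>Q (a :: 'a::rat_algebra_1)"
  by (cases n rule: int_cases2) (simp_all add: of_nat_scaleQ)

lemma scaleQ_left_commute: "p *\<^sub>Q q *\<^sub>Q a = q *\<^sub>Q p *\<^sub>Q (a :: 'a::rat_algebra_1)"
  by (simp add: scaleQ_scaleQ mult.commute)

lemma scaleQ_cancel_left:
  assumes "q \<noteq> 0" shows "q *\<^sub>Q a = q *\<^sub>Q b \<longleftrightarrow> a = (b :: 'a::rat_algebra_1)"
proof
  assume "q *\<^sub>Q a = q *\<^sub>Q b"
  then have "inverse q *\<^sub>Q q *\<^sub>Q a = inverse q *\<^sub>Q q *\<^sub>Q b" by simp
  then show "a = b" using assms by (simp add: scaleQ_scaleQ scaleQ_one)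
qed simp

lemma of_nat_mult_cancel:
  "of_nat (Suc n) * a = of_nat (Suc n) * b \<longleftrightarrow> a = (b :: 'a::rat_algebra_1)"
  unfolding of_nat_scaleQ by (rule scaleQ_cancel_left) simp

section \<open>The Poincare-Birkhoff-Witt theorem\<close>

text \<open>Second component of the termination measure of the normal form: the swap of a descent
  keeps the length and lowers this number, while the bracket term lowers the length.\<close>

fun inversions :: "'g::linorder list \<Rightarrow> nat" where
  "inversions [] = 0"
| "inversions (x # xs) = length (filter (\<lambda>y. y < x) xs) + inversions xs"

lemma inversions_swap: "b < a \<Longrightarrow> inversions (u @ b # a # v) < inversions (u @ a # b # v)"
  by (induction u) auto

lemma not_sorted_descent:
  "\<not> sorted w \<Longrightarrow> \<exists>u a b v. w = u @ a # b # v \<and> b < (a :: 'g::linorder)"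
proof (induction w)
  case (Cons x w)
  show ?case
  proof (cases "sorted w")
    case True
    with Cons.prems obtain b v where "w = b # v" "b < x"
      by (cases w) force+
    then have "x # w = [] @ x # b # v \<and> b < x" by simp
    then show ?thesis by blast
  next
    case False
    then obtain u a b v where "w = u @ a # b # v" "b < a" using Cons.IH by blast
    then have "x # w = (x # u) @ a # b # v \<and> b < a" by simp
    then show ?thesis by blast
  qed
qed simp

text \<open>Lists represent formal linear combinations without a quotient: two lists are regarded as
  equal when \<open>lin_ext f\<close> agrees on them for every \<open>f\<close>.\<close>

definition lin_ext :: "('g \<Rightarrow> 'p::rat_algebra_1) \<Rightarrow> (rat \<times> 'g) list \<Rightarrow> 'p"
  where "lin_ext f l = (\<Sum>(q, g)\<leftarrow>l. q *\<^sub>Q f g)"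

lemma lin_ext_Nil [simp]: "lin_ext f [] = 0"
  and lin_ext_Cons [simp]: "lin_ext f ((q, g) # l) = q *\<^sub>Q f g + lin_ext f l"
  by (simp_all add: lin_ext_def)

lemma lin_ext_add: "lin_ext (\<lambda>g. f g + f' g) l = lin_ext f l + lin_ext f' l"
  by (induction l) (auto simp: scaleQ_add_right)

lemma lin_ext_diff: "lin_ext (\<lambda>g. f g - f' g) l = lin_ext f l - lin_ext f' l"
  by (induction l) (auto simp: scaleQ_diff_right)

lemma lin_ext_0: "lin_ext (\<lambda>g. 0) l = 0"
  by (induction l) auto

lemma lin_ext_scaleQ: "lin_ext (\<lambda>g. q *\<^sub>Q f g) l = q *\<^sub>Q lin_ext f l"
  by (induction l) (auto simp: scaleQ_add_right scaleQ_left_commute)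

lemma lin_ext_swap: "lin_ext (\<lambda>g. lin_ext (f g) l') l = lin_ext (\<lambda>g'. lin_ext (\<lambda>g. f g g') l) l'"
  by (induction l) (auto simp: lin_ext_add lin_ext_scaleQ lin_ext_0)

text \<open>A congruence rule for the recursive call of \<open>nf\<close>, which stands under
  \<open>lin_ext\<close>.\<close>

lemma lin_ext_cong [fundef_cong]:
  "l = l' \<Longrightarrow> (\<And>q g. (q, g) \<in> set l' \<Longrightarrow> f g = f' g) \<Longrightarrow> lin_ext f l = lin_ext f' l'"
  unfolding lin_ext_def by (intro arg_cong[of _ _ sum_list]) auto

text \<open>An arbitrary choice of the descent to be straightened; \<open>nf_swap\<close> shows that
  every other position gives the same result.\<close>

definition descent :: "'g::linorder list \<Rightarrow> 'g list \<times> 'g \<times> 'g \<times> 'g list" where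
  "descent w = (SOME (u, a, b, v). w = u @ a # b # v \<and> b < a)"

lemma descent:
  assumes "\<not> sorted w" "descent w = (u, a, b, v)"
  shows "w = u @ a # b # v" "b < a"
proof -
  have "case descent w of (u, a, b, v) \<Rightarrow> w = u @ a # b # v \<and> b < a"
    unfolding descent_def
    by (rule someI_ex) (use not_sorted_descent[OF assms(1)] in auto)
  then show "w = u @ a # b # v" "b < a" using assms(2) by auto
qed

lemma split_overlap:
  assumes "u @ a # b # v = u' @ a' # b' # v'" "length u' = Suc (length u)"
  shows "u' = u @ [a] \<and> b = a' \<and> v = b' # v'"
proof -
  have "(u @ [a]) @ b # v = u' @ a' # b' # v'" using assms by simp
  then show ?thesis using assms(2) by (subst (asm) append_eq_append_conv) auto
qed

lemma split_disjoint:
  assumes "u @ a # b # v = u' @ a' # b' # v'" "Suc (Suc (length u)) \<le> length u'"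
  shows "\<exists>t. u' = u @ a # b # t \<and> v = t @ a' # b' # v'"
proof -
  have "(u @ [a, b]) @ v = take (length (u @ [a, b])) u' @ drop (length (u @ [a, b])) u' @ a' # b' # v'"
    using assms(1) by simp
  then have "u @ [a, b] = take (length (u @ [a, b])) u'"
      "v = drop (length (u @ [a, b])) u' @ a' # b' # v'"
    using assms(2) by (subst (asm) append_eq_append_conv; force)+
  then show ?thesis
    by (metis append.assoc append_Cons append_Nil append_take_drop_id)
qed

text \<open>The normal form of a word, with sorted words evaluated in a commutative algebra.  Instead of a
  Lie algebra the locale fixes the brackets of its basis elements, as formal linear combinations.\<close>

locale lie_brackets =
  fixes br :: "'g::linorder \<Rightarrow> 'g \<Rightarrow> (rat \<times> 'g) list"
    and \<psi> :: "'g \<Rightarrow> 'p::{comm_ring_1, rat_algebra_1}"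
  assumes antisym: "\<And>f :: 'g \<Rightarrow> 'p. lin_ext f (br a b) + lin_ext f (br b a) = 0"
    and jacobi: "\<And>f :: 'g \<Rightarrow> 'p. lin_ext (\<lambda>g. lin_ext f (br g c)) (br a b)
      + lin_ext (\<lambda>g. lin_ext f (br g a)) (br b c) + lin_ext (\<lambda>g. lin_ext f (br g b)) (br c a) = 0"
begin

function nf :: "'g list \<Rightarrow> 'p" where
  "nf w = (if sorted w then prod_list (map \<psi> w) else
    case descent w of (u, a, b, v) \<Rightarrow>
      nf (u @ b # a # v) + lin_ext (\<lambda>g. nf (u @ g # v)) (br a b))"
  by auto
termination
proof (relation "inv_image (less_than <*lex*> less_than) (\<lambda>w. (length w, inversions w))", goal_cases)
  case (2 w u y a ya b v)
  then have "w = u @ a # b # v" "b < a" using descent[of w u a b v] by auto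
  then show ?case using inversions_swap[of b a u v] by simp
next
  case (3 w u y a ya b v)
  then have "w = u @ a # b # v" using descent[of w u a b v] by auto
  then show ?case by simp
qed (auto intro!: wf_inv_image)

declare nf.simps [simp del]

abbreviation straighten :: "'g list \<Rightarrow> 'g \<Rightarrow> 'g \<Rightarrow> 'g list \<Rightarrow> 'p" where
  "straighten u a b v \<equiv> nf (u @ b # a # v) + lin_ext (\<lambda>g. nf (u @ g # v)) (br a b)"

text \<open>The two ambiguities of the diamond lemma; the overlapping one is resolved by the Jacobi identity.\<close>

lemma confluent_disjoint:
  assumes short: "\<And>u a b v. length (u @ a # b # v) < n \<Longrightarrow> nf (u @ a # b # v) = straighten u a b v"
    and less: "\<And>u a b v. length (u @ a # b # v) = n \<Longrightarrow> b < a \<Longrightarrow>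
      inversions (u @ a # b # v) < inversions w \<Longrightarrow> nf (u @ a # b # v) = straighten u a b v"
    and w: "w = u @ a # b # t @ a' # b' # v" "length w = n" "b < a" "b' < a'"
  shows "straighten u a b (t @ a' # b' # v) = straighten (u @ a # b # t) a' b' v"
proof -
  have 1: "nf (u @ b # a # t @ a' # b' # v) = straighten (u @ b # a # t) a' b' v"
    using less[of "u @ b # a # t" a' b' v] w inversions_swap[of b a u "t @ a' # b' # v"] by simp
  have 2: "nf (u @ g # t @ a' # b' # v) = straighten (u @ g # t) a' b' v" for g
    using short[of "u @ g # t" a' b' v] w by simp
  have 3: "nf (u @ a # b # t @ b' # a' # v) = straighten u a b (t @ b' # a' # v)"
    using less[of u a b "t @ b' # a' # v"] w inversions_swap[of b' a' "u @ a # b # t" v] by simp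
  have 4: "nf (u @ a # b # t @ g # v) = straighten u a b (t @ g # v)" for g
    using short[of u a b "t @ g # v"] w by simp
  show ?thesis
    using lin_ext_swap[of "\<lambda>g g'. nf (u @ g # t @ g' # v)" "br a' b'" "br a b"]
    by (simp add: 1 2 3 4 lin_ext_add)
qed

lemma confluent_overlap:
  assumes short: "\<And>u a b v. length (u @ a # b # v) < n \<Longrightarrow> nf (u @ a # b # v) = straighten u a b v"
    and less: "\<And>u a b v. length (u @ a # b # v) = n \<Longrightarrow> b < a \<Longrightarrow>
      inversions (u @ a # b # v) < inversions w \<Longrightarrow> nf (u @ a # b # v) = straighten u a b v"
    and w: "w = u @ a # b # c # v" "length w = n" "b < a" "c < b"
  shows "straighten u a b (c # v) = straighten (u @ [a]) b c v"
proof -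
  have i: "inversions (u @ b # a # c # v) < inversions w" "inversions (u @ b # c # a # v) < inversions w"
      "inversions (u @ a # c # b # v) < inversions w" "inversions (u @ c # a # b # v) < inversions w"
    using w inversions_swap[of b a u "c # v"] inversions_swap[of c a "u @ [b]" v]
      inversions_swap[of c b "u @ [a]" v] inversions_swap[of c a u "b # v"] less_trans[of c b a]
    by simp_all
  have 1: "nf (u @ b # a # c # v) = straighten (u @ [b]) a c v"
    using less[of "u @ [b]" a c v] w i by simp
  have 2: "nf (u @ b # c # a # v) = straighten u b c (a # v)"
    using less[of u b c "a # v"] w i by simp
  have 3: "nf (u @ a # c # b # v) = straighten u a c (b # v)"
    using less[of u a c "b # v"] w i by simp
  have 4: "nf (u @ c # a # b # v) = straighten (u @ [c]) a b v"
    using less[of "u @ [c]" a b v] w i by simp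
  define F where "F g = nf (u @ g # v)" for g
  \<comment> \<open>The words produced by a bracket are shorter, so they may be straightened
    whatever the order of \<open>g\<close> and \<open>d\<close>. Hence all single brackets can be
    brought to a common position, and only the double brackets of the Jacobi identity
    remain.\<close>
  have s: "nf (u @ g # d # v) = nf (u @ d # g # v) + lin_ext F (br g d)" for g d
    using short[of u g d v] w by (simp add: F_def[abs_def])
  have as: "lin_ext (\<lambda>g. lin_ext F (br d g)) l = - lin_ext (\<lambda>g. lin_ext F (br g d)) l" for d l
  proof -
    have "lin_ext F (br d g) = 0 - lin_ext F (br g d)" for g
      using antisym[of F d g] by (simp add: eq_neg_iff_add_eq_0)
    then show ?thesis by (simp only: lin_ext_diff lin_ext_0) simp
  qed
  have ca: "lin_ext f (br c a) = - lin_ext f (br a c)" for f :: "'g \<Rightarrow> 'p"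
    using antisym[of f c a] by (simp add: eq_neg_iff_add_eq_0)
  have e1: "lin_ext (\<lambda>g. nf (u @ g # c # v)) (br a b)
      = lin_ext (\<lambda>g. nf (u @ c # g # v)) (br a b) + lin_ext (\<lambda>g. lin_ext F (br g c)) (br a b)"
    by (simp add: s[of _ c] lin_ext_add)
  have e2: "lin_ext (\<lambda>g. nf (u @ g # a # v)) (br b c)
      = lin_ext (\<lambda>g. nf (u @ a # g # v)) (br b c) + lin_ext (\<lambda>g. lin_ext F (br g a)) (br b c)"
    by (simp add: s[of _ a] lin_ext_add)
  have e3: "lin_ext (\<lambda>g. nf (u @ g # b # v)) (br a c)
      = lin_ext (\<lambda>g. nf (u @ b # g # v)) (br a c) + lin_ext (\<lambda>g. lin_ext F (br g b)) (br a c)"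
    by (simp add: s[of _ b] lin_ext_add)
  show ?thesis
    using jacobi[of F c a b] by (simp add: 1 2 3 4 e1 e2 e3 ca algebra_simps)
qed

text \<open>The heart of the Poincare-Birkhoff-Witt theorem: the normal form respects the
  commutation relations at every position. The outer induction is on the length. Descents are
  treated by an inner induction on the inversions, comparing the given position with the one chosen
  by \<open>descent\<close>; ascents follow from antisymmetry.\<close>

lemma nf_swap: "nf (u @ a # b # v) = straighten u a b v"
proof (induction "length (u @ a # b # v)" arbitrary: u a b v rule: less_induct)
  case less
  define n where "n = length (u @ a # b # v)"
  have short: "nf (u @ a # b # v) = straighten u a b v" if "length (u @ a # b # v) < n" for u a b v
    using less that unfolding n_def by blast
  have desc: "nf (u @ a # b # v) = straighten u a b v" if "b < a" "length (u @ a # b # v) = n" for u a b v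
    using that
  proof (induction "inversions (u @ a # b # v)" arbitrary: u a b v rule: less_induct)
    case less
    define w where "w = u @ a # b # v"
    have IH: "nf (u @ a # b # v) = straighten u a b v"
      if "length (u @ a # b # v) = n" "b < a" "inversions (u @ a # b # v) < inversions w" for u a b v
      using less.hyps that unfolding w_def by blast
    have ns: "\<not> sorted w" using less.prems by (auto simp: w_def sorted_append)
    obtain u' a' b' v' where d: "descent w = (u', a', b', v')" by (metis prod_cases4)
    note w' = descent[OF ns d]
    have nfw: "nf w = straighten u' a' b' v'" using ns d by (subst nf.simps) simp
    have wn: "length w = n" using less.prems by (simp add: w_def)
    have eq: "u @ a # b # v = u' @ a' # b' # v'" using w' w_def by simp
    \<comment> \<open>The relative positions of the two descents: equal, sharing one letter, or
      disjoint, the last two from either side.\<close>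
    consider "length u' = length u" | "length u' = Suc (length u)" | "length u' \<ge> Suc (Suc (length u))"
      | "length u = Suc (length u')" | "length u \<ge> Suc (Suc (length u'))" by linarith
    then have "straighten u' a' b' v' = straighten u a b v"
    proof cases
      case 1
      then show ?thesis using eq by simp
    next
      case 2
      then have "u' = u @ [a] \<and> b = a' \<and> v = b' # v'"
        using split_overlap[OF eq 2] by blast
      then show ?thesis
        using confluent_overlap[where w = w and u = u and a = a and b = b and c = b' and v = v', OF short IH] w' w_def wn less.prems by auto
    next
      case 3
      then obtain t where "u' = u @ a # b # t \<and> v = t @ a' # b' # v'"
        using split_disjoint[OF eq 3] by blast
      then show ?thesis
        using confluent_disjoint[where w = w and u = u and a = a and b = b and t = t and a' = a' and b' = b' and v = v', OF short IH] w' w_def wn less.prems by auto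
    next
      case 4
      then have "u = u' @ [a'] \<and> b' = a \<and> v' = b # v"
        using split_overlap[OF eq[symmetric] 4] by simp
      then show ?thesis
        using confluent_overlap[where w = w and u = u' and a = a' and b = b' and c = b and v = v, OF short IH] w' w_def wn less.prems by auto
    next
      case 5
      then obtain t where "u = u' @ a' # b' # t \<and> v' = t @ a # b # v"
        using split_disjoint[OF eq[symmetric] 5] by blast
      then show ?thesis
        using confluent_disjoint[where w = w and u = u' and a = a' and b = b' and t = t and a' = a and b' = b and v = v, OF short IH] w' w_def wn less.prems by auto
    qed
    then show ?case using nfw w_def by simp
  qed
  have anti: "lin_ext f (br b a) = - lin_ext f (br a b)" for f :: "'g \<Rightarrow> 'p"
    using antisym[of f b a] by (simp add: eq_neg_iff_add_eq_0)
  consider "b < a" | "a < b" | "a = b" by fastforce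
  then show ?case
  proof cases
    case 1
    then show ?thesis by (rule desc) (simp add: n_def)
  next
    case 2
    then have "nf (u @ b # a # v) = straighten u b a v" by (rule desc) (simp add: n_def)
    then show ?thesis by (simp add: anti)
  next
    case 3
    \<comment> \<open>Antisymmetry says that twice the bracket of \<open>a\<close> with itself
      vanishes, and 2 is invertible.\<close>
    have "of_nat (Suc 1) * lin_ext f (br a a) = of_nat (Suc 1) * 0" for f :: "'g \<Rightarrow> 'p"
      using antisym[of f a a] by simp
    then have "lin_ext f (br a a) = 0" for f :: "'g \<Rightarrow> 'p"
      by (simp only: of_nat_mult_cancel)
    then show ?thesis using 3 by simp
  qed
qed

lemma nf_sorted: "sorted w \<Longrightarrow> nf w = prod_list (map \<psi> w)"
  by (subst nf.simps) simp

end

text \<open>The order of the triangular decomposition; \<open>Gen_c\<close> gets index 1 to differ from \<open>Gen_h 0\<close> in its block.\<close>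

instantiation gen :: linorder
begin

fun gen_block :: "gen \<Rightarrow> nat" where
  "gen_block (Gen_x Neg r) = 0"
| "gen_block (Gen_h r) = (if r < 0 then 1 else if r = 0 then 2 else 3)"
| "gen_block Gen_c = 2"
| "gen_block (Gen_x Pos r) = 4"

fun gen_index :: "gen \<Rightarrow> int" where
  "gen_index (Gen_x e r) = r"
| "gen_index (Gen_h r) = r"
| "gen_index Gen_c = 1"

definition less_eq_gen :: "gen \<Rightarrow> gen \<Rightarrow> bool" where
  "g \<le> g' \<longleftrightarrow> gen_block g < gen_block g' \<or> gen_block g = gen_block g' \<and> gen_index g \<le> gen_index g'"

definition less_gen :: "gen \<Rightarrow> gen \<Rightarrow> bool" where
  "g < g' \<longleftrightarrow> gen_block g < gen_block g' \<or> gen_block g = gen_block g' \<and> gen_index g < gen_index g'"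

instance
proof
  fix g g' :: gen
  show "g \<le> g' \<Longrightarrow> g' \<le> g \<Longrightarrow> g = g'"
    by (cases g rule: gen_block.cases; cases g' rule: gen_block.cases)
       (auto simp: less_eq_gen_def split: if_splits)
qed (auto simp: less_eq_gen_def less_gen_def)

end

section \<open>The brackets of affine sl2 and the linear map that they induce on the
  quotient\<close>

fun gen_bracket :: "gen \<Rightarrow> gen \<Rightarrow> (rat \<times> gen) list" where
  "gen_bracket (Gen_h r) (Gen_h s) = [(if r + s = 0 then of_int (2 * r) else 0, Gen_c)]"
| "gen_bracket (Gen_h r) (Gen_x e s) = [(of_int (2 * pm_sign e), Gen_x e (r + s))]"
| "gen_bracket (Gen_x e s) (Gen_h r) = [(- of_int (2 * pm_sign e), Gen_x e (r + s))]"
| "gen_bracket (Gen_x Pos r) (Gen_x Neg s) =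
    [(1, Gen_h (r + s)), (if r + s = 0 then of_int r else 0, Gen_c)]"
| "gen_bracket (Gen_x Neg s) (Gen_x Pos r) =
    [(- 1, Gen_h (r + s)), (if r + s = 0 then - of_int r else 0, Gen_c)]"
| "gen_bracket (Gen_x Pos r) (Gen_x Pos s) = []"
| "gen_bracket (Gen_x Neg r) (Gen_x Neg s) = []"
| "gen_bracket Gen_c g = []"
| "gen_bracket g Gen_c = []"

lemma lie_brackets_gen: "lie_brackets TYPE('p::{comm_ring_1, rat_algebra_1}) gen_bracket"
proof
  fix f :: "gen \<Rightarrow> 'p" and a b c
  show "lin_ext f (gen_bracket a b) + lin_ext f (gen_bracket b a) = 0"
    by (cases a rule: gen_block.cases; cases b rule: gen_block.cases)
       (auto simp: add.commute add_eq_0_iff scaleQ_add_left[symmetric])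
  \<comment> \<open>The central terms of the Jacobi identity for \<open>h\<close>,
    \<open>x^+\<close> and \<open>x^-\<close> add up to this multiple of \<open>c\<close>: the
    cocycle condition for modes with sum zero.\<close>
  have k: "of_int r * 2 + (of_int s * 2 + of_int t * 2) = (0 :: rat)" if "s + t = - r" for r s t :: int
    using arg_cong[OF that, of "of_int :: int \<Rightarrow> rat"] by simp
  have m: "(- numeral n) *\<^sub>Q x = - (numeral n *\<^sub>Q x)" for x :: 'p and n
    by simp
  show "lin_ext (\<lambda>g. lin_ext f (gen_bracket g c)) (gen_bracket a b)
      + lin_ext (\<lambda>g. lin_ext f (gen_bracket g a)) (gen_bracket b c)
      + lin_ext (\<lambda>g. lin_ext f (gen_bracket g b)) (gen_bracket c a) = 0"
    by (cases a rule: gen_block.cases; cases b rule: gen_block.cases; cases c rule: gen_block.cases;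
        auto simp: scaleQ_scaleQ scaleQ_one scaleQ_add_right add_eq_0_iff algebra_simps
          scaleQ_add_left[symmetric] scaleQ_diff_left[symmetric] m k simp del: scaleQ_minus_left)
qed

lemma letters_0 [simp]: "letters 0 = []"
  by (simp add: zero_free_monoid_def)

definition free_nf :: "(gen \<Rightarrow> 'p) \<Rightarrow> (gen free_monoid \<Rightarrow>\<^sub>0 rat) \<Rightarrow> 'p::{comm_ring_1, rat_algebra_1}"
  where "free_nf \<psi> p = (\<Sum>w\<in>Poly_Mapping.keys p.
    Poly_Mapping.lookup p w *\<^sub>Q lie_brackets.nf gen_bracket \<psi> (letters w))"

lemma free_nf_superset:
  assumes "finite A" "Poly_Mapping.keys p \<subseteq> A"
  shows "free_nf \<psi> p = (\<Sum>w\<in>A. Poly_Mapping.lookup p w *\<^sub>Q lie_brackets.nf gen_bracket \<psi> (letters w))"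
  unfolding free_nf_def
  by (rule sum.mono_neutral_left) (use assms in \<open>auto simp: in_keys_iff\<close>)

lemma free_nf_add: "free_nf \<psi> (p + q) = free_nf \<psi> p + free_nf \<psi> q"
  using Poly_Mapping.keys_add[of p q]
  by (simp add: free_nf_superset[of "Poly_Mapping.keys p \<union> Poly_Mapping.keys q"] lookup_add
      scaleQ_add_left sum.distrib)

lemma free_nf_single [simp]:
  "free_nf \<psi> (Poly_Mapping.single w q) = q *\<^sub>Q lie_brackets.nf gen_bracket \<psi> (letters w)"
  by (simp add: free_nf_superset[of "{w}"])

lemma free_nf_0 [simp]: "free_nf \<psi> 0 = 0"
  by (simp add: free_nf_def)

lemma free_nf_uminus: "free_nf \<psi> (- p) = - free_nf \<psi> p"
  using free_nf_add[of \<psi> p "- p"] by (simp add: add_eq_0_iff)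

lemma free_nf_diff: "free_nf \<psi> (p - q) = free_nf \<psi> p - free_nf \<psi> q"
  using free_nf_add[of \<psi> p "- q"] by (simp add: free_nf_uminus)

lemma poly_mapping_monomials:
  fixes p :: "'a \<Rightarrow>\<^sub>0 'b::comm_monoid_add"
  shows "p = (\<Sum>w\<in>Poly_Mapping.keys p. Poly_Mapping.single w (Poly_Mapping.lookup p w))"
  by (rule poly_mapping_eqI) (auto simp: lookup_sum lookup_single when_def in_keys_iff)

lemma poly_mapping_monomial_induct:
  fixes p :: "'a \<Rightarrow>\<^sub>0 'b::comm_monoid_add"
  assumes "P 0" "\<And>w q. P (Poly_Mapping.single w q)" "\<And>p p'. P p \<Longrightarrow> P p' \<Longrightarrow> P (p + p')"
  shows "P p"
proof -
  have "P (\<Sum>w\<in>A. Poly_Mapping.single w (Poly_Mapping.lookup p w))" for A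
    using assms by (induction A rule: infinite_finite_induct) auto
  then show ?thesis by (subst poly_mapping_monomials)
qed

text \<open>Brings the five families of relators into one shape, so that a single application of
  \<open>nf_swap\<close> covers them all.\<close>

lemma uhat_relators_bracket:
  assumes "u \<in> uhat_relators"
  obtains a b where "u = free_gen a * free_gen b - free_gen b * free_gen a
    - (\<Sum>(q, g)\<leftarrow>gen_bracket a b. free_const q * free_gen g)"
proof -
  have i: "of_int i = free_const (of_int i)" for i
    by (simp add: free_const_def)
  have "\<exists>a b. u = free_gen a * free_gen b - free_gen b * free_gen a
    - (\<Sum>(q, g)\<leftarrow>gen_bracket a b. free_const q * free_gen g)"
    using assms
  proof cases
    case (c g)
    then show ?thesis by (intro exI[of _ Gen_c] exI[of _ g]) (simp add: bracket_def)
  next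
    case (hh r s)
    then show ?thesis
      by (intro exI[of _ "Gen_h r"] exI[of _ "Gen_h s"]) (auto simp: bracket_def i free_const_def[of 0])
  next
    case (hx r e s)
    then show ?thesis
      by (intro exI[of _ "Gen_h r"] exI[of _ "Gen_x e s"]) (simp add: bracket_def i)
  next
    case (xx e r s)
    then show ?thesis
      by (intro exI[of _ "Gen_x e r"] exI[of _ "Gen_x e s"]) (cases e; simp add: bracket_def)
  next
    case (xpxm r s)
    then show ?thesis
      by (intro exI[of _ "Gen_x Pos r"] exI[of _ "Gen_x Neg s"])
         (auto simp: bracket_def i free_const_1 free_const_def[of 0])
  qed
  with that show thesis by blast
qed

text \<open>Between two monomials a relator is sent to zero by \<open>nf_swap\<close>; the general
  case is linear in each of the outer factors.\<close>

lemma free_nf_ideal: "u \<in> uhat_ideal \<Longrightarrow> free_nf \<psi> u = (0 :: 'p::{comm_ring_1, rat_algebra_1})"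
proof (induction rule: uhat_ideal.induct)
  case (relator u a b)
  interpret lie_brackets gen_bracket \<psi>
    by (rule lie_brackets_gen)
  obtain g g' where u: "u = free_gen g * free_gen g' - free_gen g' * free_gen g
      - (\<Sum>(q, g)\<leftarrow>gen_bracket g g'. free_const q * free_gen g)"
    using relator uhat_relators_bracket by blast
  have lin: "free_nf \<psi> (Poly_Mapping.single w q * (\<Sum>(q, g)\<leftarrow>l. free_const q * free_gen g)
      * Poly_Mapping.single w' q')
      = (q * q') *\<^sub>Q lin_ext (\<lambda>g. nf (letters w @ g # letters w')) l" for w w' q q' l
    by (induction l)
       (auto simp: distrib_left distrib_right free_nf_add free_const_def free_gen_def mult_single
          plus_free_monoid_def scaleQ_add_right scaleQ_scaleQ mult_ac)
  have "free_nf \<psi> (Poly_Mapping.single w q * u * Poly_Mapping.single w' q') = 0" for w w' q q'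
    by (simp add: u left_diff_distrib right_diff_distrib free_nf_diff lin)
       (simp add: free_gen_def mult_single plus_free_monoid_def nf_swap[of _ g g'] scaleQ_add_right)
  then have "free_nf \<psi> (Poly_Mapping.single w q * u * b) = 0" for w q
    by (induction b rule: poly_mapping_monomial_induct) (simp_all add: distrib_left free_nf_add)
  then show ?case
    by (induction a rule: poly_mapping_monomial_induct) (simp_all add: distrib_right free_nf_add)
qed (simp_all add: free_nf_add)

text \<open>The linear map behind PBW: a sorted word of generators is evaluated in a commutative algebra.\<close>

definition symbol :: "(gen \<Rightarrow> 'p) \<Rightarrow> uhat \<Rightarrow> 'p::{comm_ring_1, rat_algebra_1}"
  where "symbol \<psi> u = free_nf \<psi> (rep_uhat u)"

lemma symbol_abs: "symbol \<psi> (abs_uhat p) = free_nf \<psi> p"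
proof -
  have "uhat_eq (rep_uhat (abs_uhat p)) p"
    by (rule Quotient_rep_abs[OF Quotient_uhat uhat_eq_refl])
  then have "free_nf \<psi> (rep_uhat (abs_uhat p) - p) = 0"
    unfolding uhat_eq_def by (rule free_nf_ideal)
  then show ?thesis by (simp add: symbol_def free_nf_diff)
qed

lemma symbol_add: "symbol \<psi> (u + v) = symbol \<psi> u + symbol \<psi> v"
  by (induction u rule: uhat.abs_induct, induction v rule: uhat.abs_induct)
     (simp add: plus_uhat.abs_eq symbol_abs free_nf_add)

lemma symbol_scaleQ: "symbol \<psi> (q *\<^sub>Q u) = q *\<^sub>Q symbol \<psi> u"
proof (induction u rule: uhat.abs_induct)
  case (1 p)
  have "free_nf \<psi> (free_const q * p) = q *\<^sub>Q free_nf \<psi> p"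
    by (induction p rule: poly_mapping_monomial_induct)
       (simp_all add: distrib_left free_nf_add scaleQ_add_right free_const_def mult_single scaleQ_scaleQ)
  then show ?case by (simp add: scaleQ_uhat.abs_eq symbol_abs)
qed

lemma symbol_0 [simp]: "symbol \<psi> 0 = 0"
  using symbol_scaleQ[of \<psi> 0 0] by simp

definition word :: "gen list \<Rightarrow> uhat"
  where "word w = prod_list (map uhat_gen w)"

lemma word_Nil [simp]: "word [] = 1"
  and word_Cons: "word (g # w) = uhat_gen g * word w"
  and word_append: "word (w @ w') = word w * word w'"
  by (simp_all add: word_def)

lemma word_abs: "word w = abs_uhat (Poly_Mapping.single (Monomial w) 1)"
proof (induction w)
  case Nil
  then show ?case
    by (simp add: one_uhat.abs_eq flip: zero_free_monoid_def)
next
  case (Cons g w)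
  then show ?case
    by (simp add: word_Cons uhat_gen.abs_eq times_uhat.abs_eq free_gen_def mult_single plus_free_monoid_def)
qed

lemma symbol_word_sorted: "sorted w \<Longrightarrow> symbol \<psi> (word w) = prod_list (map \<psi> w)"
  by (simp add: word_abs symbol_abs lie_brackets.nf_sorted[OF lie_brackets_gen] scaleQ_one)

section \<open>Relations in the enveloping algebra\<close>

lemma uhat_eq_0_relator: "u \<in> uhat_relators \<Longrightarrow> abs_uhat u = 0"
  using uhat_ideal.relator[of u 1 1] by (simp add: zero_uhat.abs_eq uhat.abs_eq_iff uhat_eq_def)

lemma of_int_uhat: "of_int n = abs_uhat (of_int n)"
proof -
  have "of_nat n = abs_uhat (of_nat n)" for n
    by (induction n) (simp_all add: zero_uhat.abs_eq one_uhat.abs_eq plus_uhat.abs_eq)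
  then show ?thesis
    by (cases n rule: int_cases2) (simp_all add: uminus_uhat.abs_eq)
qed

lemmas uhat_abs = of_int_uhat uhat_gen.abs_eq times_uhat.abs_eq minus_uhat.abs_eq plus_uhat.abs_eq

lemma h_h: "h_el r * h_el s = h_el s * h_el r + of_int (if r + s = 0 then 2 * r else 0) * c_el"
proof -
  have "h_el r * h_el s - h_el s * h_el r - of_int (if r + s = 0 then 2 * r else 0) * c_el = 0"
    using uhat_eq_0_relator[OF uhat_relators.hh[of r s]]
    by (simp only: h_el_def c_el_def uhat_abs bracket_def)
  then show ?thesis by (simp add: algebra_simps)
qed

lemma h_x: "h_el r * x_el e s = x_el e s * h_el r + of_int (2 * pm_sign e) * x_el e (r + s)"
proof -
  have "h_el r * x_el e s - x_el e s * h_el r - of_int (2 * pm_sign e) * x_el e (r + s) = 0"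
    using uhat_eq_0_relator[OF uhat_relators.hx[of r e s]]
    by (simp only: h_el_def x_el_def uhat_abs bracket_def)
  then show ?thesis by (simp add: algebra_simps)
qed

lemma x_x: "x_el e r * x_el e s = x_el e s * x_el e r"
proof -
  have "x_el e r * x_el e s - x_el e s * x_el e r = 0"
    using uhat_eq_0_relator[OF uhat_relators.xx[of e r s]]
    by (simp only: x_el_def uhat_abs bracket_def)
  then show ?thesis by simp
qed

lemma xp_xm: "x_el Pos r * x_el Neg s =
  x_el Neg s * x_el Pos r + h_el (r + s) + of_int (if r + s = 0 then r else 0) * c_el"
proof -
  have "x_el Pos r * x_el Neg s - x_el Neg s * x_el Pos r
      - (h_el (r + s) + of_int (if r + s = 0 then r else 0) * c_el) = 0"
    using uhat_eq_0_relator[OF uhat_relators.xpxm[of r s]]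
    by (simp only: h_el_def x_el_def c_el_def uhat_abs bracket_def)
  then show ?thesis by (simp add: algebra_simps)
qed

lemma uhat_gen_induct [case_names gen one add mult scale]:
  assumes gen: "\<And>g. P (uhat_gen g)" and one: "P 1" and add: "\<And>u v. P u \<Longrightarrow> P v \<Longrightarrow> P (u + v)"
    and mult: "\<And>u v. P u \<Longrightarrow> P v \<Longrightarrow> P (u * v)" and scale: "\<And>q u. P u \<Longrightarrow> P (q *\<^sub>Q u)"
  shows "P u"
proof (induction u rule: uhat.abs_induct)
  case (1 p)
  have w: "P (word w)" for w
    using one mult gen by (induction w) (simp_all add: word_Cons)
  show ?case
  proof (induction p rule: poly_mapping_monomial_induct)
    case 1
    show ?case using scale[OF one, of 0] by (simp add: zero_uhat.abs_eq)
  next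
    case (2 w q)
    have "abs_uhat (Poly_Mapping.single w q) = q *\<^sub>Q word (letters w)"
      by (simp add: word_abs scaleQ_uhat.abs_eq free_const_def mult_single)
    then show ?case using scale[OF w] by simp
  next
    case (3 p p')
    then show ?case using add by (simp flip: plus_uhat.abs_eq)
  qed
qed

lemma c_central: "c_el * u = u * c_el"
proof (induction u rule: uhat_gen_induct)
  case (gen g)
  have "c_el * uhat_gen g - uhat_gen g * c_el = 0"
    using uhat_eq_0_relator[OF uhat_relators.c[of g]] by (simp only: c_el_def uhat_abs bracket_def)
  then show ?case by simp
next
  case (mult u v)
  then show ?case by (metis mult.assoc)
qed (simp_all add: distrib_left distrib_right mult_scaleQ_left mult_scaleQ_right)

lemma h_h_commute: "r + s \<noteq> 0 \<or> r = 0 \<Longrightarrow> h_el r * h_el s = h_el s * h_el r"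
  using h_h[of r s] by auto

text \<open>No central term can arise inside a block: nonzero Cartan modes of one sign never add up
  to zero, and the zero mode has a block of its own, shared only with \<open>c\<close>.\<close>

lemma uhat_gen_commute_block:
  assumes "gen_block g = gen_block g'"
  shows "uhat_gen g * uhat_gen g' = uhat_gen g' * uhat_gen g"
proof (cases g rule: gen_block.cases; cases g' rule: gen_block.cases)
  fix r s assume "g = Gen_h r" "g' = Gen_h s"
  then show ?thesis
    using assms h_h_commute[of r s] by (simp add: h_el_def split: if_splits)
qed (use assms in \<open>auto split: if_splits intro: x_x[unfolded x_el_def] c_central[unfolded c_el_def]
  c_central[unfolded c_el_def, symmetric]\<close>)

lemma word_sort:
  assumes "\<forall>g\<in>set w. gen_block g = b"
  shows "word (sort w) = word w"
  using assms
proof (induction w)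
  case (Cons g w)
  have "word (insort g v) = uhat_gen g * word v" if "\<forall>g'\<in>set v. gen_block g' = gen_block g" for v
    using that
  proof (induction v)
    case (Cons g' v)
    have "uhat_gen g' * uhat_gen g = uhat_gen g * uhat_gen g'"
      using Cons.prems by (intro uhat_gen_commute_block) simp
    then have "uhat_gen g' * (uhat_gen g * word v) = uhat_gen g * (uhat_gen g' * word v)"
      by (metis mult.assoc)
    then show ?case using Cons by (simp add: word_Cons)
  qed (simp add: word_Cons)
  then show ?case using Cons by (simp add: word_Cons)
qed simp

section \<open>Linear independence\<close>

text \<open>A relation in the place of a homomorphism: it couples an expression in the generators of
  one block with its commutative evaluation. Divided powers, binomials and the \<open>hhat\<close>
  can then be evaluated by closure rules alone.\<close>

inductive_set word_pairs :: "(gen \<Rightarrow> 'p) \<Rightarrow> nat \<Rightarrow> (uhat \<times> 'p::{comm_ring_1, rat_algebra_1}) set"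
  for \<psi> b where
  word: "\<forall>g\<in>set w. gen_block g = b \<Longrightarrow> (word w, prod_list (map \<psi> w)) \<in> word_pairs \<psi> b"
| add: "\<lbrakk>(u, p) \<in> word_pairs \<psi> b; (v, q) \<in> word_pairs \<psi> b\<rbrakk> \<Longrightarrow> (u + v, p + q) \<in> word_pairs \<psi> b"
| scale: "(u, p) \<in> word_pairs \<psi> b \<Longrightarrow> (c *\<^sub>Q u, c *\<^sub>Q p) \<in> word_pairs \<psi> b"

lemma word_pairs_one: "(1, 1) \<in> word_pairs \<psi> b"
  using word_pairs.word[of "[]"] by simp

lemma word_pairs_gen: "gen_block g = b \<Longrightarrow> (uhat_gen g, \<psi> g) \<in> word_pairs \<psi> b"
  using word_pairs.word[of "[g]" b \<psi>] by (simp add: word_Cons)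

lemma word_pairs_zero: "(0, 0) \<in> word_pairs \<psi> b"
  using word_pairs.scale[OF word_pairs_one, of 0] by simp

lemma word_pairs_diff:
  "(u, p) \<in> word_pairs \<psi> b \<Longrightarrow> (v, q) \<in> word_pairs \<psi> b \<Longrightarrow> (u - v, p - q) \<in> word_pairs \<psi> b"
  using word_pairs.add[of u p \<psi> b "(-1) *\<^sub>Q v" "(-1) *\<^sub>Q q"] word_pairs.scale[of v q \<psi> b "-1"]
  by (simp add: scaleQ_one)

lemma word_pairs_mult:
  assumes "(u, p) \<in> word_pairs \<psi> b" "(v, q) \<in> word_pairs \<psi> b"
  shows "(u * v, p * q) \<in> word_pairs \<psi> b"
  using assms
proof (induction arbitrary: v q rule: word_pairs.induct)
  case (word w)
  from word(2) show ?case
  proof (induction rule: word_pairs.induct)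
    case (word w')
    then show ?case
      using word_pairs.word[of "w @ w'" b \<psi>] \<open>\<forall>g\<in>set w. gen_block g = b\<close> by (auto simp: word_append)
  qed (simp_all add: distrib_left mult_scaleQ_right word_pairs.add word_pairs.scale)
qed (simp_all add: distrib_right mult_scaleQ_left word_pairs.add word_pairs.scale)

lemma word_pairs_power: "(u, p) \<in> word_pairs \<psi> b \<Longrightarrow> (u ^ n, p ^ n) \<in> word_pairs \<psi> b"
  by (induction n) (simp_all add: word_pairs_one word_pairs_mult)

lemma word_pairs_sum:
  "(\<And>i. i \<in> A \<Longrightarrow> (f i, g i) \<in> word_pairs \<psi> b) \<Longrightarrow> (sum f A, sum g A) \<in> word_pairs \<psi> b"
  by (induction A rule: infinite_finite_induct) (simp_all add: word_pairs_zero word_pairs.add)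

lemma word_pairs_prod_list:
  "(\<And>i. i \<in> set l \<Longrightarrow> (f i, g i) \<in> word_pairs \<psi> b) \<Longrightarrow>
    (prod_list (map f l), prod_list (map g l)) \<in> word_pairs \<psi> b"
  by (induction l) (simp_all add: word_pairs_one word_pairs_mult)

text \<open>Sorting within each block changes neither side, and the blocks are numbered so that the
  concatenation of the sorted blocks is a sorted word.\<close>

lemma symbol_words:
  assumes "\<forall>g\<in>set w0. gen_block g = 0" "\<forall>g\<in>set w1. gen_block g = 1" "\<forall>g\<in>set w2. gen_block g = 2"
    "\<forall>g\<in>set w3. gen_block g = 3" "\<forall>g\<in>set w4. gen_block g = 4"
  shows "symbol \<psi> (word w0 * word w1 * word w2 * word w3 * word w4) =
    prod_list (map \<psi> w0) * prod_list (map \<psi> w1) * prod_list (map \<psi> w2) * prod_list (map \<psi> w3)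
      * prod_list (map \<psi> w4)"
proof -
  let ?w = "sort w0 @ sort w1 @ sort w2 @ sort w3 @ sort w4"
  have s: "sorted ?w"
    using assms by (auto simp: sorted_append less_eq_gen_def)
  have *: "prod_list (map \<psi> (sort w)) = prod_list (map \<psi> w)" for w
    by (metis mset_map mset_sort prod_mset_prod_list)
  have "word w0 * word w1 * word w2 * word w3 * word w4 = word ?w"
    by (simp only: word_append mult.assoc assms[THEN word_sort])
  then show ?thesis
    using symbol_word_sorted[OF s, of \<psi>] by (simp add: * mult.assoc)
qed

text \<open>Both sides are linear in each of the five factors, so one induction per factor leaves
  only words.\<close>

lemma symbol_blocks:
  assumes "(a0, p0) \<in> word_pairs \<psi> 0" "(a1, p1) \<in> word_pairs \<psi> 1" "(a2, p2) \<in> word_pairs \<psi> 2"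
    "(a3, p3) \<in> word_pairs \<psi> 3" "(a4, p4) \<in> word_pairs \<psi> 4"
  shows "symbol \<psi> (a0 * a1 * a2 * a3 * a4) = p0 * p1 * p2 * p3 * p4"
  using assms(1)
proof (induction rule: word_pairs.induct)
  case w0: (word w0)
  from assms(2) show ?case
  proof (induction rule: word_pairs.induct)
    case w1: (word w1)
    from assms(3) show ?case
    proof (induction rule: word_pairs.induct)
      case w2: (word w2)
      from assms(4) show ?case
      proof (induction rule: word_pairs.induct)
        case w3: (word w3)
        from assms(5) show ?case
        proof (induction rule: word_pairs.induct)
          case w4: (word w4)
          show ?case using symbol_words[OF w0 w1 w2 w3 w4] .
        qed (simp_all add: algebra_simps mult_scaleQ_left mult_scaleQ_right symbol_add symbol_scaleQ)
      qed (simp_all add: algebra_simps mult_scaleQ_left mult_scaleQ_right symbol_add symbol_scaleQ)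
    qed (simp_all add: algebra_simps mult_scaleQ_left mult_scaleQ_right symbol_add symbol_scaleQ)
  qed (simp_all add: algebra_simps mult_scaleQ_left mult_scaleQ_right symbol_add symbol_scaleQ)
qed (simp_all add: algebra_simps mult_scaleQ_left mult_scaleQ_right symbol_add symbol_scaleQ)

unbundle fps_syntax

section \<open>Formal power series over a noncommutative algebra\<close>

instantiation fps :: (rat_algebra_1) rat_algebra_1
begin

definition scaleQ_fps :: "rat \<Rightarrow> 'a fps \<Rightarrow> 'a fps"
  where "scaleQ_fps q f = Abs_fps (\<lambda>n. q *\<^sub>Q fps_nth f n)"

instance
  by standard
     (simp_all add: scaleQ_fps_def fps_eq_iff fps_mult_nth scaleQ_add_right scaleQ_add_left scaleQ_scaleQ
        scaleQ_one mult_scaleQ_left mult_scaleQ_right scaleQ_sum_right)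

end

lemma fps_nth_scaleQ [simp]: "fps_nth (q *\<^sub>Q f) n = q *\<^sub>Q fps_nth f n"
  by (simp add: scaleQ_fps_def)

lemma fps_deriv_eqD:
  fixes f g :: "'a::rat_algebra_1 fps"
  shows "fps_deriv f $ n = fps_deriv g $ n \<Longrightarrow> f $ Suc n = g $ Suc n"
  by (simp add: of_nat_mult_cancel del: of_nat_Suc)

text \<open>The equation determines the coefficient \<open>n + 1\<close> from the earlier ones,
  because \<open>n + 1\<close> can be divided out. This is the main tool for identities of series
  below; the factor \<kappa> stays on the left since nothing needs to commute with it.\<close>

lemma fps_ode_left_unique:
  fixes f g \<kappa> :: "'a::rat_algebra_1 fps"
  assumes f: "fps_deriv f = \<kappa> * f" and g: "fps_deriv g = \<kappa> * g" and 0: "f $ 0 = g $ 0"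
  shows "f = g"
proof (rule fps_ext)
  fix n show "f $ n = g $ n"
  proof (induction n rule: less_induct)
    case (less n)
    show ?case
    proof (cases n)
      case (Suc m)
      have "fps_deriv f $ m = fps_deriv g $ m"
        unfolding f g fps_mult_nth by (rule sum.cong) (use less Suc in auto)
      then show ?thesis unfolding Suc by (rule fps_deriv_eqD)
    qed (use 0 in simp)
  qed
qed

lemma fps_const_commute:
  "(\<And>n. a * f $ n = f $ n * a) \<Longrightarrow> fps_const a * f = f * fps_const (a :: 'a::ring_1)"
  by (simp add: fps_eq_iff)

lemma fps_mult_commute:
  assumes "\<And>i j. f $ i * g $ j = g $ j * (f $ i :: 'a::ring_1)"
  shows "f * g = g * f"
proof (rule fps_ext)
  fix n
  have "(f * g) $ n = (\<Sum>i=0..n. f $ (n - i) * g $ i)"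
    unfolding fps_mult_nth by (subst sum.atLeastAtMost_rev) simp
  then show "(f * g) $ n = (g * f) $ n" by (simp add: fps_mult_nth assms)
qed

lemma fps_X_commute: "fps_X * f = f * (fps_X :: 'a::ring_1 fps)"
  by (simp add: fps_eq_iff)

section \<open>Divided powers and binomials\<close>

lemma div_power_0 [simp]: "div_power a 0 = 1"
  by (simp add: div_power_def scaleQ_one)

lemma div_power_1 [simp]: "div_power a (Suc 0) = a"
  by (simp add: div_power_def scaleQ_one)

lemma div_power_Suc: "of_nat (Suc n) * div_power a (Suc n) = a * div_power a n"
  by (simp add: div_power_def of_nat_scaleQ scaleQ_scaleQ mult_scaleQ_right field_simps del: of_nat_Suc)

lemma div_power_commute: "a * b = b * a \<Longrightarrow> div_power a n * b = b * div_power a n"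
  by (simp add: div_power_def mult_scaleQ_left mult_scaleQ_right power_commuting_commutes)

lemma mult_of_nat_left_commute: "a * (of_nat n * b) = of_nat n * (a * (b :: 'a::ring_1))"
  by (metis mult.assoc mult_of_nat_commute)

lemma div_power_mult:
  assumes "a * b = b * a"
  shows "div_power (a * b) n = a ^ n * div_power b n"
proof (induction n)
  case (Suc n)
  have c: "b * a ^ n = a ^ n * b" using power_commuting_commutes[OF assms, of n] by simp
  have "of_nat (Suc n) * div_power (a * b) (Suc n) = a * (b * a ^ n) * div_power b n"
    by (simp only: div_power_Suc Suc.IH mult.assoc)
  also have "\<dots> = a ^ Suc n * (of_nat (Suc n) * div_power b (Suc n))"
    by (simp only: c mult.assoc power_Suc div_power_Suc)
  finally show ?case by (simp only: mult_of_nat_left_commute of_nat_mult_cancel)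
qed simp

lemma fps_deriv_Abs_div_power:
  "fps_deriv (Abs_fps (div_power a)) = fps_const a * Abs_fps (div_power a)"
  by (simp add: fps_eq_iff div_power_Suc del: of_nat_Suc)

text \<open>The divided powers of \<open>a\<close> are the coefficients of \<open>exp (a u)\<close>;
  the claim is the functional equation of the exponential for commuting \<open>a\<close> and
  \<open>b\<close>.\<close>

lemma div_power_add:
  assumes "a * b = b * a"
  shows "div_power (a + b) n = (\<Sum>i=0..n. div_power a i * div_power b (n - i))"
proof -
  let ?A = "Abs_fps (div_power a)" and ?B = "Abs_fps (div_power b)"
  have "fps_deriv (?A * ?B) = fps_const (a + b) * (?A * ?B)"
  proof -
    have "?A * fps_const b = fps_const b * ?A"
      by (rule fps_const_commute[symmetric]) (simp add: div_power_commute assms)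
    then show ?thesis
      by (simp add: fps_deriv_Abs_div_power distrib_right flip: fps_const_add) (simp flip: mult.assoc)
  qed
  then have "Abs_fps (div_power (a + b)) = ?A * ?B"
    by (intro fps_ode_left_unique[OF fps_deriv_Abs_div_power]) simp_all
  from arg_cong[OF this, of "\<lambda>f. f $ n"] show ?thesis by (simp add: fps_mult_nth)
qed

lemma div_power_mult_div_power:
  "div_power a i * div_power a j = of_nat ((i + j) choose i) * div_power a (i + j)"
proof -
  have "(1 / fact i) * (1 / fact j) = of_nat ((i + j) choose i) * (1 / fact (i + j) :: rat)"
    by (simp add: binomial_fact field_simps)
  then show ?thesis
    by (simp add: div_power_def of_nat_scaleQ scaleQ_scaleQ mult_scaleQ_left mult_scaleQ_right power_add
        mult.commute)
qed

lemma fps_deriv_div_power: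
  fixes f :: "'a::rat_algebra_1 fps"
  assumes "fps_deriv f * f = f * fps_deriv f"
  shows "fps_deriv (div_power f (Suc n)) = fps_deriv f * div_power f n"
proof (induction n)
  case (Suc n)
  have "of_nat (Suc (Suc n)) * fps_deriv (div_power f (Suc (Suc n)))
      = fps_deriv (of_nat (Suc (Suc n)) * div_power f (Suc (Suc n)))"
    by (simp only: fps_deriv_mult fps_deriv_of_nat mult_zero_left add_0_right)
  also have "\<dots> = f * fps_deriv f * div_power f n + fps_deriv f * div_power f (Suc n)"
    by (simp only: div_power_Suc fps_deriv_mult Suc mult.assoc)
  also have "\<dots> = fps_deriv f * (of_nat (Suc n) * div_power f (Suc n)) + fps_deriv f * div_power f (Suc n)"
    by (simp only: div_power_Suc mult.assoc flip: assms)
  also have "\<dots> = of_nat (Suc (Suc n)) * (fps_deriv f * div_power f (Suc n))"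
    by (simp only: mult_of_nat_left_commute of_nat_Suc distrib_right distrib_left mult_1_left ac_simps)
  finally show ?case by (simp only: of_nat_mult_cancel)
qed simp

section \<open>Binomials of algebra elements as coefficients of a power of
  \<open>1 + u\<close>\<close>

lemma binomQ_0 [simp]: "binomQ a 0 = 1"
  by (simp add: binomQ_def scaleQ_one)

lemma binomQ_Suc: "of_nat (Suc n) * binomQ a (Suc n) = binomQ a n * (a - of_nat n)"
  by (simp add: binomQ_def of_nat_scaleQ scaleQ_scaleQ mult_scaleQ_left field_simps del: of_nat_Suc)

lemma binomQ_commute: "a * b = b * a \<Longrightarrow> binomQ a n * b = b * binomQ a n"
proof (induction n)
  case (Suc n)
  have "(a - of_nat n) * b = b * (a - of_nat n)"
    using Suc.prems by (simp add: algebra_simps mult_of_nat_commute)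
  then have "of_nat (Suc n) * (binomQ a (Suc n) * b) = of_nat (Suc n) * (b * binomQ a (Suc n))"
    using Suc by (metis (no_types, opaque_lifting) binomQ_Suc mult.assoc mult_of_nat_commute)
  then show ?case by (simp only: of_nat_mult_cancel)
qed simp

text \<open>This is \<open>a / (1 + u)\<close>, the logarithmic derivative of
  \<open>(1 + u)^a\<close>.\<close>

definition binom_exponent :: "'a::ring_1 \<Rightarrow> 'a fps"
  where "binom_exponent a = Abs_fps (\<lambda>n. (- 1) ^ n * a)"

lemma binom_exponent_add: "binom_exponent (a + b) = binom_exponent a + binom_exponent b"
  by (simp add: binom_exponent_def fps_eq_iff distrib_left)

lemma fps_deriv_Abs_binomQ:
  "fps_deriv (Abs_fps (binomQ a)) = binom_exponent a * Abs_fps (binomQ a)"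
proof (rule fps_ext)
  fix n
  have "of_nat (Suc n) * binomQ a (Suc n) = (\<Sum>i=0..n. (- 1) ^ i * a * binomQ a (n - i))"
  proof (induction n)
    case 0
    then show ?case using binomQ_Suc[of 0 a] by simp
  next
    case (Suc n)
    have "of_nat (Suc (Suc n)) * binomQ a (Suc (Suc n)) = a * binomQ a (Suc n) - of_nat (Suc n) * binomQ a (Suc n)"
      by (simp only: binomQ_Suc[of "Suc n"] right_diff_distrib binomQ_commute[OF refl]
          mult_of_nat_commute[of "Suc n"])
    also have "\<dots> = (\<Sum>i=0..Suc n. (- 1) ^ i * a * binomQ a (Suc n - i))"
      unfolding Suc by (subst sum.atLeast0_atMost_Suc_shift) (simp add: sum_negf)
    finally show ?case .
  qed
  then show "fps_deriv (Abs_fps (binomQ a)) $ n = (binom_exponent a * Abs_fps (binomQ a)) $ n"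
    by (simp add: fps_mult_nth binom_exponent_def del: of_nat_Suc)
qed

text \<open>Vandermonde's identity, read off from
  \<open>(1 + u)^(a + b) = (1 + u)^a (1 + u)^b\<close>.\<close>

lemma binomQ_add:
  assumes "a * b = b * a"
  shows "binomQ (a + b) n = (\<Sum>i=0..n. binomQ a i * binomQ b (n - i))"
proof -
  let ?A = "Abs_fps (binomQ a)" and ?B = "Abs_fps (binomQ b)"
  have "?A * binom_exponent b = binom_exponent b * ?A"
    by (rule fps_mult_commute)
       (simp add: binom_exponent_def minus_one_power_iff binomQ_commute assms)
  then have "fps_deriv (?A * ?B) = binom_exponent (a + b) * (?A * ?B)"
    by (simp add: fps_deriv_Abs_binomQ distrib_right binom_exponent_add) (simp flip: mult.assoc)
  then have "Abs_fps (binomQ (a + b)) = ?A * ?B"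
    by (intro fps_ode_left_unique[OF fps_deriv_Abs_binomQ]) simp_all
  from arg_cong[OF this, of "\<lambda>f. f $ n"] show ?thesis by (simp add: fps_mult_nth)
qed

lemma binomQ_of_nat: "binomQ (of_nat m) n = (of_nat (m choose n) :: 'a::rat_algebra_1)"
proof (induction n)
  case (Suc n)
  have "of_nat (m choose n) * (of_nat m - of_nat n) = (of_nat (Suc n * (m choose Suc n)) :: 'a)"
  proof (cases "n \<le> m")
    case True
    then show ?thesis
      by (metis binomial_absorb_comp binomial_absorption mult.commute of_nat_diff of_nat_mult)
  qed (simp add: binomial_eq_0)
  then have "of_nat (Suc n) * binomQ (of_nat m) (Suc n) = of_nat (Suc n) * (of_nat (m choose Suc n) :: 'a)"
    unfolding binomQ_Suc Suc by (simp only: of_nat_mult)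
  then show ?case by (simp only: of_nat_mult_cancel)
qed simp

lemma binomQ_mult_shift:
  "binomQ a k * binomQ (a - of_nat k) j = of_nat ((k + j) choose k) * binomQ a (k + j)"
proof (induction j)
  case (Suc j)
  have "of_nat (Suc j) * (binomQ a k * binomQ (a - of_nat k) (Suc j))
      = binomQ a k * (of_nat (Suc j) * binomQ (a - of_nat k) (Suc j))"
    by (simp only: mult_of_nat_left_commute)
  also have "\<dots> = of_nat ((k + j) choose k) * (binomQ a (k + j) * (a - of_nat (k + j)))"
    unfolding binomQ_Suc using Suc by (simp add: algebra_simps flip: mult.assoc)
  also have "\<dots> = of_nat (((k + j) choose k) * Suc (k + j)) * binomQ a (Suc (k + j))"
    unfolding binomQ_Suc[symmetric] by (simp only: of_nat_mult mult.assoc)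
  also have "((k + j) choose k) * Suc (k + j) = Suc j * ((k + Suc j) choose k)"
    using binomial_absorb_comp[of "k + Suc j" k] by (simp add: mult.commute)
  finally show ?case by (simp only: of_nat_mult mult.assoc of_nat_mult_cancel add_Suc_right)
qed simp

text \<open>Vandermonde's identity for \<open>a = (a - k) + k\<close> expands the second factor into
  binomials of \<open>a - k\<close>, which \<open>binomQ_mult_shift\<close> absorbs into the first
  one. The integral coefficients make the span of the binomials a ring.\<close>

lemma binomQ_mult:
  "binomQ a k * binomQ a l = (\<Sum>i=0..l. of_nat ((k choose (l - i)) * ((k + i) choose k)) * binomQ a (k + i))"
proof -
  have "a - of_nat k + of_nat k = a" by simp
  then have "binomQ a l = (\<Sum>i=0..l. binomQ (a - of_nat k) i * of_nat (k choose (l - i)))"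
    using binomQ_add[of "a - of_nat k" "of_nat k" l] mult_of_nat_commute[of k "a - of_nat k"]
    by (simp only: binomQ_of_nat)
  then have "binomQ a k * binomQ a l = (\<Sum>i=0..l. of_nat (k choose (l - i)) * (binomQ a k * binomQ (a - of_nat k) i))"
    by (simp only: sum_distrib_left mult_of_nat_commute[symmetric] mult.assoc[symmetric])
  then show ?thesis by (simp add: binomQ_mult_shift mult.assoc)
qed

section \<open>The exponential of a series without constant term\<close>

lemma fps_power_nth_eq_0:
  fixes F :: "'a::rat_algebra_1 fps"
  assumes "F $ 0 = 0" "k < n" shows "(F ^ n) $ k = 0"
  using assms(2)
proof (induction n arbitrary: k)
  case (Suc n)
  have "F $ i * (F ^ n) $ (k - i) = 0" if "i \<le> k" for i
    using Suc that assms(1) by (cases "i = 0") auto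
  then show ?case by (simp add: fps_mult_nth)
qed simp

lemma expQ_fps_0 [simp]: "expQ_fps F $ 0 = 1"
  by (simp add: expQ_fps_def scaleQ_one)

lemma fps_deriv_expQ:
  fixes F :: "'a::rat_algebra_1 fps"
  assumes "F $ 0 = 0" and "fps_deriv F * F = F * fps_deriv F"
  shows "fps_deriv (expQ_fps F) = fps_deriv F * expQ_fps F"
proof (rule fps_ext)
  fix k
  \<comment> \<open>The sum defining a coefficient stops at its own index; up to \<open>k\<close>
    all these sums may run to the common bound \<open>k\<close>, since the added terms
    vanish.\<close>
  have e: "expQ_fps F $ j = (\<Sum>n=0..k. div_power F n $ j)" if "j \<le> k" for j
    unfolding expQ_fps_def div_power_def fps_nth_Abs_fps fps_nth_scaleQ
    by (rule sum.mono_neutral_left)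
       (use that fps_power_nth_eq_0[OF assms(1)] in \<open>simp_all add: not_le subset_iff\<close>)
  have "expQ_fps F $ Suc k = (\<Sum>n=0..Suc k. div_power F n $ Suc k)"
    unfolding expQ_fps_def div_power_def by (simp add: atLeast0AtMost)
  then have "fps_deriv (expQ_fps F) $ k = (\<Sum>n=0..Suc k. fps_deriv (div_power F n) $ k)"
    by (simp only: fps_deriv_nth sum_distrib_left Suc_eq_plus1)
  also have "\<dots> = (\<Sum>n=0..k. (fps_deriv F * div_power F n) $ k)"
    by (subst sum.atLeast0_atMost_Suc_shift) (simp add: fps_deriv_div_power assms(2) del: fps_deriv_nth)
  also have "\<dots> = (\<Sum>i=0..k. fps_deriv F $ i * (\<Sum>n=0..k. div_power F n $ (k - i)))"
    unfolding fps_mult_nth sum_distrib_left by (rule sum.swap)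
  finally show "fps_deriv (expQ_fps F) $ k = (fps_deriv F * expQ_fps F) $ k"
    by (simp add: fps_mult_nth e del: fps_deriv_nth)
qed

section \<open>Straightening divided powers\<close>

lemma fps_X_left_commute: "f * (fps_X * g) = fps_X * (f * (g :: 'a::ring_1 fps))"
  by (metis fps_X_commute mult.assoc)

text \<open>Describes \<open>K = exp (\<Sum> (-1)^n g n u^(n+1) / (n+1))\<close> by its logarithmic
  derivative. The series of \<open>hhat\<close>, its inverse and \<open>(1 + u)^a\<close> are all of
  this kind, the last one with a constant \<open>g\<close>.\<close>

locale exp_series =
  fixes g :: "nat \<Rightarrow> 'a::rat_algebra_1" and K :: "'a fps"
  assumes g_comm: "g i * g j = g j * g i"
    and K_deriv: "fps_deriv K = Abs_fps (\<lambda>n. (- 1) ^ n * g n) * K"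
    and K_0: "K $ 0 = 1"
begin

definition \<kappa> :: "'a fps" where "\<kappa> = Abs_fps (\<lambda>n. (- 1) ^ n * g n)"

lemma \<kappa>_nth [simp]: "\<kappa> $ n = (- 1) ^ n * g n"
  by (simp add: \<kappa>_def)

lemma deriv_K: "fps_deriv K = \<kappa> * K"
  by (simp add: K_deriv \<kappa>_def)

text \<open>With \<open>T\<close> sending \<open>x j\<close> to \<open>x (j + 1)\<close>, the
  bracket of the exponent of \<open>K\<close> with \<open>x\<close> is
  \<open>2 log (1 + uT) x\<close>; so conjugation by \<open>K\<close> is the action of
  \<open>(1 + uT)^2\<close>. The proof checks this through the differential equation.\<close>

lemma K_conj:
  assumes gx: "\<And>i j. g i * x j = x j * g i + 2 * x (Suc (i + j))"
  shows "K * fps_const (x j) = (fps_const (x j) + fps_X * (2 * fps_const (x (j + 1)))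
    + fps_X * (fps_X * fps_const (x (j + 2)))) * K"
proof -
  define \<tau> where "\<tau> j = Abs_fps (\<lambda>n. (- 1) ^ n * x (Suc (n + j)))" for j
  define c where "c j = fps_const (x j)" for j
  have \<kappa>c: "\<kappa> * c j = c j * \<kappa> + 2 * \<tau> j" for j
  proof (rule fps_ext)
    fix n
    have "(- 1) ^ n * g n * x j = x j * ((- 1) ^ n * g n) + 2 * ((- 1) ^ n * x (Suc (n + j)))"
      by (simp add: minus_one_power_iff gx)
    then show "(\<kappa> * c j) $ n = (c j * \<kappa> + 2 * \<tau> j) $ n"
      by (simp add: c_def \<tau>_def numeral_fps_const)
  qed
  \<comment> \<open>In terms of the index shift, \<open>\<tau> j\<close> is
    \<open>T / (1 + uT)\<close> applied to \<open>x j\<close>, and this is the equation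
    \<open>(1 + uT) \<tau> j = x (j + 1)\<close>.\<close>
  have \<tau>: "\<tau> j = c (j + 1) - fps_X * \<tau> (j + 1)" for j
  proof (rule fps_ext)
    fix n show "\<tau> j $ n = (c (j + 1) - fps_X * \<tau> (j + 1)) $ n"
      by (cases n) (simp_all add: \<tau>_def c_def)
  qed
  define q where "q = c j + fps_X * (2 * c (j + 1)) + fps_X * (fps_X * c (j + 2))"
  have "\<kappa> * q = q * \<kappa> + 2 * \<tau> j + fps_X * (2 * (2 * \<tau> (j + 1))) + fps_X * (fps_X * (2 * \<tau> (j + 2)))"
    by (simp add: q_def distrib_left distrib_right fps_X_left_commute[of \<kappa>] \<kappa>c mult_2 mult.assoc add_ac)
  also have "\<dots> = q * \<kappa> + 2 * c (j + 1) + fps_X * (2 * c (j + 2))"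
    by (simp add: \<tau>[of j] \<tau>[of "Suc j"] mult_2 distrib_left right_diff_distrib algebra_simps)
  also have "\<dots> = q * \<kappa> + fps_deriv q"
    by (simp add: q_def c_def distrib_left mult_2 add_ac del: fps_const_add)
  finally have \<kappa>q: "\<kappa> * q = q * \<kappa> + fps_deriv q" .
  have "fps_deriv (q * K) = \<kappa> * (q * K)"
    by (simp add: deriv_K \<kappa>q distrib_right flip: mult.assoc)
  moreover have "fps_deriv (K * c j) = \<kappa> * (K * c j)"
    by (simp add: deriv_K c_def mult.assoc)
  moreover have "(K * c j) $ 0 = (q * K) $ 0"
    by (simp add: K_0 q_def c_def)
  ultimately have "K * c j = q * K"
    using fps_ode_left_unique by blast
  then show ?thesis by (simp add: q_def c_def)
qed

text \<open>The factor on the right is \<open>(1 + uT)^(-2) x j\<close>, written as the derivative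
  of \<open>u / (1 + uT)\<close> applied to \<open>x j\<close>. By \<open>K_conj\<close> the
  operator \<open>(1 + uT)^2\<close> annihilates the difference of the two sides, which forces its
  coefficients to vanish from the lowest one on.\<close>

lemma conj_K:
  assumes gx: "\<And>i j. g i * x j = x j * g i + 2 * x (Suc (i + j))"
  shows "fps_const (x j) * K = K * fps_deriv (fps_X * Abs_fps (\<lambda>n. (- 1) ^ n * x (n + j)))"
proof -
  define e where "e j = fps_deriv (fps_X * Abs_fps (\<lambda>n. (- 1) ^ n * x (n + j)))" for j
  define d where "d j = K * e j - fps_const (x j) * K" for j
  have e: "e j + fps_X * (2 * e (j + 1)) + fps_X * (fps_X * e (j + 2)) = fps_const (x j)" for j
  proof (rule fps_ext)
    fix n show "(e j + fps_X * (2 * e (j + 1)) + fps_X * (fps_X * e (j + 2))) $ n = fps_const (x j) $ n"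
      by (cases n rule: nat.exhaust[case_product nat.exhaust]; cases "n - 1")
         (auto simp: e_def minus_one_power_iff numeral_fps_const mult_2 algebra_simps)
  qed
  have "d j + fps_X * (2 * d (j + 1)) + fps_X * (fps_X * d (j + 2))
      = K * (e j + fps_X * (2 * e (j + 1)) + fps_X * (fps_X * e (j + 2)))
      - (fps_const (x j) + fps_X * (2 * fps_const (x (j + 1)))
        + fps_X * (fps_X * fps_const (x (j + 2)))) * K" for j
    by (simp add: d_def distrib_left distrib_right right_diff_distrib left_diff_distrib
        fps_X_left_commute[of K] mult_2 mult.assoc algebra_simps del: fps_const_add)
  then have rec: "d j + fps_X * (2 * d (j + 1)) + fps_X * (fps_X * d (j + 2)) = 0" for j
    by (simp only: e K_conj[OF gx] diff_self)
  have "d j $ n = 0" for n j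
  proof (induction n arbitrary: j rule: less_induct)
    case (less n)
    have "d j $ n = - ((fps_X * (2 * d (j + 1)) + fps_X * (fps_X * d (j + 2))) $ n)"
      using arg_cong[OF rec[of j], of "\<lambda>f. f $ n"]
      by (simp only: fps_add_nth fps_zero_nth eq_neg_iff_add_eq_0 add.assoc)
    also have "\<dots> = 0"
      by (cases n; cases "n - 1") (simp_all add: less numeral_fps_const)
    finally show ?case .
  qed
  then have "d j = 0" by (simp add: fps_eq_iff)
  then show ?thesis by (simp add: d_def e_def)
qed

end

text \<open>Modes in two arithmetic progressions, as supplied by \<open>mixed\<close> below. The
  powers to be exchanged are those of \<open>x 0\<close> and \<open>y 0\<close>; their bracket
  \<open>g 0\<close> and the further brackets bring in the remaining members of the
  progressions.\<close>

locale straightening = exp_series g K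
  for g :: "nat \<Rightarrow> 'a::rat_algebra_1" and K +
  fixes x y :: "nat \<Rightarrow> 'a"
  assumes x_comm: "x i * x j = x j * x i"
    and y_comm: "y i * y j = y j * y i"
    and x_y: "x 0 * y j = y j * x 0 + g j"
    and g_x: "g i * x j = x j * g i + 2 * x (Suc (i + j))"
    and g_y: "g i * y j = y j * g i - 2 * y (Suc (i + j))"
begin

definition \<xi> :: "'a fps" where "\<xi> = Abs_fps (\<lambda>n. (- 1) ^ n * y n)"
definition \<eta> :: "'a fps" where "\<eta> = Abs_fps (\<lambda>n. (- 1) ^ n * x n)"

lemma deriv_\<xi>_comm: "fps_deriv \<xi> * \<xi> = \<xi> * fps_deriv \<xi>"
proof (rule fps_mult_commute)
  fix i j
  show "fps_deriv \<xi> $ i * \<xi> $ j = \<xi> $ j * fps_deriv \<xi> $ i"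
    by (simp add: \<xi>_def minus_one_power_iff y_comm[of "Suc i"] mult_of_nat_left_commute mult.assoc
        del: of_nat_Suc)
qed

lemma deriv_\<eta>_comm: "fps_deriv \<eta> * \<eta> = \<eta> * fps_deriv \<eta>"
proof (rule fps_mult_commute)
  fix i j
  show "fps_deriv \<eta> $ i * \<eta> $ j = \<eta> $ j * fps_deriv \<eta> $ i"
    by (simp add: \<eta>_def minus_one_power_iff x_comm[of "Suc i"] mult_of_nat_left_commute mult.assoc
        del: of_nat_Suc)
qed

lemma x_\<xi>: "fps_const (x 0) * \<xi> = \<xi> * fps_const (x 0) + \<kappa>"
  by (simp add: fps_eq_iff \<xi>_def minus_one_power_iff x_y)

text \<open>All \<open>n + 1\<close> brackets in degree \<open>n\<close> yield the same
  \<open>y (n + 1)\<close> with the same sign, and the factor \<open>n + 1\<close> turns their sum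
  into a derivative.\<close>

lemma \<kappa>_\<xi>: "\<kappa> * \<xi> = \<xi> * \<kappa> + 2 * fps_deriv \<xi>"
proof (rule fps_ext)
  fix n
  have "(\<kappa> * \<xi>) $ n = (\<Sum>i=0..n. \<xi> $ (n - i) * \<kappa> $ i - (- 1) ^ n * 2 * y (Suc n))"
    unfolding fps_mult_nth
  proof (rule sum.cong)
    fix i assume "i \<in> {0..n}"
    then show "\<kappa> $ i * \<xi> $ (n - i) = \<xi> $ (n - i) * \<kappa> $ i - (- 1) ^ n * 2 * y (Suc n)"
      using g_y[of i "n - i"] by (auto simp: \<xi>_def minus_one_power_iff)
  qed simp
  also have "\<dots> = (\<Sum>i=0..n. \<xi> $ (n - i) * \<kappa> $ i) + 2 * fps_deriv \<xi> $ n"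
    by (simp add: sum_subtractf \<xi>_def minus_one_power_iff mult_2 distrib_left distrib_right algebra_simps)
  also have "(\<Sum>i=0..n. \<xi> $ (n - i) * \<kappa> $ i) = (\<xi> * \<kappa>) $ n"
    unfolding fps_mult_nth by (subst sum.atLeastAtMost_rev) simp
  finally show "(\<kappa> * \<xi>) $ n = (\<xi> * \<kappa> + 2 * fps_deriv \<xi>) $ n"
    by (simp add: numeral_fps_const)
qed

lemma \<kappa>_div_power_\<xi>:
  "\<kappa> * div_power \<xi> (Suc a) = div_power \<xi> (Suc a) * \<kappa> + 2 * (fps_deriv \<xi> * div_power \<xi> a)"
proof (induction a)
  case (Suc a)
  have "of_nat (Suc (Suc a)) * (\<kappa> * div_power \<xi> (Suc (Suc a))) = \<kappa> * \<xi> * div_power \<xi> (Suc a)"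
    by (simp only: mult_of_nat_left_commute[symmetric] div_power_Suc mult.assoc)
  also have "\<dots> = \<xi> * div_power \<xi> (Suc a) * \<kappa>
      + 2 * (fps_deriv \<xi> * (\<xi> * div_power \<xi> a)) + 2 * (fps_deriv \<xi> * div_power \<xi> (Suc a))"
    unfolding \<kappa>_\<xi> by (simp add: distrib_right distrib_left mult_2 Suc mult.assoc)
      (simp add: deriv_\<xi>_comm flip: mult.assoc)
  also have "\<dots> = of_nat (Suc (Suc a)) * (div_power \<xi> (Suc (Suc a)) * \<kappa> + 2 * (fps_deriv \<xi> * div_power \<xi> (Suc a)))"
    unfolding div_power_Suc[symmetric] mult_of_nat_left_commute
    by (simp add: distrib_right distrib_left mult_2 mult_of_nat_left_commute mult.assoc add_ac)
  finally show ?case by (simp only: of_nat_mult_cancel)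
qed (simp add: \<kappa>_\<xi>)

text \<open>The bracket of \<open>x 0\<close> with \<xi> is \<kappa>; collecting the \<kappa> on the
  right costs derivatives of \<xi> by \<open>\<kappa>_div_power_\<xi>\<close>, and these combine
  into the derivative of a divided power.\<close>

lemma x_div_power_\<xi>:
  "fps_const (x 0) * div_power \<xi> (Suc a) =
    div_power \<xi> (Suc a) * fps_const (x 0) + div_power \<xi> a * \<kappa> + fps_deriv (div_power \<xi> a)"
proof (induction a)
  case (Suc a)
  let ?c = "fps_const (x 0)"
  have "of_nat (Suc (Suc a)) * (?c * div_power \<xi> (Suc (Suc a))) = ?c * \<xi> * div_power \<xi> (Suc a)"
    by (simp only: mult_of_nat_left_commute[symmetric] div_power_Suc mult.assoc)
  also have "\<dots> = \<xi> * (?c * div_power \<xi> (Suc a)) + \<kappa> * div_power \<xi> (Suc a)"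
    by (simp only: x_\<xi> distrib_right mult.assoc)
  also have "\<dots> = \<xi> * div_power \<xi> (Suc a) * ?c + (\<xi> * div_power \<xi> a * \<kappa> + div_power \<xi> (Suc a) * \<kappa>)
      + (fps_deriv (\<xi> * div_power \<xi> a) + fps_deriv \<xi> * div_power \<xi> a)"
    by (simp add: Suc \<kappa>_div_power_\<xi> mult_2 distrib_left distrib_right mult.assoc add_ac)
  also have "fps_deriv (\<xi> * div_power \<xi> a) = of_nat (Suc a) * (fps_deriv (div_power \<xi> (Suc a)))"
    unfolding div_power_Suc[symmetric] by (simp only: fps_deriv_mult fps_deriv_of_nat mult_zero_left add_0_right)
  also have "fps_deriv \<xi> * div_power \<xi> a = fps_deriv (div_power \<xi> (Suc a))"
    by (simp only: fps_deriv_div_power[OF deriv_\<xi>_comm])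
  also have "\<xi> * div_power \<xi> (Suc a) * ?c = of_nat (Suc (Suc a)) * (div_power \<xi> (Suc (Suc a)) * ?c)"
    by (simp only: div_power_Suc[symmetric] mult.assoc)
  also have "\<xi> * div_power \<xi> a * \<kappa> + div_power \<xi> (Suc a) * \<kappa> = of_nat (Suc (Suc a)) * (div_power \<xi> (Suc a) * \<kappa>)"
    by (simp only: div_power_Suc[symmetric] of_nat_Suc[of "Suc a"] distrib_right mult_1_left mult.assoc add.commute)
  also have "of_nat (Suc a) * (fps_deriv (div_power \<xi> (Suc a))) + fps_deriv (div_power \<xi> (Suc a))
      = of_nat (Suc (Suc a)) * fps_deriv (div_power \<xi> (Suc a))"
    by (simp only: of_nat_Suc[of "Suc a"] distrib_right mult_1_left add.commute)
  finally show ?case by (simp only: of_nat_mult_cancel flip: distrib_left)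
qed (simp add: x_\<xi>)

text \<open>Induction on \<open>k\<close> by multiplication with \<open>x 0\<close> from the left.
  With \<open>G i\<close> the product for \<open>k + 1\<close>, moving \<open>x 0\<close> through
  the summand \<open>i\<close> gives \<open>k + 1 - i\<close> times the coefficient \<open>i\<close>
  of \<open>G i\<close>, and further terms that add up to derivatives of \<open>G (i + 1)\<close>. A
  derivative contributes \<open>i + 1\<close> times the coefficient \<open>i + 1\<close>, so each
  coefficient finally occurs \<open>k + 1\<close> times.\<close>

theorem div_power_straighten:
  "div_power (x 0) k * div_power (y 0) l
    = (\<Sum>i=0..k. ((if i \<le> l then div_power \<xi> (l - i) else 0) * K * div_power \<eta> (k - i)) $ i)"
proof (induction k)
  case 0
  have "div_power f n $ 0 = div_power (f $ 0) n" for f :: "'a fps" and n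
    by (simp add: div_power_def fps_nth_power_0)
  then show ?case by (simp add: K_0 \<xi>_def)
next
  case (Suc k)
  \<comment> \<open>Defined as 0 beyond \<open>l\<close>, so that the exchange rule
    \<open>cD\<close> holds for every \<open>i\<close>, also at the boundary \<open>i = l\<close>,
    where \<open>D i\<close> is 1.\<close>
  define D where "D i = (if i \<le> l then div_power \<xi> (l - i) else 0)" for i
  define E where "E = div_power \<eta>"
  define G where "G i = D i * K * E (Suc k - i)" for i
  let ?c = "fps_const (x 0)"
  have cD: "?c * D i = D i * ?c + D (Suc i) * \<kappa> + fps_deriv (D (Suc i))" for i
  proof (cases "Suc i \<le> l")
    case True
    then show ?thesis using x_div_power_\<xi>[of "l - Suc i"] by (simp add: D_def Suc_diff_Suc)
  next
    case False
    then show ?thesis by (cases "i = l") (simp_all add: D_def)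
  qed
  have cK: "?c * K = K * (\<eta> + fps_X * fps_deriv \<eta>)"
    using conj_K[OF g_x, of 0] by (simp add: \<eta>_def add.commute)
  have e: "(\<eta> + fps_X * fps_deriv \<eta>) * E b = of_nat (Suc b) * E (Suc b) + fps_X * fps_deriv (E (Suc b))" for b
    unfolding E_def div_power_Suc fps_deriv_div_power[OF deriv_\<eta>_comm]
    by (simp only: distrib_right mult.assoc)
  have "?c * (D i * K * E b) = of_nat (Suc b) * (D i * K * E (Suc b))
      + fps_X * (D i * K * fps_deriv (E (Suc b))) + fps_deriv (D (Suc i) * K) * E b" for i b
  proof -
    have "?c * (D i * K * E b) = (?c * D i) * K * E b" by (simp only: mult.assoc)
    also have "\<dots> = D i * ((?c * K) * E b) + fps_deriv (D (Suc i) * K) * E b"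
      by (simp only: cD fps_deriv_mult deriv_K distrib_right mult.assoc add.assoc)
    also have "(?c * K) * E b = K * (of_nat (Suc b) * E (Suc b) + fps_X * fps_deriv (E (Suc b)))"
      by (simp only: cK e mult.assoc)
    finally show ?thesis
      by (simp only: distrib_left mult.assoc mult_of_nat_left_commute[of K] mult_of_nat_left_commute[of "D i"]
          fps_X_left_commute[of K] fps_X_left_commute[of "D i"])
  qed
  note step = this
  have s: "(?c * (D i * K * E (k - i))) $ i = of_nat (Suc k - i) * G i $ i
      + (if i = 0 then 0 else (D i * K * fps_deriv (E (Suc k - i))) $ (i - 1))
      + (fps_deriv (D (Suc i) * K) * E (k - i)) $ i" if "i \<le> k" for i
  proof -
    have "(of_nat m * f) $ i = of_nat m * f $ i" for m and f :: "'a fps"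
      by (simp add: fps_of_nat[symmetric] del: fps_of_nat)
    then show ?thesis
      unfolding step using that by (simp add: G_def Suc_diff_le del: of_nat_Suc fps_deriv_mult)
  qed
  have "of_nat (Suc k) * (div_power (x 0) (Suc k) * div_power (y 0) l)
      = x 0 * (div_power (x 0) k * div_power (y 0) l)"
    by (simp only: div_power_Suc flip: mult.assoc)
  also have "\<dots> = (\<Sum>i=0..k. (?c * (D i * K * E (k - i))) $ i)"
    unfolding Suc by (simp add: sum_distrib_left D_def E_def)
  also have "\<dots> = (\<Sum>i=0..k. of_nat (Suc k - i) * G i $ i)
      + (\<Sum>i=0..k. if i = 0 then 0 else (D i * K * fps_deriv (E (Suc k - i))) $ (i - 1))
      + (\<Sum>i=0..k. (fps_deriv (D (Suc i) * K) * E (k - i)) $ i)"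
    by (simp add: s sum.distrib del: fps_mult_left_const_nth fps_deriv_mult of_nat_diff)
  \<comment> \<open>An index shift: the term added at \<open>i = k + 1\<close> is zero, because
    \<open>E 0\<close> is constant.\<close>
  also have "(\<Sum>i=0..k. if i = 0 then 0 else (D i * K * fps_deriv (E (Suc k - i))) $ (i - 1))
      = (\<Sum>i=0..k. (D (Suc i) * K * fps_deriv (E (k - i))) $ i)"
  proof -
    have "(\<Sum>i=0..k. if i = 0 then 0 else (D i * K * fps_deriv (E (Suc k - i))) $ (i - 1))
      = (\<Sum>i=0..Suc k. if i = 0 then 0 else (D i * K * fps_deriv (E (Suc k - i))) $ (i - 1))"
      by (simp add: E_def)
    then show ?thesis unfolding sum.atLeast0_atMost_Suc_shift by simp
  qed
  also have "(\<Sum>i=0..k. of_nat (Suc k - i) * G i $ i)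
      + (\<Sum>i=0..k. (D (Suc i) * K * fps_deriv (E (k - i))) $ i)
      + (\<Sum>i=0..k. (fps_deriv (D (Suc i) * K) * E (k - i)) $ i)
    = (\<Sum>i=0..k. of_nat (Suc k - i) * G i $ i) + (\<Sum>i=0..k. fps_deriv (G (Suc i)) $ i)"
    by (simp add: G_def sum.distrib add_ac del: fps_deriv_nth)
  also have "(\<Sum>i=0..k. fps_deriv (G (Suc i)) $ i) = (\<Sum>i=0..Suc k. of_nat i * G i $ i)"
    by (subst sum.atLeast0_atMost_Suc_shift) simp
  also have "(\<Sum>i=0..k. of_nat (Suc k - i) * G i $ i) = (\<Sum>i=0..Suc k. of_nat (Suc k - i) * G i $ i)"
    by simp
  also have "(\<Sum>i=0..Suc k. of_nat (Suc k - i) * G i $ i) + (\<Sum>i=0..Suc k. of_nat i * G i $ i)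
      = (\<Sum>i=0..Suc k. of_nat (Suc k) * G i $ i)"
    unfolding sum.distrib[symmetric]
    by (rule sum.cong) (simp_all flip: distrib_right of_nat_add del: of_nat_Suc)
  finally show ?case
    unfolding sum_distrib_left[symmetric] by (simp only: of_nat_mult_cancel G_def D_def E_def)
qed

end

section \<open>Subrings\<close>

lemma Z_subalgebra_hull: "Z_subalgebra (Z_subalgebra hull A)"
  by (rule hull_in) (auto simp: Z_subalgebra_def)

lemma Z_subalgebra_one: "Z_subalgebra S \<Longrightarrow> 1 \<in> S"
  and Z_subalgebra_diff: "Z_subalgebra S \<Longrightarrow> a \<in> S \<Longrightarrow> b \<in> S \<Longrightarrow> a - b \<in> S"
  and Z_subalgebra_mult: "Z_subalgebra S \<Longrightarrow> a \<in> S \<Longrightarrow> b \<in> S \<Longrightarrow> a * b \<in> S"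
  by (auto simp: Z_subalgebra_def)

lemma Z_subalgebra_zero: "Z_subalgebra S \<Longrightarrow> 0 \<in> S"
  using Z_subalgebra_diff[OF _ Z_subalgebra_one Z_subalgebra_one, of S] by simp

lemma Z_subalgebra_minus: "Z_subalgebra S \<Longrightarrow> a \<in> S \<Longrightarrow> - a \<in> S"
  using Z_subalgebra_diff[OF _ Z_subalgebra_zero, of S a] by simp

lemma Z_subalgebra_add: "Z_subalgebra S \<Longrightarrow> a \<in> S \<Longrightarrow> b \<in> S \<Longrightarrow> a + b \<in> S"
  using Z_subalgebra_diff[OF _ _ Z_subalgebra_minus, of S a b] by simp

lemma Z_subalgebra_sum: "Z_subalgebra S \<Longrightarrow> (\<And>i. i \<in> A \<Longrightarrow> f i \<in> S) \<Longrightarrow> sum f A \<in> S"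
  by (induction A rule: infinite_finite_induct) (simp_all add: Z_subalgebra_zero Z_subalgebra_add)

lemma Z_subalgebra_power: "Z_subalgebra S \<Longrightarrow> a \<in> S \<Longrightarrow> a ^ n \<in> S"
  by (induction n) (simp_all add: Z_subalgebra_one Z_subalgebra_mult)

lemma Z_subalgebra_of_nat: "Z_subalgebra S \<Longrightarrow> of_nat n \<in> S"
  by (induction n) (simp_all add: Z_subalgebra_zero Z_subalgebra_one Z_subalgebra_add)

lemma Z_subalgebra_of_int: "Z_subalgebra S \<Longrightarrow> of_int n \<in> S"
  by (cases n rule: int_cases2) (simp_all add: Z_subalgebra_of_nat Z_subalgebra_minus)

lemma Z_subalgebra_prod_list: "Z_subalgebra S \<Longrightarrow> set l \<subseteq> S \<Longrightarrow> prod_list l \<in> S"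
  by (induction l) (simp_all add: Z_subalgebra_one Z_subalgebra_mult)

lemmas Z_subalgebra_intros = Z_subalgebra_one Z_subalgebra_diff Z_subalgebra_mult Z_subalgebra_zero
  Z_subalgebra_minus Z_subalgebra_add Z_subalgebra_sum Z_subalgebra_power Z_subalgebra_of_nat
  Z_subalgebra_of_int

lemma Z_subalgebra_hull_induct [consumes 1, case_names gen one diff mult]:
  assumes "a \<in> Z_subalgebra hull A"
    and "\<And>a. a \<in> A \<Longrightarrow> P a" "P 1" "\<And>a b. P a \<Longrightarrow> P b \<Longrightarrow> P (a - b)" "\<And>a b. P a \<Longrightarrow> P b \<Longrightarrow> P (a * b)"
  shows "P a"
proof -
  have "Z_subalgebra hull A \<subseteq> {a. P a}"
    by (rule hull_minimal) (use assms(2-) in \<open>auto simp: Z_subalgebra_def\<close>)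
  then show ?thesis using assms(1) by auto
qed

lemma Z_subalgebra_hull_commute_with:
  assumes "\<And>a. a \<in> A \<Longrightarrow> a * b = b * a" "a \<in> Z_subalgebra hull A"
  shows "a * b = b * a"
  using assms(2)
proof (induction rule: Z_subalgebra_hull_induct)
  case (mult a c)
  then show ?case by (metis mult.assoc)
qed (simp_all add: assms(1) left_diff_distrib right_diff_distrib)

lemma Z_subalgebra_hull_commute:
  assumes "\<And>a b. a \<in> A \<Longrightarrow> b \<in> B \<Longrightarrow> a * b = b * a" "a \<in> Z_subalgebra hull A" "b \<in> Z_subalgebra hull B"
  shows "a * b = b * a"
proof (rule Z_subalgebra_hull_commute_with[OF _ assms(2)])
  fix a assume "a \<in> A"
  then show "a * b = b * a"
    using Z_subalgebra_hull_commute_with[of B a b] assms by metis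
qed

definition fps_over :: "'a::ring_1 set \<Rightarrow> 'a fps set"
  where "fps_over S = {f. \<forall>n. f $ n \<in> S}"

lemma fps_overD: "f \<in> fps_over S \<Longrightarrow> f $ n \<in> S"
  by (simp add: fps_over_def)

lemma Z_subalgebra_fps_over: "Z_subalgebra S \<Longrightarrow> Z_subalgebra (fps_over S)"
  unfolding Z_subalgebra_def[of "fps_over S"]
  by (auto simp: fps_over_def fps_mult_nth intro: Z_subalgebra_intros)

lemma fps_over_const: "Z_subalgebra S \<Longrightarrow> a \<in> S \<Longrightarrow> fps_const a \<in> fps_over S"
  by (auto simp: fps_over_def Z_subalgebra_zero)

lemma fps_over_X: "Z_subalgebra S \<Longrightarrow> fps_X \<in> fps_over S"
  by (auto simp: fps_over_def fps_X_def Z_subalgebra_zero Z_subalgebra_one)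

lemma fps_over_commute:
  assumes "\<And>a b. a \<in> S \<Longrightarrow> b \<in> S \<Longrightarrow> a * b = b * a" "f \<in> fps_over S" "g \<in> fps_over S"
  shows "f * g = g * f"
  by (rule fps_mult_commute) (use assms in \<open>auto simp: fps_over_def\<close>)

section \<open>Integrality of power sum substitutions\<close>

text \<open>\<open>power_sums F p\<close> says \<open>F(u) = exp (-\<Sum> p\<^sub>n u\<^sup>n / n)\<close>: if \<open>F = \<Prod> (1 - t\<^sub>i u)\<close> then \<open>p\<^sub>n = \<Sum> t\<^sub>i\<^sup>n\<close>.\<close>

definition power_sums :: "'a::rat_algebra_1 fps \<Rightarrow> (nat \<Rightarrow> 'a) \<Rightarrow> bool"
  where "power_sums F p \<longleftrightarrow> F $ 0 = 1 \<and> fps_deriv F = - (Abs_fps (\<lambda>n. p (Suc n)) * F)"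

lemma power_sums_mult:
  assumes F: "power_sums F p" and G: "power_sums G q"
    and c: "F * Abs_fps (\<lambda>n. q (Suc n)) = Abs_fps (\<lambda>n. q (Suc n)) * F"
  shows "power_sums (F * G) (\<lambda>n. p n + q n)"
proof -
  have "fps_deriv (F * G) = - ((Abs_fps (\<lambda>n. p (Suc n)) + Abs_fps (\<lambda>n. q (Suc n))) * (F * G))"
    using F G c by (simp add: power_sums_def distrib_right flip: mult.assoc)
  moreover have "Abs_fps (\<lambda>n. p (Suc n)) + Abs_fps (\<lambda>n. q (Suc n)) = Abs_fps (\<lambda>n. p (Suc n) + q (Suc n))"
    by (simp add: fps_eq_iff)
  ultimately show ?thesis using F G by (simp add: power_sums_def)
qed

lemma power_sums_one: "power_sums 1 (\<lambda>n. 0)"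
  by (simp add: power_sums_def fps_eq_iff)

definition root_factor :: "'a::ring_1 \<Rightarrow> nat \<Rightarrow> 'a fps"
  where "root_factor a k = 1 - fps_const a * fps_X ^ k"

definition root_factor_inv :: "'a::ring_1 \<Rightarrow> nat \<Rightarrow> 'a fps"
  where "root_factor_inv a k = Abs_fps (\<lambda>n. if k dvd n then a ^ (n div k) else 0)"

text \<open>The sum of the \<open>n\<close>-th powers of the \<open>k\<close> roots \<open>t\<close>
  of \<open>t^k = a\<close>, i.e. the power sum belonging to
  \<open>1 - a u^k = \<Prod> (1 - t u)\<close>.\<close>

definition root_power_sum :: "'a::ring_1 \<Rightarrow> nat \<Rightarrow> nat \<Rightarrow> 'a"
  where "root_power_sum a k n = (if k dvd n then of_nat k * a ^ (n div k) else 0)"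

lemma const_X_power_mult_nth:
  "(fps_const a * fps_X ^ k * f) $ n = (if n < k then 0 else a * f $ (n - k))"
  by (simp add: fps_X_power_mult_nth mult.assoc)

lemma root_factor_inverse: "k > 0 \<Longrightarrow> root_factor a k * root_factor_inv a k = 1"
proof (rule fps_ext)
  fix n assume k: "k > 0"
  show "(root_factor a k * root_factor_inv a k) $ n = 1 $ n"
  proof (cases "n < k")
    case True
    then have "k dvd n \<longleftrightarrow> n = 0" using k by (auto dest: dvd_imp_le)
    then show ?thesis
      using True by (simp add: root_factor_def left_diff_distrib const_X_power_mult_nth root_factor_inv_def)
  next
    case False
    then have "k dvd n - k \<longleftrightarrow> k dvd n" by (simp add: dvd_minus_self)
    moreover have "a * a ^ ((n - k) div k) = a ^ (n div k)"
      using False k by (simp add: le_div_geq flip: power_Suc)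
    ultimately show ?thesis
      using False k by (simp add: root_factor_def left_diff_distrib const_X_power_mult_nth root_factor_inv_def)
  qed
qed

lemma power_sums_root_factor:
  assumes k: "k > 0"
  shows "power_sums (root_factor a k) (root_power_sum a k)"
proof -
  let ?P = "Abs_fps (\<lambda>n. root_power_sum a k (Suc n))"
  have "?P * (fps_const a * fps_X ^ k) = fps_const a * fps_X ^ k * ?P"
    by (rule fps_mult_commute)
       (auto simp: root_power_sum_def fps_X_power_nth mult_of_nat_left_commute mult.assoc power_commutes)
  then have "?P * root_factor a k = ?P - fps_const a * fps_X ^ k * ?P"
    by (simp add: root_factor_def right_diff_distrib)
  also have "\<dots> = - fps_deriv (root_factor a k)"
  proof (rule fps_ext)
    fix n
    have d: "(- fps_deriv (root_factor a k)) $ n = (if Suc n = k then of_nat k * a else 0)"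
      using k mult_of_nat_commute[of k a] by (cases "Suc n = k") (auto simp: root_factor_def)
    consider "Suc n < k" | "Suc n = k" | "k \<le> n" by linarith
    then show "(?P - fps_const a * fps_X ^ k * ?P) $ n = (- fps_deriv (root_factor a k)) $ n"
    proof cases
      case 1
      then have "\<not> k dvd Suc n" by (auto dest: dvd_imp_le)
      with 1 show ?thesis
        unfolding d by (simp add: const_X_power_mult_nth root_power_sum_def)
    next
      case 2
      then show ?thesis
        unfolding d using k by (auto simp: const_X_power_mult_nth root_power_sum_def)
    next
      case 3
      then have e: "Suc (n - k) = Suc n - k" by simp
      have "k dvd Suc n - k \<longleftrightarrow> k dvd Suc n"
        using 3 by (simp add: dvd_minus_self)
      moreover have "a * a ^ ((Suc n - k) div k) = a ^ (Suc n div k)"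
        using 3 k by (simp add: le_div_geq flip: power_Suc)
      ultimately show ?thesis
        unfolding d using 3 by (simp add: const_X_power_mult_nth root_power_sum_def e mult_of_nat_left_commute
            del: Suc_diff_le)
    qed
  qed
  finally show ?thesis using k by (simp add: power_sums_def root_factor_def)
qed

lemma power_sums_deriv_nth:
  assumes "power_sums F p"
  shows "of_nat (Suc n) * F $ Suc n = - (\<Sum>i=0..n. p (Suc i) * F $ (n - i))"
proof -
  have "fps_deriv F $ n = - ((Abs_fps (\<lambda>n. p (Suc n)) * F) $ n)"
    using assms by (simp only: power_sums_def fps_neg_nth)
  then show ?thesis by (simp add: fps_mult_nth del: of_nat_Suc)
qed

lemma power_sums_rec:
  assumes "power_sums F p"
  shows "p (Suc n) = - (of_nat (Suc n) * F $ Suc n) - (\<Sum>i<n. p (Suc i) * F $ (n - i))"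
proof -
  have "(\<Sum>i=0..n. p (Suc i) * F $ (n - i)) = (\<Sum>i<n. p (Suc i) * F $ (n - i)) + p (Suc n) * F $ 0"
    by (simp add: atLeast0AtMost lessThan_Suc_atMost[symmetric])
  then show ?thesis
    using power_sums_deriv_nth[OF assms, of n] assms by (simp add: power_sums_def del: of_nat_Suc)
qed

lemma power_sums_vanish:
  assumes F: "power_sums F p" and 0: "\<And>n. 0 < n \<Longrightarrow> n < k \<Longrightarrow> F $ n = 0"
  shows "Suc n < k \<Longrightarrow> p (Suc n) = 0"
proof (induction n rule: less_induct)
  case (less n)
  then show ?case unfolding power_sums_rec[OF F, of n] using 0 by (auto intro!: sum.neutral)
qed

lemma power_sums_vanish_conv:
  assumes F: "power_sums F p" and 0: "\<And>n. 0 < n \<Longrightarrow> n < k \<Longrightarrow> p n = 0"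
  shows "Suc n < k \<Longrightarrow> F $ Suc n = 0"
proof -
  assume "Suc n < k"
  then have "of_nat (Suc n) * F $ Suc n = of_nat (Suc n) * 0"
    unfolding power_sums_deriv_nth[OF F] using 0 by (auto intro!: sum.neutral)
  then show ?thesis by (simp only: of_nat_mult_cancel)
qed

text \<open>The \<open>m\<close>-th powers of the \<open>k\<close>-th roots of \<open>a\<close> run
  through the roots of order \<open>k / g\<close> of \<open>a^(m/g)\<close>, each taken
  \<open>g = gcd k m\<close> times.\<close>

lemma root_power_sum_mult:
  fixes a :: "'a::ring_1"
  assumes "k > 0"
  shows "root_power_sum a k (m * n) =
    of_nat (gcd k m) * root_power_sum (a ^ (m div gcd k m)) (k div gcd k m) n"
proof -
  define g where "g = gcd k m"
  obtain d e where k: "k = g * d" and m: "m = g * e" and cop: "coprime d e" and g0: "g > 0"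
    using assms gcd_coprime_exists[of k m] unfolding g_def by (metis gcd_pos_nat mult.commute less_not_refl)
  have "k dvd m * n \<longleftrightarrow> d dvd e * n" using g0 by (simp add: k m mult.assoc)
  also have "\<dots> \<longleftrightarrow> d dvd n" using cop by (simp add: coprime_dvd_mult_right_iff)
  finally have dvd: "k dvd m * n \<longleftrightarrow> d dvd n" .
  show ?thesis
  proof (cases "d dvd n")
    case True
    then obtain t where t: "n = d * t" by blast
    have d0: "d > 0" using assms k by (cases d) auto
    have "m * n div k = e * t" using g0 d0 by (simp add: k m t)
    moreover have "n div d = t" using d0 t by simp
    moreover have "m div g = e" "k div g = d" using g0 k m by simp_all
    moreover have "of_nat k = of_nat g * (of_nat d :: 'a)" by (simp add: k)
    ultimately show ?thesis
      using True dvd by (simp add: root_power_sum_def mult.assoc flip: g_def power_mult)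
  next
    case False
    have "k div g = d" using g0 k by simp
    then show ?thesis using False dvd by (simp add: root_power_sum_def flip: g_def)
  qed
qed

lemma commuting_power_mult:
  "a * b = b * a \<Longrightarrow> a ^ n * b ^ n = (a * b :: 'a::ring_1) ^ n"
proof (induction n)
  case (Suc n)
  have "b * a ^ n = a ^ n * b" using power_commuting_commutes[of a b n] Suc.prems by simp
  then have "a ^ Suc n * b ^ Suc n = a * b * (a ^ n * b ^ n)"
    by (metis mult.assoc power_Suc)
  then show ?case using Suc by simp
qed simp

locale commutative_subring =
  fixes Z :: "'a::rat_algebra_1 set"
  assumes sub: "Z_subalgebra Z" and comm: "a \<in> Z \<Longrightarrow> b \<in> Z \<Longrightarrow> a * b = b * a"
begin

lemmas intros = Z_subalgebra_intros[OF sub]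
lemmas fps_intros = Z_subalgebra_intros[OF Z_subalgebra_fps_over[OF sub]]
lemma fps_comm: "f \<in> fps_over Z \<Longrightarrow> g \<in> fps_over Z \<Longrightarrow> f * g = g * f"
  by (rule fps_over_commute[OF comm])

lemma root_factor_over: "a \<in> Z \<Longrightarrow> root_factor a k \<in> fps_over Z"
  unfolding root_factor_def by (intro fps_intros fps_over_const[OF sub] fps_over_X[OF sub])

lemma root_factor_inv_over: "a \<in> Z \<Longrightarrow> root_factor_inv a k \<in> fps_over Z"
  by (simp add: root_factor_inv_def fps_over_def intros)

lemma root_power_sum_over: "a \<in> Z \<Longrightarrow> Abs_fps (\<lambda>n. root_power_sum a k (Suc n)) \<in> fps_over Z"
  by (simp add: root_power_sum_def fps_over_def intros)

lemma power_sums_over: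
  assumes "power_sums F p" "F \<in> fps_over Z"
  shows "p (Suc n) \<in> Z"
proof (induction n rule: less_induct)
  case (less n)
  show ?case
    unfolding power_sums_rec[OF assms(1), of n]
    by (intro intros fps_overD[OF assms(2)] less) simp
qed

lemma power_sums_root_factor_inv:
  assumes k: "k > 0" and a: "a \<in> Z"
  shows "power_sums (root_factor_inv a k) (\<lambda>n. - root_power_sum a k n)"
proof -
  let ?P = "Abs_fps (\<lambda>n. root_power_sum a k (Suc n))"
  let ?J = "root_factor a k" and ?I = "root_factor_inv a k"
  have J: "fps_deriv ?J = - (?P * ?J)" using power_sums_root_factor[OF k, of a] by (simp add: power_sums_def)
  have JI: "?J * ?I = 1" using k by (rule root_factor_inverse)
  have IJ: "?I * ?J = 1"
    using JI fps_comm[OF root_factor_inv_over root_factor_over, OF a a] by simp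
  have "fps_deriv (?J * ?I) = 0" unfolding JI by simp
  then have "?J * fps_deriv ?I + - ?P = 0"
    by (simp only: fps_deriv_mult J mult_minus_left mult.assoc, simp only: JI mult_1_right)
  then have "?J * fps_deriv ?I = ?P" by (simp only: add_uminus_conv_diff right_minus_eq)
  then have "?I * (?J * fps_deriv ?I) = ?I * ?P" by simp
  then have "fps_deriv ?I = ?P * ?I"
    using fps_comm[OF root_factor_inv_over root_power_sum_over, OF a a] by (simp add: IJ flip: mult.assoc)
  moreover have "Abs_fps (\<lambda>n. - root_power_sum a k (Suc n)) = - ?P" by (simp add: fps_eq_iff)
  ultimately show ?thesis by (simp add: power_sums_def root_factor_inv_def)
qed

lemma power_sums_power:
  assumes F: "power_sums F p" "F \<in> fps_over Z"
  shows "power_sums (F ^ g) (\<lambda>n. of_nat g * p n)"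
proof (induction g)
  case (Suc g)
  have "power_sums (F * F ^ g) (\<lambda>n. p n + of_nat g * p n)"
    by (rule power_sums_mult[OF F(1) Suc.IH], rule fps_comm)
       (use F power_sums_over[OF F] in \<open>auto simp: fps_over_def intro: intros\<close>)
  then show ?case by (simp add: distrib_right)
qed (simp add: power_sums_one)

text \<open>Downward induction on the order \<open>k\<close> of \<open>F - 1\<close>: splitting off a factor \<open>1 - a u\<^sup>k\<close> of \<open>F\<close> splits off
  \<open>(1 - a\<^bsup>m/g\<^esup> u\<^bsup>k/g\<^esup>)\<^sup>g\<close> of \<open>G\<close>, where \<open>g = gcd k m\<close>.\<close>

lemma power_sum_substitution_aux:
  assumes "m > 0" "k > 0" "power_sums F p" "F \<in> fps_over Z" "\<And>n. 0 < n \<Longrightarrow> n < k \<Longrightarrow> F $ n = 0"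
    "power_sums G (\<lambda>n. p (m * n))" "n \<le> N"
  shows "G $ n \<in> Z"
  using assms
proof (induction "Suc (m * N) - k" arbitrary: k F p G n rule: less_induct)
  case less
  note F = less.prems(3,4) and G = less.prems(6)
  have pZ: "p (Suc n) \<in> Z" for n by (rule power_sums_over[OF F])
  have pmZ: "p (m * Suc n) \<in> Z" for n
    using pZ[of "m * Suc n - 1"] \<open>m > 0\<close> by simp
  show ?case
  proof (cases "m * N < k")
    \<comment> \<open>Here the power sums up to the order \<open>m * N\<close> vanish, hence
      \<open>G\<close> is 1 up to the order \<open>N\<close>.\<close>
    case True
    have p0: "p n = 0" if "0 < n" "n < k" for n
      using power_sums_vanish[OF less.prems(3), of k "n - 1"] less.prems(5) that by simp
    have "p (m * n) = 0" if "0 < n" "n < Suc N" for n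
    proof (rule p0)
      have "m * n \<le> m * N" using that by simp
      then show "m * n < k" using True by linarith
    qed (use that \<open>m > 0\<close> in simp)
    then have "G $ n = 0" if "n > 0"
      using power_sums_vanish_conv[OF G, of "Suc N" "n - 1"] that \<open>n \<le> N\<close> by simp
    then show ?thesis using G by (cases "n = 0") (auto simp: power_sums_def intro: intros)
  next
    case False
    \<comment> \<open>The sign is chosen so that \<open>F = 1 - a u^k + ...\<close>; dividing by
      \<open>1 - a u^k\<close> removes the coefficient of order \<open>k\<close>.\<close>
    define a where "a = - (F $ k)"
    have a: "a \<in> Z" unfolding a_def by (intro intros fps_overD[OF F(2)])
    define F' where "F' = root_factor_inv a k * F"
    define g where "g = gcd k m"
    define b where "b = a ^ (m div g)"
    define d where "d = k div g"
    have b: "b \<in> Z" unfolding b_def by (intro intros a)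
    have g0: "g > 0" and d0: "d > 0"
      using \<open>k > 0\<close> by (simp_all add: g_def d_def div_greater_zero_iff gcd_le1_nat)
    define G' where "G' = root_factor_inv b d ^ g * G"
    have I: "root_factor_inv a k \<in> fps_over Z" "root_factor_inv b d ^ g \<in> fps_over Z"
      by (intro fps_intros root_factor_inv_over a b)+
    have P: "Abs_fps (\<lambda>n. p (Suc n)) \<in> fps_over Z" by (simp add: fps_over_def pZ)
    have F': "power_sums F' (\<lambda>n. - root_power_sum a k n + p n)" "F' \<in> fps_over Z"
      unfolding F'_def
      by (rule power_sums_mult[OF power_sums_root_factor_inv[OF \<open>k > 0\<close> a] F(1) fps_comm[OF I(1) P]])
         (rule Z_subalgebra_mult[OF Z_subalgebra_fps_over[OF sub] I(1) F(2)])
    have "power_sums G' (\<lambda>n. of_nat g * (- root_power_sum b d n) + p (m * n))"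
      unfolding G'_def
      by (rule power_sums_mult[OF power_sums_power[OF power_sums_root_factor_inv[OF d0 b] root_factor_inv_over[OF b]] G])
         (rule fps_comm[OF I(2)], use pmZ in \<open>simp add: fps_over_def\<close>)
    then have G': "power_sums G' (\<lambda>n. - root_power_sum a k (m * n) + p (m * n))"
      by (simp add: root_power_sum_mult[OF \<open>k > 0\<close>] flip: g_def b_def d_def)
    have F'0: "F' $ n = 0" if "0 < n" "n < Suc k" for n
    proof -
      have I0: "root_factor_inv a k $ i = (if i = 0 then 1 else if i = k then a else 0)" if "i \<le> k" for i
        using that \<open>k > 0\<close> by (auto simp: root_factor_inv_def dest: dvd_imp_le)
      have "F' $ n = (\<Sum>i=0..n. (if i = 0 then F $ n else 0) + (if i = k then a else 0))"
        unfolding F'_def fps_mult_nth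
      proof (rule sum.cong)
        fix i assume "i \<in> {0..n}"
        then show "root_factor_inv a k $ i * F $ (n - i) = (if i = 0 then F $ n else 0) + (if i = k then a else 0)"
          using that I0[of i] F(1) \<open>k > 0\<close> by (auto simp: power_sums_def)
      qed simp
      also have "\<dots> = F $ n + (if k \<le> n then a else 0)"
        by (simp add: sum.distrib)
      also have "\<dots> = 0"
        using that less.prems(5)[of n] by (cases "n = k") (auto simp: a_def)
      finally show ?thesis .
    qed
    have G'n: "G' $ i \<in> Z" if "i \<le> N" for i
      by (rule less.hyps[OF _ \<open>m > 0\<close> _ F' F'0 G' that]) (use False in simp_all)
    have "root_factor b d * root_factor_inv b d = 1" by (rule root_factor_inverse[OF d0])
    then have "root_factor b d ^ g * root_factor_inv b d ^ g = 1"
      using fps_comm[OF root_factor_over root_factor_inv_over, OF b b]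
      by (simp add: commuting_power_mult)
    then have "G = root_factor b d ^ g * G'"
      by (simp add: G'_def flip: mult.assoc)
    then have "G $ n = (\<Sum>i=0..n. (root_factor b d ^ g) $ i * G' $ (n - i))"
      by (simp add: fps_mult_nth)
    moreover have "root_factor b d ^ g \<in> fps_over Z" by (intro fps_intros root_factor_over b)
    ultimately show ?thesis
      using G'n \<open>n \<le> N\<close> by (auto intro!: intros simp: fps_overD)
  qed
qed

theorem power_sum_substitution:
  assumes "m > 0" "power_sums F p" "F \<in> fps_over Z" "power_sums G (\<lambda>n. p (m * n))"
  shows "G \<in> fps_over Z"
  using power_sum_substitution_aux[of m 1 F p G n n for n] assms by (auto simp: fps_over_def)

end

section \<open>Additive spans and their products\<close>

inductive_set zspan :: "'a::ab_group_add set \<Rightarrow> 'a set" for A where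
  zero: "0 \<in> zspan A"
| base: "a \<in> A \<Longrightarrow> a \<in> zspan A"
| diff: "a \<in> zspan A \<Longrightarrow> b \<in> zspan A \<Longrightarrow> a - b \<in> zspan A"

lemma zspan_minus: "a \<in> zspan A \<Longrightarrow> - a \<in> zspan A"
  using zspan.diff[OF zspan.zero] by fastforce

lemma zspan_add: "a \<in> zspan A \<Longrightarrow> b \<in> zspan A \<Longrightarrow> a + b \<in> zspan A"
  using zspan.diff[OF _ zspan_minus, of a A b] by simp

lemma zspan_sum: "(\<And>i. i \<in> I \<Longrightarrow> f i \<in> zspan A) \<Longrightarrow> sum f I \<in> zspan A"
  by (induction I rule: infinite_finite_induct) (simp_all add: zspan.zero zspan_add)

lemma zspan_of_nat: "a \<in> zspan A \<Longrightarrow> of_nat n * a \<in> zspan (A :: 'a::ring_1 set)"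
  by (induction n) (simp_all add: zspan.zero zspan_add distrib_right)

lemma zspan_of_int: "a \<in> zspan A \<Longrightarrow> of_int n * a \<in> zspan (A :: 'a::ring_1 set)"
  by (cases n rule: int_cases2) (simp_all add: zspan_of_nat zspan_minus)

lemma zspan_minimal:
  assumes "A \<subseteq> zspan B" shows "zspan A \<subseteq> zspan B"
proof
  fix a assume "a \<in> zspan A" then show "a \<in> zspan B"
    by induction (use assms in \<open>auto intro: zspan.intros\<close>)
qed

lemma zspan_mono: "A \<subseteq> B \<Longrightarrow> zspan A \<subseteq> zspan B"
  by (rule zspan_minimal) (auto intro: zspan.base)

lemma zspan_subset_subalgebra: "Z_subalgebra S \<Longrightarrow> A \<subseteq> S \<Longrightarrow> zspan A \<subseteq> S"
proof
  fix a assume S: "Z_subalgebra S" "A \<subseteq> S" and "a \<in> zspan A"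
  from this(3) show "a \<in> S" by induction (use S in \<open>auto intro: Z_subalgebra_intros\<close>)
qed

lemma span_scaleZ: "module.span scaleZ A = zspan A"
proof -
  interpret module scaleZ by (rule module_scaleZ)
  show ?thesis
  proof
    show "span A \<subseteq> zspan A"
    proof
      fix a assume "a \<in> span A" then show "a \<in> zspan A"
        by (induction rule: span_induct_alt) (auto intro: zspan.intros zspan_add zspan_of_int)
    qed
    show "zspan A \<subseteq> span A"
    proof
      fix a assume "a \<in> zspan A" then show "a \<in> span A"
        by induction (auto intro: span_zero span_base span_diff)
    qed
  qed
qed

definition prod_span :: "'a::ring_1 set \<Rightarrow> 'a set \<Rightarrow> 'a set"  (infixl \<open>\<odot>\<close> 70)
  where "A \<odot> B = zspan {a * b | a b. a \<in> A \<and> b \<in> B}"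

lemma prod_spanI: "a \<in> A \<Longrightarrow> b \<in> B \<Longrightarrow> a * b \<in> A \<odot> B"
  unfolding prod_span_def by (rule zspan.base) blast

lemma prod_span_zero: "0 \<in> A \<odot> B"
  and prod_span_diff: "u \<in> A \<odot> B \<Longrightarrow> v \<in> A \<odot> B \<Longrightarrow> u - v \<in> A \<odot> B"
  and prod_span_sum: "(\<And>i. i \<in> I \<Longrightarrow> f i \<in> A \<odot> B) \<Longrightarrow> sum f I \<in> A \<odot> B"
  unfolding prod_span_def by (auto intro: zspan.intros zspan_add zspan_sum zspan_of_int)

lemma prod_span_induct [consumes 1, case_names zero mult diff]:
  assumes "u \<in> A \<odot> B" "P 0" "\<And>a b. a \<in> A \<Longrightarrow> b \<in> B \<Longrightarrow> P (a * b)"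
    "\<And>u v. P u \<Longrightarrow> P v \<Longrightarrow> P (u - v)"
  shows "P u"
  using assms(1) unfolding prod_span_def by induction (use assms(2-) in auto)

lemma prod_span_mono: "A \<subseteq> A' \<Longrightarrow> B \<subseteq> B' \<Longrightarrow> A \<odot> B \<subseteq> A' \<odot> B'"
  unfolding prod_span_def by (rule zspan_mono) blast

lemma prod_span_mult_left:
  "Z_subalgebra A \<Longrightarrow> a \<in> A \<Longrightarrow> u \<in> A \<odot> B \<Longrightarrow> a * u \<in> A \<odot> B"
proof (rotate_tac 2, induction rule: prod_span_induct)
  case (mult a' b)
  then show ?case using prod_spanI[of "a * a'" A b B] by (simp add: mult.assoc Z_subalgebra_mult)
qed (simp_all add: prod_span_zero right_diff_distrib prod_span_diff)

lemma prod_span_mult_right: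
  "Z_subalgebra B \<Longrightarrow> b \<in> B \<Longrightarrow> u \<in> A \<odot> B \<Longrightarrow> u * b \<in> A \<odot> B"
proof (rotate_tac 2, induction rule: prod_span_induct)
  case (mult a b')
  then show ?case using prod_spanI[of a A "b' * b" B] by (simp add: mult.assoc Z_subalgebra_mult)
qed (simp_all add: prod_span_zero left_diff_distrib prod_span_diff)

lemma prod_span_assoc: "A \<odot> (B \<odot> C) = A \<odot> B \<odot> C"
proof
  show "A \<odot> (B \<odot> C) \<subseteq> A \<odot> B \<odot> C"
  proof
    fix u assume "u \<in> A \<odot> (B \<odot> C)"
    then show "u \<in> A \<odot> B \<odot> C"
    proof (induction rule: prod_span_induct)
      case (mult a v)
      from mult(2) show ?case
      proof (induction rule: prod_span_induct)
        case (mult b c)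
        then show ?case using \<open>a \<in> A\<close> by (metis mult.assoc prod_spanI)
      qed (simp_all add: prod_span_zero right_diff_distrib prod_span_diff)
    qed (simp_all add: prod_span_zero prod_span_diff)
  qed
  show "A \<odot> B \<odot> C \<subseteq> A \<odot> (B \<odot> C)"
  proof
    fix u assume "u \<in> A \<odot> B \<odot> C"
    then show "u \<in> A \<odot> (B \<odot> C)"
    proof (induction rule: prod_span_induct)
      case (mult v c)
      from mult(1) show ?case
      proof (induction rule: prod_span_induct)
        case (mult a b)
        then show ?case using \<open>c \<in> C\<close> by (metis mult.assoc prod_spanI)
      qed (simp_all add: prod_span_zero left_diff_distrib prod_span_diff)
    qed (simp_all add: prod_span_zero prod_span_diff)
  qed
qed

lemma prod_span_subset_subalgebra:
  "Z_subalgebra S \<Longrightarrow> A \<subseteq> S \<Longrightarrow> B \<subseteq> S \<Longrightarrow> A \<odot> B \<subseteq> S"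
  unfolding prod_span_def by (rule zspan_subset_subalgebra) (auto intro: Z_subalgebra_mult)

text \<open>In a product \<open>a b a' b'\<close> only the inner pair has to be exchanged, since
  \<open>A \<odot> B\<close> is stable under \<open>A\<close> from the left and \<open>B\<close>
  from the right.\<close>

lemma prod_span_subalgebra:
  assumes A: "Z_subalgebra A" and B: "Z_subalgebra B"
    and BA: "\<And>a b. a \<in> A \<Longrightarrow> b \<in> B \<Longrightarrow> b * a \<in> A \<odot> B"
  shows "Z_subalgebra (A \<odot> B)"
proof -
  have "u * v \<in> A \<odot> B" if "u \<in> A \<odot> B" "v \<in> A \<odot> B" for u v
    using that(1)
  proof (induction rule: prod_span_induct)
    case ab: (mult a b)
    from that(2) show ?case
    proof (induction rule: prod_span_induct)
      case (mult a' b')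
      have "a * (b * a') * b' \<in> A \<odot> B"
        using ab mult by (intro prod_span_mult_left prod_span_mult_right A B BA)
      then show ?case by (simp add: mult.assoc)
    qed (simp_all add: prod_span_zero right_diff_distrib prod_span_diff)
  qed (simp_all add: prod_span_zero left_diff_distrib prod_span_diff)
  then show ?thesis
    using prod_spanI[OF Z_subalgebra_one[OF A] Z_subalgebra_one[OF B]]
    by (simp add: Z_subalgebra_def prod_span_diff)
qed

lemma subset_prod_span_left: "Z_subalgebra B \<Longrightarrow> A \<subseteq> A \<odot> B"
  using prod_spanI[OF _ Z_subalgebra_one, of _ A B] by auto

lemma subset_prod_span_right: "Z_subalgebra A \<Longrightarrow> B \<subseteq> A \<odot> B"
  using prod_spanI[OF Z_subalgebra_one, of A _ B] by auto

text \<open>\<open>V\<close> is a mere set of elements to be moved. After one exchange the factor on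
  the right lies in \<open>V\<close> again, so the next generator from \<open>X\<close> can be
  passed in the same way.\<close>

lemma move_past_left:
  assumes A: "Z_subalgebra A" and gen: "\<And>b a. b \<in> V \<Longrightarrow> a \<in> X \<Longrightarrow> b * a \<in> A \<odot> V"
    and a: "a \<in> Z_subalgebra hull X" and b: "b \<in> V"
  shows "b * a \<in> A \<odot> V"
  using a b
proof (induction arbitrary: b rule: Z_subalgebra_hull_induct)
  case one
  then show ?case using prod_spanI[OF Z_subalgebra_one[OF A] one] by simp
next
  case (mult a a')
  from mult.IH(1)[OF mult.prems] have "b * a * a' \<in> A \<odot> V"
  proof (induction rule: prod_span_induct)
    case (mult c b')
    then show ?case using prod_span_mult_left[OF A, of c "b' * a'"] mult.IH by (simp add: mult.assoc \<open>\<And>b. b \<in> V \<Longrightarrow> b * a' \<in> A \<odot> V\<close>)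
  qed (simp_all add: prod_span_zero left_diff_distrib prod_span_diff)
  then show ?case by (simp add: mult.assoc)
qed (simp_all add: gen right_diff_distrib prod_span_diff)

text \<open>The complementary induction: now the element that moves is built up from generators,
  while \<open>a\<close> ranges over all of \<open>A\<close>, because each exchange replaces it by a
  new element of \<open>A\<close>.\<close>

lemma move_hull_past_left:
  assumes A: "Z_subalgebra A" and gen: "\<And>b a. b \<in> V \<Longrightarrow> a \<in> A \<Longrightarrow> b * a \<in> A \<odot> V"
    and b: "b \<in> Z_subalgebra hull V" and a: "a \<in> A"
  shows "b * a \<in> A \<odot> (Z_subalgebra hull V)"
  using b a
proof (induction arbitrary: a rule: Z_subalgebra_hull_induct)
  case (gen b)
  then show ?case using assms(2) prod_span_mono[OF subset_refl hull_subset, of A V] by blast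
next
  case one
  then show ?case
    using prod_spanI[OF one Z_subalgebra_one[OF Z_subalgebra_hull]] by simp
next
  case (mult b b')
  from mult.IH(2)[OF mult.prems] have "b * (b' * a) \<in> A \<odot> (Z_subalgebra hull V)"
  proof (induction rule: prod_span_induct)
    case (mult c d)
    then have "b * c * d \<in> A \<odot> (Z_subalgebra hull V)"
      by (intro prod_span_mult_right[OF Z_subalgebra_hull] \<open>\<And>a. a \<in> A \<Longrightarrow> b * a \<in> _\<close>)
    then show ?case by (simp add: mult.assoc)
  qed (simp_all add: prod_span_zero right_diff_distrib prod_span_diff)
  then show ?case by (simp add: mult.assoc)
qed (simp_all add: left_diff_distrib prod_span_diff)

section \<open>Integrality of divided powers of series\<close>

lemma fps_power_nth_cong:
  assumes "\<And>i. i \<le> n \<Longrightarrow> f $ i = g $ i" "j \<le> n"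
  shows "(f ^ k) $ j = (g ^ k) $ (j :: nat)"
  using assms(2)
proof (induction k arbitrary: j)
  case (Suc k)
  then show ?case using assms(1) by (auto simp: fps_mult_nth intro!: sum.cong)
qed simp

lemma div_power_fps_const: "div_power (fps_const a) k = fps_const (div_power a k)"
  by (simp add: div_power_def fps_eq_iff fps_const_power)

text \<open>The intended \<open>S k\<close> is the additive span of the products of divided powers
  of total degree \<open>k\<close>; keeping the degree is what later bounds the positive
  factors.\<close>

locale graded_subring =
  fixes S :: "nat \<Rightarrow> 'a::rat_algebra_1 set"
  assumes one: "1 \<in> S 0" and zero: "0 \<in> S k" and diff: "a \<in> S k \<Longrightarrow> b \<in> S k \<Longrightarrow> a - b \<in> S k"
    and mult: "a \<in> S i \<Longrightarrow> b \<in> S j \<Longrightarrow> a * b \<in> S (i + j)"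
begin

lemma add: "a \<in> S k \<Longrightarrow> b \<in> S k \<Longrightarrow> a + b \<in> S k"
  using diff[OF _ diff[OF zero], of a k b] by simp

lemma sum: "(\<And>i. i \<in> I \<Longrightarrow> f i \<in> S k) \<Longrightarrow> sum f I \<in> S k"
  by (induction I rule: infinite_finite_induct) (simp_all add: zero add)

lemma of_int: "a \<in> S k \<Longrightarrow> of_int n * a \<in> S k"
proof -
  assume a: "a \<in> S k"
  have "of_nat n * a \<in> S k" for n by (induction n) (simp_all add: zero add distrib_right a)
  then show ?thesis using diff[OF zero] by (cases n rule: int_cases2) fastforce+
qed

lemma fps_mult: "f \<in> fps_over (S i) \<Longrightarrow> g \<in> fps_over (S j) \<Longrightarrow> f * g \<in> fps_over (S (i + j))"
  by (auto simp: fps_over_def fps_mult_nth intro!: sum mult)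

text \<open>A divided power of a sum of commuting terms is a sum of products of divided powers,
  without denominators. Each coefficient of the result depends on finitely many terms of
  \<open>f\<close> only, so the rule for finite sums suffices.\<close>

lemma div_power_fps:
  assumes comm: "\<And>i j. f $ i * f $ j = f $ j * f $ i" and dp: "\<And>i k. div_power (f $ i) k \<in> S k"
  shows "div_power f k \<in> fps_over (S k)"
proof -
  have one': "1 \<in> fps_over (S 0)" using one zero by (simp add: fps_over_def)
  have mono: "div_power (fps_const (f $ i) * fps_X ^ i) k \<in> fps_over (S k)" for i k
  proof -
    have "fps_X ^ i * fps_const (f $ i) = fps_const (f $ i) * fps_X ^ i"
      by (rule fps_mult_commute) simp
    then have "div_power (fps_const (f $ i) * fps_X ^ i) k = (fps_X ^ i) ^ k * fps_const (div_power (f $ i) k)"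
      using div_power_mult[of "fps_X ^ i" "fps_const (f $ i)" k] by (simp add: div_power_fps_const)
    then show ?thesis
      using dp zero by (simp add: fps_over_def fps_X_power_mult_nth flip: power_mult)
  qed
  have trunc: "div_power (\<Sum>i<N. fps_const (f $ i) * fps_X ^ i) k \<in> fps_over (S k)" for N k
  proof (induction N arbitrary: k)
    case 0
    then show ?case using one' by (cases k) (simp_all add: div_power_def zero_power fps_over_def zero scaleQ_one)
  next
    case (Suc N)
    let ?t = "\<Sum>i<N. fps_const (f $ i) * fps_X ^ i" and ?m = "fps_const (f $ N) * fps_X ^ N"
    have "?t * ?m = ?m * ?t"
    proof (rule fps_mult_commute)
      fix a b
      show "?t $ a * ?m $ b = ?m $ b * ?t $ a"
        by (simp add: fps_sum_nth sum_distrib_left sum_distrib_right comm if_distrib cong: if_cong)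
    qed
    then have "div_power (?t + ?m) k = (\<Sum>i=0..k. div_power ?t i * div_power ?m (k - i))"
      by (rule div_power_add)
    moreover have "div_power ?t i * div_power ?m (k - i) \<in> fps_over (S k)" if "i \<le> k" for i
      using fps_mult[OF Suc.IH mono[of N "k - i"], of i] that by simp
    ultimately show ?case by (auto simp: fps_over_def fps_sum_nth intro!: sum)
  qed
  have "div_power f k $ n \<in> S k" for n
  proof -
    define t where "t = (\<Sum>i<Suc n. fps_const (f $ i) * fps_X ^ i)"
    have "f $ i = t $ i" if "i \<le> n" for i
      using that unfolding t_def by (simp add: fps_sum_nth if_distrib cong: if_cong)
    then have "(f ^ k) $ n = (t ^ k) $ n" by (rule fps_power_nth_cong[OF _ order_refl])
    then have "div_power f k $ n = div_power t k $ n" by (simp add: div_power_def)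
    then show ?thesis using fps_overD[OF trunc[of "Suc n" k], of n] by (simp only: t_def)
  qed
  then show ?thesis by (simp add: fps_over_def)
qed

end

lemma zspan_mult:
  assumes "\<And>a b. a \<in> A \<Longrightarrow> b \<in> B \<Longrightarrow> a * b \<in> zspan C" "u \<in> zspan A" "v \<in> zspan B"
  shows "u * v \<in> zspan (C :: 'a::ring_1 set)"
  using assms(2)
proof induction
  case (base a)
  from assms(3) show ?case
    by induction (use base assms(1) in \<open>auto simp: right_diff_distrib intro: zspan.intros\<close>)
qed (auto simp: left_diff_distrib intro: zspan.intros)

section \<open>Exponential series of commuting elements\<close>

text \<open>The index is shifted: \<open>g n\<close> belongs to the power \<open>n + 1\<close>, as
  in the normalisation of \<open>exp_series\<close>.\<close>

definition exp_of :: "(nat \<Rightarrow> 'a::rat_algebra_1) \<Rightarrow> 'a fps"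
  where "exp_of g = expQ_fps (Abs_fps (\<lambda>n. if n = 0 then 0 else ((- 1) ^ (n - 1) / of_nat n) *\<^sub>Q g (n - 1)))"

lemma exp_series_exp_of:
  assumes comm: "\<And>i j. g i * g j = g j * g i"
  shows "exp_series g (exp_of g)"
proof
  let ?F = "Abs_fps (\<lambda>n. if n = 0 then 0 else ((- 1) ^ (n - 1) / of_nat n) *\<^sub>Q g (n - 1))"
  have d: "fps_deriv ?F = Abs_fps (\<lambda>n. (- 1) ^ n * g n)"
  proof (rule fps_ext)
    fix n
    have "of_nat (Suc n) * (((- 1) ^ n / of_nat (Suc n)) *\<^sub>Q g n) = (- 1) ^ n *\<^sub>Q g n"
      by (simp add: of_nat_scaleQ scaleQ_scaleQ del: of_nat_Suc)
    then show "fps_deriv ?F $ n = Abs_fps (\<lambda>n. (- 1) ^ n * g n) $ n"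
      by (simp add: minus_one_power_iff scaleQ_one del: of_nat_Suc)
  qed
  have "fps_deriv ?F * ?F = ?F * fps_deriv ?F"
    unfolding d by (rule fps_mult_commute) (simp add: minus_one_power_iff mult_scaleQ_left mult_scaleQ_right comm)
  then show "fps_deriv (exp_of g) = Abs_fps (\<lambda>n. (- 1) ^ n * g n) * exp_of g"
    unfolding exp_of_def by (subst fps_deriv_expQ) (simp_all add: d)
qed (simp_all add: comm exp_of_def)

context exp_series
begin

lemma K_commute: "(\<And>i. g i * b = b * g i) \<Longrightarrow> K $ n * b = b * K $ n"
proof -
  assume b: "\<And>i. g i * b = b * g i"
  have "fps_const b * \<kappa> = \<kappa> * fps_const b"
    by (rule fps_const_commute) (simp add: minus_one_power_iff b)
  then have "fps_deriv (fps_const b * K) = \<kappa> * (fps_const b * K)"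
    by (simp add: deriv_K flip: mult.assoc)
  moreover have "fps_deriv (K * fps_const b) = \<kappa> * (K * fps_const b)"
    by (simp add: deriv_K mult.assoc)
  ultimately have "K * fps_const b = fps_const b * K"
    using fps_ode_left_unique[of "K * fps_const b" \<kappa> "fps_const b * K"] by (simp add: K_0)
  from arg_cong[OF this, of "\<lambda>f. f $ n"] show ?thesis by simp
qed

lemma K_unique: "exp_series g K' \<Longrightarrow> K' = K"
proof -
  assume "exp_series g K'"
  then interpret L: exp_series g K' .
  show ?thesis
    by (rule fps_ode_left_unique[OF L.K_deriv K_deriv]) (simp add: K_0 L.K_0)
qed

lemma K_inverse:
  assumes "exp_series (\<lambda>n. - g n) K'"
  shows "K * K' = 1" "K' * K = 1"
proof -
  interpret L: exp_series "\<lambda>n. - g n" K' by (fact assms)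
  have L: "L.\<kappa> = - \<kappa>" by (simp add: fps_eq_iff)
  have "\<kappa> * K = K * \<kappa>"
    by (rule fps_mult_commute) (simp add: minus_one_power_iff K_commute g_comm)
  then have "fps_deriv (K * K') = 0 * (K * K')"
    by (simp add: deriv_K L.deriv_K L flip: mult.assoc)
  then show "K * K' = 1"
    using fps_ode_left_unique[of "K * K'" 0 1] by (simp add: K_0 L.K_0)
  moreover have "g i * K' $ j = K' $ j * g i" for i j
    by (rule L.K_commute[symmetric]) (simp add: g_comm)
  then have "K * K' = K' * K"
    by (intro fps_mult_commute K_commute)
  ultimately show "K' * K = 1" by simp
qed

text \<open>The polynomial \<open>(1 + uT)^2 x 0\<close> of \<open>K_conj\<close>.\<close>

definition shift :: "(nat \<Rightarrow> 'a) \<Rightarrow> 'a fps"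
  where "shift x = fps_const (x 0) + fps_X * (2 * fps_const (x 1)) + fps_X * (fps_X * fps_const (x 2))"

lemma shift_nth: "shift x $ n = (if n = 0 then x 0 else if n = 1 then 2 * x 1 else if n = 2 then x 2 else 0)"
  by (cases n; cases "n - 1") (auto simp: shift_def numeral_fps_const)

lemma K_conj_div_power:
  assumes gx: "\<And>i j. g i * x j = x j * g i + 2 * x (Suc (i + j))"
  shows "K * fps_const (div_power (x 0) k) = div_power (shift x) k * K"
proof -
  have *: "K * fps_const (x 0) = shift x * K"
    using K_conj[of x 0, OF gx] by (simp add: shift_def numeral_2_eq_2)
  have "K * fps_const (x 0) ^ k = shift x ^ k * K"
  proof (induction k)
    case (Suc k)
    have "K * fps_const (x 0) ^ Suc k = shift x * (K * fps_const (x 0) ^ k)"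
      by (simp only: power_Suc * flip: mult.assoc)
    then show ?case by (simp only: Suc power_Suc mult.assoc)
  qed simp
  then show ?thesis
    by (simp only: flip: div_power_fps_const)
       (simp only: div_power_def mult_scaleQ_left mult_scaleQ_right)
qed

end

lemma binomQ_intertwine:
  assumes "a * y = y * a'"
  shows "binomQ a k * y = y * binomQ a' k"
proof (induction k)
  case (Suc k)
  have "(a - of_nat k) * y = y * (a' - of_nat k)"
    using assms by (simp add: algebra_simps mult_of_nat_commute[of k y])
  then have "of_nat (Suc k) * (binomQ a (Suc k) * y) = binomQ a k * y * (a' - of_nat k)"
    by (simp only: mult.assoc[symmetric] binomQ_Suc) (simp only: mult.assoc)
  also have "\<dots> = of_nat (Suc k) * (y * binomQ a' (Suc k))"
    by (simp only: Suc mult.assoc flip: binomQ_Suc) (simp only: mult_of_nat_left_commute)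
  finally show ?case by (simp only: of_nat_mult_cancel)
qed simp

text \<open>\<open>(1 + u)^(-a)\<close> is the inverse of a series with constant term 1, so its
  coefficients are obtained recursively without division.\<close>

lemma binomQ_minus_mem:
  assumes S: "Z_subalgebra S" and a: "\<And>k. binomQ a k \<in> S"
  shows "binomQ (- a) k \<in> S"
proof (induction k rule: less_induct)
  case (less k)
  have "(\<Sum>i=0..k. binomQ a i * binomQ (- a) (k - i)) = (if k = 0 then 1 else 0)"
    using binomQ_add[of a "- a" k] binomQ_of_nat[of 0 k, where ?'a = 'a] by (cases k) simp_all
  then have "binomQ (- a) k = (if k = 0 then 1 else 0) - (\<Sum>i=Suc 0..k. binomQ a i * binomQ (- a) (k - i))"
    by (simp add: sum.atLeast_Suc_atMost eq_diff_eq)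
  also have "\<dots> \<in> S"
    by (intro Z_subalgebra_intros[OF S]) (auto intro!: Z_subalgebra_intros[OF S] a less)
  finally show ?case .
qed

lemma Z_subalgebra_range_of_int: "Z_subalgebra (range of_int)"
  unfolding Z_subalgebra_def
  by (metis (no_types, lifting) of_int_1 of_int_diff of_int_mult rangeE rangeI)

lemma binomQ_of_int: "binomQ (of_int m) k \<in> range (of_int :: int \<Rightarrow> 'a::rat_algebra_1)"
proof -
  have n: "binomQ (of_nat n) k \<in> range (of_int :: int \<Rightarrow> 'a)" for n k
    unfolding binomQ_of_nat by (metis of_int_of_nat_eq rangeI)
  show ?thesis
    by (cases m rule: int_cases2) (simp_all add: n binomQ_minus_mem[OF Z_subalgebra_range_of_int])
qed

section \<open>The Cartan series\<close>

definition cartan :: "pm \<Rightarrow> nat \<Rightarrow> uhat"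
  where "cartan e n = h_el (pm_sign e * int (Suc n))"

lemma pm_sign_cases: "pm_sign e = 1 \<or> pm_sign e = - 1"
  by (cases e) simp_all

lemma cartan_comm: "cartan e i * cartan e j = cartan e j * cartan e i"
  unfolding cartan_def by (rule h_h_commute) (use pm_sign_cases[of e] in auto)

text \<open>The coefficients of the inverse series. They generate the same ring as the
  \<open>hhat\<close>, and they pass the negative part from the left and the positive part from the
  right by the polynomial \<open>shift\<close>, where the \<open>hhat\<close> would need the factor
  \<open>(1 + uT)^(-2)\<close>.\<close>

definition hhat_inv :: "pm \<Rightarrow> nat \<Rightarrow> uhat"
  where "hhat_inv e n = exp_of (\<lambda>n. - cartan e n) $ n"

lemma exp_series_hhat: "exp_series (cartan e) (Abs_fps (hhat e))"
proof -
  have "(\<lambda>r. if r = 0 then 0 else ((- 1) ^ (r - 1) / of_nat r) *\<^sub>Q h_el (pm_sign e * int r))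
      = (\<lambda>n. if n = 0 then 0 else ((- 1) ^ (n - 1) / of_nat n) *\<^sub>Q cartan e (n - 1))"
    by (auto simp: cartan_def fun_eq_iff)
  then have "Abs_fps (hhat e) = exp_of (cartan e)"
    by (simp add: fps_eq_iff hhat_def exp_of_def)
  then show ?thesis using exp_series_exp_of[OF cartan_comm] by simp
qed

lemma exp_series_hhat_inv: "exp_series (\<lambda>n. - cartan e n) (Abs_fps (hhat_inv e))"
proof -
  have "Abs_fps (hhat_inv e) = exp_of (\<lambda>n. - cartan e n)"
    by (simp add: fps_eq_iff hhat_inv_def)
  then show ?thesis using exp_series_exp_of[of "\<lambda>n. - cartan e n"] by (simp add: cartan_comm)
qed

lemma hhat_0 [simp]: "hhat e 0 = 1"
  using exp_series.K_0[OF exp_series_hhat] by simp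

lemma hhat_inv_0 [simp]: "hhat_inv e 0 = 1"
  using exp_series.K_0[OF exp_series_hhat_inv] by simp

lemmas hhat_inverse = exp_series.K_inverse[OF exp_series_hhat exp_series_hhat_inv]

lemma hhat_Suc: "of_nat (Suc n) * hhat e (Suc n) = (\<Sum>i=0..n. (- 1) ^ i * cartan e i * hhat e (n - i))"
  using arg_cong[OF exp_series.K_deriv[OF exp_series_hhat], of "\<lambda>f. f $ n" e]
  by (simp add: fps_mult_nth del: of_nat_Suc)

lemma hhat_commute: "hhat e i * hhat e j = hhat e j * hhat e i"
proof -
  have "cartan e k * hhat e j = hhat e j * cartan e k" for k
    using exp_series.K_commute[OF exp_series_hhat, of e "cartan e k" j] cartan_comm by simp
  then show ?thesis using exp_series.K_commute[OF exp_series_hhat, of e "hhat e j" i] by simp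
qed

lemma UZ_0pm_subalgebra: "Z_subalgebra (UZ_0pm e)"
  and UZ_pm_subalgebra: "Z_subalgebra (UZ_pm e)"
  and UZ_00_subalgebra: "Z_subalgebra UZ_00"
  and UZ_0_subalgebra: "Z_subalgebra UZ_0"
  and UZ_subalgebra: "Z_subalgebra UZ"
  unfolding UZ_0pm_def UZ_pm_def UZ_00_def UZ_0_def UZ_def by (rule Z_subalgebra_hull)+

lemma hhat_in_UZ_0pm: "hhat e n \<in> UZ_0pm e"
proof (cases "n = 0")
  case True
  then show ?thesis by (simp add: Z_subalgebra_one UZ_0pm_subalgebra)
next
  case False
  then show ?thesis unfolding UZ_0pm_def by (intro hull_inc) auto
qed

lemma inverse_series_mem:
  assumes S: "Z_subalgebra S" and f: "f \<in> fps_over S" and 0: "f $ 0 = 1" and fg: "f * g = 1"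
  shows "g \<in> fps_over S"
proof -
  have "g $ n \<in> S" for n
  proof (induction n rule: less_induct)
    case (less n)
    have "(\<Sum>i=0..n. f $ i * g $ (n - i)) = (if n = 0 then 1 else 0)"
      using arg_cong[OF fg, of "\<lambda>f. f $ n"] by (simp add: fps_mult_nth)
    then have "g $ n = (if n = 0 then 1 else 0) - (\<Sum>i=Suc 0..n. f $ i * g $ (n - i))"
      by (simp add: sum.atLeast_Suc_atMost eq_diff_eq 0)
    also have "\<dots> \<in> S"
      by (intro Z_subalgebra_intros[OF S]) (auto intro!: Z_subalgebra_intros[OF S] fps_overD[OF f] less)
    finally show ?case .
  qed
  then show ?thesis by (simp add: fps_over_def)
qed

text \<open>Of two mutually inverse series with constant term 1, each has its coefficients in every
  subring containing those of the other.\<close>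

lemma UZ_0pm_hhat_inv: "UZ_0pm e = Z_subalgebra hull (range (hhat_inv e))"
proof
  have "Abs_fps (hhat_inv e) \<in> fps_over (UZ_0pm e)"
    by (rule inverse_series_mem[OF UZ_0pm_subalgebra _ _ hhat_inverse(1)])
       (simp_all add: fps_over_def hhat_in_UZ_0pm)
  then show "Z_subalgebra hull (range (hhat_inv e)) \<subseteq> UZ_0pm e"
    by (intro hull_minimal UZ_0pm_subalgebra) (auto simp: fps_over_def)
  have "Abs_fps (hhat e) \<in> fps_over (Z_subalgebra hull (range (hhat_inv e)))"
    by (rule inverse_series_mem[OF Z_subalgebra_hull _ _ hhat_inverse(2)])
       (simp_all add: fps_over_def hull_inc)
  then show "UZ_0pm e \<subseteq> Z_subalgebra hull (range (hhat_inv e))"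
    unfolding UZ_0pm_def by (intro hull_minimal Z_subalgebra_hull) (auto simp: fps_over_def)
qed

lemma UZ_0pm_comm: "a \<in> UZ_0pm e \<Longrightarrow> b \<in> UZ_0pm e \<Longrightarrow> a * b = b * a"
  unfolding UZ_0pm_def by (rule Z_subalgebra_hull_commute) (auto simp: hhat_commute)

interpretation UZ_0pm: commutative_subring "UZ_0pm e" for e
  by standard (rule UZ_0pm_subalgebra, rule UZ_0pm_comm)

text \<open>The hypothesis says \<open>K = exp (\<Sum> (-1)\<^sup>n\<^sup>-\<^sup>1 h\<^sub>m\<^sub>n u\<^sup>n / n)\<close>: replace the power sums \<open>p\<^sub>n\<close> of \<open>hhat\<close> by \<open>p\<^sub>m\<^sub>n\<close>.\<close>

lemma exp_series_multiple_mem: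
  assumes K: "exp_series (\<lambda>n. h_el (pm_sign e * int (m * Suc n))) K" and m: "m > 0"
  shows "K \<in> fps_over (UZ_0pm e)"
proof -
  define p where "p n = h_el (pm_sign e * int n)" for n
  \<comment> \<open>Replacing \<open>u\<close> by \<open>-u\<close> turns
    \<open>exp (\<Sum> (-1)^(n-1) q n u^n / n)\<close> into
    \<open>exp (- \<Sum> q n u^n / n)\<close>, the form required by
    \<open>power_sums\<close>.\<close>
  have ps: "power_sums (Abs_fps (\<lambda>n. (- 1) ^ n * K $ n)) q"
    if "exp_series (\<lambda>n. q (Suc n)) K" for K q
  proof -
    interpret exp_series "\<lambda>n. q (Suc n)" K by (fact that)
    have "fps_deriv (Abs_fps (\<lambda>n. (- 1) ^ n * K $ n)) $ n
        = - (Abs_fps (\<lambda>n. q (Suc n)) * Abs_fps (\<lambda>n. (- 1) ^ n * K $ n)) $ n" for n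
    proof -
      have "of_nat (Suc n) * K $ Suc n = (\<Sum>i=0..n. (- 1) ^ i * q (Suc i) * K $ (n - i))"
        using arg_cong[OF K_deriv, of "\<lambda>f. f $ n"] by (simp add: fps_mult_nth del: of_nat_Suc)
      then have "(- 1) ^ Suc n * (of_nat (Suc n) * K $ Suc n)
          = - (\<Sum>i=0..n. q (Suc i) * ((- 1) ^ (n - i) * K $ (n - i)))"
        by (auto simp: sum_distrib_left minus_one_power_iff sum_negf[symmetric] intro!: sum.cong)
      moreover have "(- 1) ^ Suc n * (of_nat (Suc n) * K $ Suc n) = of_nat (Suc n) * ((- 1) ^ Suc n * K $ Suc n)"
        by (simp add: minus_one_power_iff del: of_nat_Suc)
      ultimately show ?thesis
        by (simp add: fps_mult_nth del: of_nat_Suc power_Suc)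
    qed
    then have "fps_deriv (Abs_fps (\<lambda>n. (- 1) ^ n * K $ n))
        = - (Abs_fps (\<lambda>n. q (Suc n)) * Abs_fps (\<lambda>n. (- 1) ^ n * K $ n))"
      by (simp add: fps_eq_iff del: fps_deriv_nth)
    then show ?thesis by (simp add: power_sums_def K_0)
  qed
  have F: "power_sums (Abs_fps (\<lambda>n. (- 1) ^ n * hhat e n)) p"
    using ps[of p "Abs_fps (hhat e)"] exp_series_hhat[of e] by (simp add: p_def cartan_def[abs_def])
  have G: "power_sums (Abs_fps (\<lambda>n. (- 1) ^ n * K $ n)) (\<lambda>n. p (m * n))"
    using ps[of "\<lambda>n. p (m * n)" K] K by (simp add: p_def)
  have "Abs_fps (\<lambda>n. (- 1) ^ n * hhat e n) \<in> fps_over (UZ_0pm e)"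
    by (auto simp: fps_over_def intro!: UZ_0pm.intros hhat_in_UZ_0pm)
  from UZ_0pm.power_sum_substitution[OF m F this G]
  have "(- 1) ^ n * K $ n \<in> UZ_0pm e" for n by (simp add: fps_over_def)
  then have "(- 1) ^ n * ((- 1) ^ n * K $ n) \<in> UZ_0pm e" for n
    using Z_subalgebra_mult[OF UZ_0pm.sub Z_subalgebra_power[OF UZ_0pm.sub
      Z_subalgebra_minus[OF UZ_0pm.sub Z_subalgebra_one[OF UZ_0pm.sub]]]] by blast
  moreover have "(- 1) ^ n * ((- 1) ^ n * K $ n) = K $ n" for n
    by (simp add: minus_one_power_iff)
  ultimately show ?thesis by (simp add: fps_over_def)
qed

section \<open>Products of divided powers\<close>

text \<open>Modes may be repeated and stand in any order, which makes the closure under products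
  immediate; only the total degree is recorded.\<close>

definition dp_products :: "pm \<Rightarrow> nat \<Rightarrow> uhat set"
  where "dp_products e k = {prod_list (map (\<lambda>(r, j). div_power (x_el e r) j) l) | l. sum_list (map snd l) = k}"

lemma dp_products_one: "1 \<in> dp_products e 0"
  unfolding dp_products_def by (auto intro!: exI[of _ "[]"])

lemma dp_products_single: "div_power (x_el e r) k \<in> dp_products e k"
  unfolding dp_products_def by (auto intro!: exI[of _ "[(r, k)]"])

lemma dp_products_mult: "a \<in> dp_products e i \<Longrightarrow> b \<in> dp_products e j \<Longrightarrow> a * b \<in> dp_products e (i + j)"
  unfolding dp_products_def by clarify (rule_tac x = "l @ la" in exI, simp)

lemma dp_products_subset: "dp_products e k \<subseteq> UZ_pm e"
proof -
  have "div_power (x_el e r) j \<in> UZ_pm e" for r j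
    unfolding UZ_pm_def by (rule hull_inc) blast
  then show ?thesis
    by (auto simp: dp_products_def intro!: Z_subalgebra_prod_list[OF UZ_pm_subalgebra])
qed

definition dp_span :: "pm \<Rightarrow> nat \<Rightarrow> uhat set"
  where "dp_span e k = zspan (dp_products e k)"

lemma dp_span_subset: "dp_span e k \<subseteq> UZ_pm e"
  unfolding dp_span_def by (rule zspan_subset_subalgebra[OF UZ_pm_subalgebra dp_products_subset])

lemma dp_span_single: "div_power (x_el e r) k \<in> dp_span e k"
  unfolding dp_span_def by (rule zspan.base[OF dp_products_single])

lemma dp_span_mult: "a \<in> dp_span e i \<Longrightarrow> b \<in> dp_span e j \<Longrightarrow> a * b \<in> dp_span e (i + j)"
  unfolding dp_span_def by (rule zspan_mult[OF zspan.base[OF dp_products_mult]])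

interpretation dp_span: graded_subring "dp_span e" for e
  by standard (auto simp: dp_span_def intro: zspan.intros dp_products_one zspan_mult[OF zspan.base[OF dp_products_mult]])

lemma UZ_pm_dp_products: "UZ_pm e \<subseteq> zspan (\<Union>k. dp_products e k)"
proof
  fix a assume "a \<in> UZ_pm e"
  then show "a \<in> zspan (\<Union>k. dp_products e k)"
    unfolding UZ_pm_def
  proof (induction rule: Z_subalgebra_hull_induct)
    case (gen a)
    then show ?case using dp_products_single by (auto intro!: zspan.base)
  next
    case one
    then show ?case using dp_products_one by (auto intro!: zspan.base)
  next
    case (mult a b)
    show ?case
      by (rule zspan_mult[OF _ mult]) (auto intro!: zspan.base intro: dp_products_mult)
  qed (rule zspan.diff)
qed

lemma div_power_of_int_mult:
  "graded_subring S \<Longrightarrow> div_power a k \<in> S k \<Longrightarrow> div_power (of_int n * a) k \<in> S k"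
proof -
  assume S: "graded_subring S" "div_power a k \<in> S k"
  have "div_power (of_int n * a) k = of_int (n ^ k) * div_power a k"
    using div_power_mult[of "of_int n" a k] by (simp add: mult_of_int_commute)
  then show ?thesis using graded_subring.of_int[OF S] by (simp del: of_int_power)
qed

lemma div_power_0_left: "div_power 0 k = (if k = 0 then 1 else 0)"
  by (cases k) (simp_all add: div_power_def scaleQ_one)

lemma prod_span_zspan: "A \<odot> zspan B = A \<odot> B"
proof
  show "A \<odot> zspan B \<subseteq> A \<odot> B"
  proof
    fix u assume "u \<in> A \<odot> zspan B"
    then show "u \<in> A \<odot> B"
    proof (induction rule: prod_span_induct)
      case (mult a v)
      from mult(2) show ?case
        by induction (use mult(1) in \<open>auto simp: right_diff_distrib prod_span_zero prod_spanI prod_span_diff\<close>)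
    qed (auto intro: prod_span_zero prod_span_diff)
  qed
qed (rule prod_span_mono, auto intro: zspan.base)

section \<open>Commuting the Cartan part past the nilpotent parts\<close>

definition x_seq :: "pm \<Rightarrow> pm \<Rightarrow> int \<Rightarrow> nat \<Rightarrow> uhat"
  where "x_seq e e' s j = x_el e (s + pm_sign e' * int j)"

lemma cartan_x_seq: "cartan e' i * x_seq e e' s j = x_seq e e' s j * cartan e' i
    + of_int (2 * pm_sign e) * x_seq e e' s (Suc (i + j))"
  using h_x[of "pm_sign e' * int (Suc i)" e "s + pm_sign e' * int j"]
  by (cases e') (simp_all add: cartan_def x_seq_def algebra_simps)

lemma div_power_shift:
  fixes g :: "nat \<Rightarrow> uhat"
  assumes "exp_series g K"
  shows "div_power (exp_series.shift (x_seq e e' s)) k \<in> fps_over (dp_span e k)"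
proof (rule dp_span.div_power_fps)
  interpret exp_series g K by (fact assms)
  fix i j
  show "shift (x_seq e e' s) $ i * shift (x_seq e e' s) $ j = shift (x_seq e e' s) $ j * shift (x_seq e e' s) $ i"
    by (simp add: shift_nth x_seq_def x_x mult_2 distrib_left distrib_right)
  have "div_power (2 * x_seq e e' s 1) k \<in> dp_span e k" for k
    using div_power_of_int_mult[OF dp_span.graded_subring_axioms, of "x_seq e e' s 1" k e 2] dp_span_single
    by (simp add: x_seq_def)
  then show "div_power (shift (x_seq e e' s) $ i) k \<in> dp_span e k" for k
    by (auto simp: shift_nth x_seq_def dp_span_single div_power_0_left dp_span.one dp_span.zero)
qed

text \<open>On negative modes the Cartan elements act with weight -2, so their negatives act with
  weight 2, as \<open>K_conj_div_power\<close> demands.\<close>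

lemma hhat_inv_past_Neg:
  "hhat_inv e' n * div_power (x_el Neg r) k \<in> UZ_pm Neg \<odot> range (hhat_inv e')"
proof -
  interpret exp_series "\<lambda>n. - cartan e' n" "Abs_fps (hhat_inv e')" by (rule exp_series_hhat_inv)
  let ?q = "div_power (shift (x_seq Neg e' r)) k"
  have "Abs_fps (hhat_inv e') * fps_const (div_power (x_seq Neg e' r 0) k) = ?q * Abs_fps (hhat_inv e')"
    by (rule K_conj_div_power) (use cartan_x_seq[of e' _ Neg r] in \<open>simp add: algebra_simps\<close>)
  from arg_cong[OF this, of "\<lambda>f. f $ n"]
  have "hhat_inv e' n * div_power (x_el Neg r) k = (\<Sum>i=0..n. ?q $ i * hhat_inv e' (n - i))"
    by (simp add: fps_mult_nth[of ?q] x_seq_def)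
  moreover have "?q $ i \<in> UZ_pm Neg" for i
    using fps_overD[OF div_power_shift[OF exp_series_axioms]] dp_span_subset by blast
  ultimately show ?thesis by (auto intro!: prod_span_sum prod_spanI)
qed

text \<open>The rule \<open>K_conj_div_power\<close> for \<open>hhat\<close>, multiplied by the
  inverse series from both sides. The conclusion keeps the degree \<open>k\<close>, not merely
  membership in \<open>UZ_pm Pos\<close>.\<close>

lemma Pos_past_hhat_inv:
  "div_power (x_el Pos r) k * hhat_inv e' n \<in> range (hhat_inv e') \<odot> dp_span Pos k"
proof -
  interpret exp_series "cartan e'" "Abs_fps (hhat e')" by (rule exp_series_hhat)
  let ?q = "div_power (shift (x_seq Pos e' r)) k" and ?H = "Abs_fps (hhat e')" and ?G = "Abs_fps (hhat_inv e')"
  let ?x = "fps_const (div_power (x_seq Pos e' r 0) k)"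
  have "?H * ?x = ?q * ?H"
    by (rule K_conj_div_power) (use cartan_x_seq[of e' _ Pos r] in simp)
  then have "?G * (?H * ?x) * ?G = ?G * (?q * ?H) * ?G" by simp
  then have "(?G * ?H) * (?x * ?G) = ?G * (?q * (?H * ?G))" by (simp only: mult.assoc)
  then have "?x * ?G = ?G * ?q" by (simp add: hhat_inverse)
  from arg_cong[OF this, of "\<lambda>f. f $ n"]
  have "div_power (x_el Pos r) k * hhat_inv e' n = (\<Sum>i=0..n. hhat_inv e' i * ?q $ (n - i))"
    by (simp add: fps_mult_nth[of _ ?q] x_seq_def)
  moreover have "?q $ i \<in> dp_span Pos k" for i
    using fps_overD[OF div_power_shift[OF exp_series_axioms]] by blast
  ultimately show ?thesis by (auto intro!: prod_span_sum prod_spanI)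
qed

lemma h_div_power:
  "h_el 0 * div_power (x_el e r) k = div_power (x_el e r) k * (h_el 0 + of_int (2 * pm_sign e * int k))"
proof -
  have 1: "h_el 0 * x_el e r = x_el e r * (h_el 0 + of_int (2 * pm_sign e))"
    using h_x[of 0 e r] mult_of_int_commute[of "2 * pm_sign e" "x_el e r"] by (simp add: distrib_left)
  have "h_el 0 * x_el e r ^ k = x_el e r ^ k * (h_el 0 + of_int (2 * pm_sign e * int k))"
  proof (induction k)
    case (Suc k)
    have "h_el 0 * x_el e r ^ Suc k = x_el e r * (h_el 0 * x_el e r ^ k + of_int (2 * pm_sign e) * x_el e r ^ k)"
      by (simp only: power_Suc mult.assoc[symmetric] 1) (simp only: mult.assoc distrib_right)
    also have "\<dots> = x_el e r ^ Suc k * (h_el 0 + of_int (2 * pm_sign e * int k) + of_int (2 * pm_sign e))"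
      by (simp only: Suc mult_of_int_commute[of "2 * pm_sign e"] power_Suc mult.assoc distrib_left)
    also have "h_el 0 + of_int (2 * pm_sign e * int k) + of_int (2 * pm_sign e)
        = h_el 0 + of_int (2 * pm_sign e * int (Suc k))"
      by (simp add: distrib_left add_ac)
    finally show ?case .
  qed simp
  then show ?thesis by (simp only: div_power_def mult_scaleQ_left mult_scaleQ_right)
qed

text \<open>Vandermonde's identity and the integrality of binomials of integers: the shift of
  \<open>h_el 0\<close> by the weight of a divided power does no harm.\<close>

lemma binomQ_shift_mem: "binomQ (a + of_int m) n \<in> zspan (range (binomQ a))"
proof -
  have "binomQ a i * binomQ (of_int m) j \<in> zspan (range (binomQ a))" for i j
  proof -
    obtain z where "binomQ (of_int m :: 'a) j = of_int z" using binomQ_of_int by blast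
    then have "binomQ a i * binomQ (of_int m) j = of_int z * binomQ a i"
      by (simp add: mult_of_int_commute)
    then show ?thesis by (simp add: zspan_of_int zspan.base)
  qed
  then show ?thesis
    by (auto simp: binomQ_add mult_of_int_commute[of m a, symmetric] intro!: zspan_sum)
qed

definition cartan_gens :: "uhat set"
  where "cartan_gens = range (hhat_inv Neg) \<union> range (hhat_inv Pos) \<union> range (binomQ (h_el 0)) \<union> range (binomQ c_el)"

lemma UZ_0_cartan_gens: "UZ_0 = Z_subalgebra hull cartan_gens"
proof
  have "UZ_0pm e \<subseteq> Z_subalgebra hull cartan_gens" for e
    unfolding UZ_0pm_hhat_inv by (rule hull_mono) (cases e; auto simp: cartan_gens_def)
  moreover have "UZ_00 \<subseteq> Z_subalgebra hull cartan_gens"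
    unfolding UZ_00_def by (rule hull_mono) (auto simp: cartan_gens_def)
  ultimately show "UZ_0 \<subseteq> Z_subalgebra hull cartan_gens"
    unfolding UZ_0_def by (intro hull_minimal Z_subalgebra_hull) auto
  have "hhat_inv e n \<in> UZ_0pm e" for e n
    unfolding UZ_0pm_hhat_inv by (intro hull_inc) simp
  then have "hhat_inv Neg n \<in> UZ_0" "hhat_inv Pos n \<in> UZ_0" for n
    unfolding UZ_0_def by (auto intro: hull_inc)
  moreover have "binomQ (h_el 0) n \<in> UZ_00" "binomQ c_el n \<in> UZ_00" for n
    unfolding UZ_00_def by (auto intro: hull_inc)
  then have "binomQ (h_el 0) n \<in> UZ_0" "binomQ c_el n \<in> UZ_0" for n
    unfolding UZ_0_def by (auto intro: hull_inc)
  ultimately show "Z_subalgebra hull cartan_gens \<subseteq> UZ_0"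
    by (intro hull_minimal UZ_0_subalgebra) (auto simp: cartan_gens_def)
qed

lemma prod_span_zspan_left: "zspan A \<odot> B = A \<odot> B"
proof
  show "zspan A \<odot> B \<subseteq> A \<odot> B"
  proof
    fix u assume "u \<in> zspan A \<odot> B"
    then show "u \<in> A \<odot> B"
    proof (induction rule: prod_span_induct)
      case (mult v b)
      from mult(1) show ?case
        by induction (use mult(2) in \<open>auto simp: left_diff_distrib prod_span_zero prod_spanI prod_span_diff\<close>)
    qed (auto intro: prod_span_zero prod_span_diff)
  qed
qed (rule prod_span_mono, auto intro: zspan.base)

lemma cartan_gens_past_Neg:
  assumes "b \<in> cartan_gens"
  shows "b * div_power (x_el Neg r) k \<in> UZ_pm Neg \<odot> cartan_gens"
proof -
  let ?a = "div_power (x_el Neg r) k"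
  have a: "?a \<in> UZ_pm Neg" using dp_span_single dp_span_subset by blast
  consider e n where "b = hhat_inv e n" | n where "b = binomQ (h_el 0) n" | n where "b = binomQ c_el n"
    using assms unfolding cartan_gens_def by auto
  then show ?thesis
  proof cases
    case 1
    have "range (hhat_inv e) \<subseteq> cartan_gens" by (cases e) (auto simp: cartan_gens_def)
    then show ?thesis
      using hhat_inv_past_Neg[of e n r k] prod_span_mono[OF subset_refl] unfolding 1 by blast
  next
    case 2
    have "b * ?a = ?a * binomQ (h_el 0 + of_int (2 * pm_sign Neg * int k)) n"
      unfolding 2 by (rule binomQ_intertwine[OF h_div_power])
    also have "\<dots> \<in> UZ_pm Neg \<odot> zspan (range (binomQ (h_el 0)))"
      by (rule prod_spanI[OF a binomQ_shift_mem])
    also have "\<dots> \<subseteq> UZ_pm Neg \<odot> cartan_gens"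
      unfolding prod_span_zspan by (rule prod_span_mono) (auto simp: cartan_gens_def)
    finally show ?thesis .
  next
    case 3
    have "b * ?a = ?a * b" unfolding 3 by (rule binomQ_commute[OF c_central])
    then show ?thesis using prod_spanI[OF a assms] by simp
  qed
qed

lemma Pos_past_cartan_gens:
  assumes "b \<in> cartan_gens"
  shows "div_power (x_el Pos r) k * b \<in> cartan_gens \<odot> dp_span Pos k"
proof -
  let ?a = "div_power (x_el Pos r) k"
  have a: "?a \<in> dp_span Pos k" by (rule dp_span_single)
  consider e n where "b = hhat_inv e n" | n where "b = binomQ (h_el 0) n" | n where "b = binomQ c_el n"
    using assms unfolding cartan_gens_def by auto
  then show ?thesis
  proof cases
    case 1
    have "range (hhat_inv e) \<subseteq> cartan_gens" by (cases e) (auto simp: cartan_gens_def)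
    then show ?thesis
      using Pos_past_hhat_inv[of r k e n] prod_span_mono[OF _ subset_refl] unfolding 1 by blast
  next
    case 2
    define m where "m = 2 * pm_sign Pos * int k"
    have "h_el 0 * ?a = ?a * h_el 0 + ?a * of_int m"
      using h_div_power[of Pos r k] by (simp only: m_def distrib_left)
    then have "(h_el 0 + of_int (- m)) * ?a = ?a * h_el 0"
      by (simp add: left_diff_distrib mult_of_int_commute)
    then have "?a * b = binomQ (h_el 0 + of_int (- m)) n * ?a"
      unfolding 2 by (rule binomQ_intertwine[symmetric])
    also have "\<dots> \<in> zspan (range (binomQ (h_el 0))) \<odot> dp_span Pos k"
      by (rule prod_spanI[OF binomQ_shift_mem a])
    also have "\<dots> \<subseteq> cartan_gens \<odot> dp_span Pos k"
      unfolding prod_span_zspan_left by (rule prod_span_mono) (auto simp: cartan_gens_def)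
    finally show ?thesis .
  next
    case 3
    have "?a * b = b * ?a" unfolding 3 by (rule binomQ_commute[OF c_central, symmetric])
    then show ?thesis using prod_spanI[OF assms a] by simp
  qed
qed

lemma UZ_0_past_Neg: "b \<in> UZ_0 \<Longrightarrow> a \<in> UZ_pm Neg \<Longrightarrow> b * a \<in> UZ_pm Neg \<odot> UZ_0"
  unfolding UZ_0_cartan_gens
proof (rule move_hull_past_left[OF UZ_pm_subalgebra])
  fix b a assume b: "b \<in> cartan_gens" and a: "a \<in> UZ_pm Neg"
  have "b * a \<in> UZ_pm Neg \<odot> cartan_gens"
    if "b \<in> cartan_gens" "a \<in> {div_power (x_el Neg r) k | r k. True}" for b a
    using that cartan_gens_past_Neg by blast
  then show "b * a \<in> UZ_pm Neg \<odot> cartan_gens"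
    by (rule move_past_left[OF UZ_pm_subalgebra _ a[unfolded UZ_pm_def] b])
qed

text \<open>Cartan elements change the modes of positive factors but not their total degree, which
  the induction in \<open>dp_upto_past_Neg\<close> relies on.\<close>

lemma dp_products_past_UZ_0:
  assumes "c \<in> dp_products Pos k" "b \<in> UZ_0"
  shows "c * b \<in> UZ_0 \<odot> dp_span Pos k"
proof -
  have gens: "prod_list (map (\<lambda>(r, j). div_power (x_el Pos r) j) l) * b \<in> cartan_gens \<odot> dp_span Pos (sum_list (map snd l))"
    if "b \<in> cartan_gens" for l b
  proof (induction l)
    case Nil
    then show ?case using prod_spanI[OF that dp_span.one] by simp
  next
    case (Cons p l)
    obtain r j where p: "p = (r, j)" by fastforce
    from Cons have "div_power (x_el Pos r) j * (prod_list (map (\<lambda>(r, j). div_power (x_el Pos r) j) l) * b)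
        \<in> cartan_gens \<odot> dp_span Pos (j + sum_list (map snd l))"
    proof (induction rule: prod_span_induct)
      case (mult b s)
      from Pos_past_cartan_gens[OF mult(1), of r j]
      have "div_power (x_el Pos r) j * b * s \<in> cartan_gens \<odot> dp_span Pos (j + sum_list (map snd l))"
      proof (induction rule: prod_span_induct)
        case (mult b' s')
        then show ?case
          using prod_spanI[OF mult(1) dp_span_mult[OF mult(2) \<open>s \<in> _\<close>]] by (simp add: mult.assoc)
      qed (simp_all add: prod_span_zero left_diff_distrib prod_span_diff)
      then show ?case by (simp add: mult.assoc)
    qed (simp_all add: prod_span_zero right_diff_distrib prod_span_diff)
    then show ?case by (simp add: p mult.assoc)
  qed
  have gens': "c * b \<in> UZ_0 \<odot> dp_span Pos k" if "c \<in> dp_span Pos k" "b \<in> cartan_gens" for c b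
    using that(1) unfolding dp_span_def
  proof induction
    case (base c)
    then obtain l where l: "c = prod_list (map (\<lambda>(r, j). div_power (x_el Pos r) j) l)" "k = sum_list (map snd l)"
      by (auto simp: dp_products_def)
    have "cartan_gens \<subseteq> UZ_0" unfolding UZ_0_cartan_gens by (rule hull_subset)
    then show ?case
      using gens[OF that(2), of l] prod_span_mono[OF _ subset_refl] unfolding l dp_span_def by blast
  qed (simp_all add: prod_span_zero left_diff_distrib prod_span_diff)
  have c: "c \<in> dp_span Pos k" using assms(1) unfolding dp_span_def by (rule zspan.base)
  from assms(2) c show ?thesis
    unfolding UZ_0_cartan_gens
  proof (induction arbitrary: c rule: Z_subalgebra_hull_induct)
    case (gen b)
    then show ?case using gens' unfolding UZ_0_cartan_gens by blast
  next
    case one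
    then show ?case using prod_spanI[OF Z_subalgebra_one[OF Z_subalgebra_hull] one] by simp
  next
    case (mult b b')
    from mult.IH(1)[OF mult.prems] have "c * b * b' \<in> (Z_subalgebra hull cartan_gens) \<odot> dp_span Pos k"
    proof (induction rule: prod_span_induct)
      case (mult d s)
      then have "d * (s * b') \<in> (Z_subalgebra hull cartan_gens) \<odot> dp_span Pos k"
        by (intro prod_span_mult_left[OF Z_subalgebra_hull] \<open>\<And>c. c \<in> dp_span Pos k \<Longrightarrow> c * b' \<in> _\<close>)
      then show ?case by (simp add: mult.assoc)
    qed (simp_all add: prod_span_zero left_diff_distrib prod_span_diff)
    then show ?case by (simp add: mult.assoc)
  qed (simp_all add: right_diff_distrib prod_span_diff)
qed

lemma Pos_past_UZ_0:
  assumes "c \<in> UZ_pm Pos" "b \<in> UZ_0"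
  shows "c * b \<in> UZ_0 \<odot> UZ_pm Pos"
proof -
  from assms(1) UZ_pm_dp_products have "c \<in> zspan (\<Union>k. dp_products Pos k)" by blast
  then show ?thesis
  proof induction
    case (base c)
    then show ?case
      using dp_products_past_UZ_0[OF _ assms(2)] prod_span_mono[OF subset_refl dp_span_subset] by blast
  qed (simp_all add: prod_span_zero left_diff_distrib prod_span_diff)
qed

section \<open>The Cartan part\<close>

lemma binomQ_of_nat_mult_mem:
  assumes S: "Z_subalgebra S" and a: "\<And>k. binomQ a k \<in> S"
  shows "binomQ (of_nat n * a) k \<in> S"
proof (induction n arbitrary: k)
  case 0
  then show ?case using Z_subalgebra_of_nat[OF S] binomQ_of_nat[of 0 k, where ?'a = 'a] by simp
next
  case (Suc n)
  have "a * (of_nat n * a) = of_nat n * a * a"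
    by (metis mult.assoc mult_of_nat_commute)
  then have "binomQ (of_nat (Suc n) * a) k = (\<Sum>i=0..k. binomQ a i * binomQ (of_nat n * a) (k - i))"
    by (simp add: distrib_right binomQ_add)
  also have "\<dots> \<in> S" by (intro Z_subalgebra_sum[OF S] Z_subalgebra_mult[OF S] a Suc)
  finally show ?case .
qed

lemma binomQ_of_int_mult_mem:
  assumes S: "Z_subalgebra S" and a: "\<And>k. binomQ a k \<in> S"
  shows "binomQ (of_int n * a) k \<in> S"
  by (cases n rule: int_cases2)
     (simp_all add: binomQ_of_nat_mult_mem[OF assms] binomQ_minus_mem[OF S] )

lemma binomQ_in_UZ_00: "binomQ (h_el 0) k \<in> UZ_00" "binomQ c_el k \<in> UZ_00"
  unfolding UZ_00_def by (auto intro: hull_inc)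

lemma UZ_0pm_subset: "UZ_0pm e \<subseteq> UZ_0" and UZ_00_subset: "UZ_00 \<subseteq> UZ_0"
  unfolding UZ_0_def by (cases e; auto intro: hull_inc) (auto intro: hull_inc)

lemma UZ_00_comm: "a \<in> UZ_00 \<Longrightarrow> b \<in> UZ_0pm e \<Longrightarrow> a * b = b * a"
proof -
  have "h_el 0 * hhat e k = hhat e k * h_el 0" for k
    using exp_series.K_commute[OF exp_series_hhat, of e "h_el 0" k] h_h_commute[of 0]
    by (simp add: cartan_def)
  then have "binomQ (h_el 0) n * hhat e k = hhat e k * binomQ (h_el 0) n" for n k
    by (rule binomQ_commute)
  moreover have "binomQ c_el n * u = u * binomQ c_el n" for n u
    by (rule binomQ_commute[OF c_central])
  ultimately show "a \<in> UZ_00 \<Longrightarrow> b \<in> UZ_0pm e \<Longrightarrow> a * b = b * a"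
    unfolding UZ_00_def UZ_0pm_def by (elim Z_subalgebra_hull_commute[rotated]) auto
qed

text \<open>The coefficients of \<open>(1 - u)^(-2c)\<close>.\<close>

definition central_binom :: "nat \<Rightarrow> uhat"
  where "central_binom n = (- 1) ^ n * binomQ (- (2 * c_el)) n"

lemma central_binom_commute: "central_binom n * u = u * central_binom n"
proof -
  have "- (2 * c_el) * u = u * - (2 * c_el)"
    using c_central[of u] by (simp add: mult_2 algebra_simps)
  then have "binomQ (- (2 * c_el)) n * u = u * binomQ (- (2 * c_el)) n" by (rule binomQ_commute)
  then show ?thesis by (simp add: central_binom_def minus_one_power_iff)
qed

lemma central_binom_Suc: "of_nat (Suc n) * central_binom (Suc n) = (\<Sum>i=0..n. 2 * c_el * central_binom i)"
proof -
  have "of_nat (Suc n) * binomQ (- (2 * c_el)) (Suc n)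
      = (\<Sum>i=0..n. (- 1) ^ i * - (2 * c_el) * binomQ (- (2 * c_el)) (n - i))"
    using arg_cong[OF fps_deriv_Abs_binomQ[of "- (2 * c_el)"], of "\<lambda>f. f $ n"]
    by (simp add: fps_mult_nth binom_exponent_def del: of_nat_Suc)
  then have "(- 1) ^ Suc n * (of_nat (Suc n) * binomQ (- (2 * c_el)) (Suc n))
      = (\<Sum>i=0..n. 2 * c_el * central_binom (n - i))"
    unfolding central_binom_def
    by (simp only: sum_distrib_left) (auto simp: minus_one_power_iff intro!: sum.cong)
  moreover have "(\<Sum>i=0..n. 2 * c_el * central_binom (n - i)) = (\<Sum>i=0..n. 2 * c_el * central_binom i)"
    by (subst sum.atLeastAtMost_rev) simp
  moreover have "(- 1) ^ Suc n * (of_nat (Suc n) * binomQ (- (2 * c_el)) (Suc n)) = of_nat (Suc n) * central_binom (Suc n)"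
    unfolding central_binom_def by (simp add: minus_one_power_iff del: of_nat_Suc)
  ultimately show ?thesis by simp
qed

text \<open>Extended by 0 beyond \<open>l\<close>, so that relations lowering the index hold for
  every \<open>i\<close>.\<close>

definition hhat_Neg_below :: "nat \<Rightarrow> nat \<Rightarrow> uhat"
  where "hhat_Neg_below l i = (if i \<le> l then hhat Neg (l - i) else 0)"

text \<open>The bracket of \<open>cartan Pos r\<close> with the exponent of the negative series is
  the central element \<open>(-1)^r 2c u^(r+1)\<close>. Hence the bracket with the series itself is
  this element times the series.\<close>

lemma cartan_hhat_Neg:
  "cartan Pos r * hhat_Neg_below l i = hhat_Neg_below l i * cartan Pos r
    + (- 1) ^ r * (2 * c_el) * hhat_Neg_below l (Suc (i + r))"
proof -
  interpret exp_series "cartan Neg" "Abs_fps (hhat Neg)" by (rule exp_series_hhat)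
  let ?H = "Abs_fps (hhat Neg)" and ?h = "fps_const (cartan Pos r)"
  define z where "z = (- 1) ^ r * (2 * c_el)"
  have z: "z * u = u * z" for u
    using c_central[of u] by (simp add: z_def minus_one_power_iff mult_2 distrib_left distrib_right)
  have cc: "cartan Pos r * cartan Neg j = cartan Neg j * cartan Pos r + (if j = r then of_nat (Suc r) * (2 * c_el) else 0)" for j
  proof (cases "j = r")
    case True
    have "of_int (2 * int (Suc r)) = (of_nat (Suc r) * 2 :: uhat)"
      by (simp only: mult.commute[of 2] of_int_mult of_int_of_nat_eq of_int_numeral)
    then show ?thesis
      using h_h[of "int (Suc r)" "- int (Suc r)"] True by (simp add: cartan_def mult.assoc del: of_nat_Suc)
  next
    case False
    then show ?thesis
      using h_h_commute[of "int (Suc r)" "- int (Suc j)"] by (simp add: cartan_def)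
  qed
  have h\<kappa>: "?h * \<kappa> = \<kappa> * ?h + of_nat (Suc r) * (fps_const z * fps_X ^ r)"
  proof (rule fps_ext)
    fix n
    have "(of_nat m * (fps_const z * fps_X ^ r)) $ n = (if n = r then of_nat m * z else 0)" for m
      by (simp add: fps_of_nat[symmetric] del: fps_of_nat)
    moreover have "cartan Pos r * ((- 1) ^ n * cartan Neg n)
        = (- 1) ^ n * cartan Neg n * cartan Pos r + (if n = r then of_nat (Suc r) * z else 0)"
      using cc[of n] by (cases "n = r") (simp_all add: minus_one_power_iff z_def del: of_nat_Suc)
    ultimately show "(?h * \<kappa>) $ n = (\<kappa> * ?h + of_nat (Suc r) * (fps_const z * fps_X ^ r)) $ n"
      by (simp del: of_nat_Suc)
  qed
  define Z where "Z = fps_const z * fps_X ^ Suc r"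
  have Z\<kappa>: "Z * \<kappa> = \<kappa> * Z"
    unfolding Z_def by (rule fps_mult_commute) (simp add: z)
  have dZ: "fps_deriv Z = of_nat (Suc r) * (fps_const z * fps_X ^ r)"
    unfolding Z_def
    by (rule fps_ext) (auto simp: fps_of_nat[symmetric] mult_of_nat_commute[of "Suc r" z] simp del: fps_of_nat of_nat_Suc power_Suc)
  have "fps_deriv (?h * ?H - Z * ?H) = ?h * \<kappa> * ?H - (Z * \<kappa> * ?H + fps_deriv Z * ?H)"
    by (simp only: fps_deriv_sub fps_deriv_mult deriv_K fps_deriv_const mult_zero_left add_0_right mult.assoc)
  also have "\<dots> = \<kappa> * (?h * ?H - Z * ?H)"
    unfolding h\<kappa> Z\<kappa> dZ by (simp only: distrib_right right_diff_distrib mult.assoc) simp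
  finally have "fps_deriv (?h * ?H - Z * ?H) = \<kappa> * (?h * ?H - Z * ?H)" .
  moreover have "fps_deriv (?H * ?h) = \<kappa> * (?H * ?h)"
    by (simp add: deriv_K mult.assoc)
  ultimately have eq: "?h * ?H - Z * ?H = ?H * ?h"
    by (rule fps_ode_left_unique) (simp add: Z_def)
  have "(Z * ?H) $ n = (if n < Suc r then 0 else z * hhat Neg (n - Suc r))" for n
    unfolding Z_def by (simp only: const_X_power_mult_nth fps_nth_Abs_fps)
  with arg_cong[OF eq, of "\<lambda>f. f $ (l - i)"]
  have "i \<le> l \<Longrightarrow> cartan Pos r * hhat Neg (l - i) = hhat Neg (l - i) * cartan Pos r
      + (if l - i < Suc r then 0 else z * hhat Neg (l - i - Suc r))"
    by (simp add: diff_eq_eq add.commute del: power_Suc)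
  then show ?thesis
    by (auto simp: hhat_Neg_below_def z_def)
qed

text \<open>Coefficientwise form of \<open>H^+(u) H^-(v) = H^-(v) (1 - uv)^(-2c) H^+(u)\<close>: the
  bracket of the two exponents is the central element \<open>-2c log (1 - uv)\<close>. The proof
  fixes the power \<open>l\<close> of \<open>v\<close> and compares the differential equations in
  \<open>u\<close>.\<close>

lemma hhat_Pos_Neg:
  "hhat Pos k * hhat Neg l = (\<Sum>i=0..k. hhat_Neg_below l i * central_binom i * hhat Pos (k - i))"
proof -
  interpret exp_series "cartan Pos" "Abs_fps (hhat Pos)" by (rule exp_series_hhat)
  let ?H = "Abs_fps (hhat Pos)"
  define W where "W = Abs_fps (\<lambda>i. hhat_Neg_below l i * central_binom i)"
  have "\<kappa> * W = W * \<kappa> + fps_deriv W"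
  proof (rule fps_ext)
    fix n
    have "(\<kappa> * W) $ n = (\<Sum>r=0..n. W $ (n - r) * \<kappa> $ r + hhat_Neg_below l (Suc n) * (2 * c_el * central_binom (n - r)))"
      unfolding fps_mult_nth
    proof (rule sum.cong)
      fix r assume r: "r \<in> {0..n}"
      have "(- 1) ^ r * ((- 1) ^ r * (2 * c_el) * hhat_Neg_below l (Suc (n - r + r)))
          = hhat_Neg_below l (Suc n) * (2 * c_el)"
        using r c_central[of "hhat_Neg_below l (Suc n)"]
        by (simp add: minus_one_power_iff mult_2 distrib_left distrib_right)
      then have "(- 1) ^ r * cartan Pos r * hhat_Neg_below l (n - r)
          = hhat_Neg_below l (n - r) * ((- 1) ^ r * cartan Pos r) + hhat_Neg_below l (Suc n) * (2 * c_el)"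
        by (simp add: mult.assoc cartan_hhat_Neg distrib_left) (simp add: minus_one_power_iff)
      then have "(- 1) ^ r * cartan Pos r * hhat_Neg_below l (n - r) * central_binom (n - r)
          = hhat_Neg_below l (n - r) * ((- 1) ^ r * cartan Pos r) * central_binom (n - r)
            + hhat_Neg_below l (Suc n) * (2 * c_el) * central_binom (n - r)"
        by (simp only: distrib_right)
      then show "\<kappa> $ r * W $ (n - r) = W $ (n - r) * \<kappa> $ r + hhat_Neg_below l (Suc n) * (2 * c_el * central_binom (n - r))"
        using central_binom_commute[of "n - r" "(- 1) ^ r * cartan Pos r"]
        by (simp add: W_def mult.assoc)
    qed simp
    also have "\<dots> = (\<Sum>r=0..n. W $ (n - r) * \<kappa> $ r) + hhat_Neg_below l (Suc n) * (\<Sum>r=0..n. 2 * c_el * central_binom (n - r))"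
      by (simp only: sum.distrib sum_distrib_left)
    also have "(\<Sum>r=0..n. 2 * c_el * central_binom (n - r)) = of_nat (Suc n) * central_binom (Suc n)"
      unfolding central_binom_Suc by (subst sum.atLeastAtMost_rev) simp
    also have "(\<Sum>r=0..n. W $ (n - r) * \<kappa> $ r) = (W * \<kappa>) $ n"
      unfolding fps_mult_nth by (subst sum.atLeastAtMost_rev) simp
    finally show "(\<kappa> * W) $ n = (W * \<kappa> + fps_deriv W) $ n"
      by (simp add: W_def mult_of_nat_left_commute del: of_nat_Suc)
  qed
  then have "fps_deriv (W * ?H) = \<kappa> * (W * ?H)"
    by (simp add: deriv_K distrib_right flip: mult.assoc)
  moreover have "fps_deriv (?H * fps_const (hhat Neg l)) = \<kappa> * (?H * fps_const (hhat Neg l))"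
    by (simp add: deriv_K mult.assoc)
  ultimately have "?H * fps_const (hhat Neg l) = W * ?H"
    using fps_ode_left_unique[of "?H * fps_const (hhat Neg l)" \<kappa> "W * ?H"]
    by (simp add: W_def hhat_Neg_below_def central_binom_def)
  from arg_cong[OF this, of "\<lambda>f. f $ k"] show ?thesis
    by (simp add: fps_mult_nth[of W]) (simp add: W_def)
qed

lemma UZ_0_minus_subalgebra: "Z_subalgebra (UZ_0pm Neg \<odot> UZ_00)"
  by (rule prod_span_subalgebra[OF UZ_0pm_subalgebra UZ_00_subalgebra])
     (metis UZ_00_comm prod_spanI)

lemma central_binom_in_UZ_00: "central_binom n \<in> UZ_00"
proof -
  have "binomQ (of_int (- 2) * c_el) n \<in> UZ_00"
    by (rule binomQ_of_int_mult_mem[OF UZ_00_subalgebra binomQ_in_UZ_00(2)])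
  then show ?thesis
    unfolding central_binom_def
    by (auto intro!: Z_subalgebra_mult[OF UZ_00_subalgebra] Z_subalgebra_power[OF UZ_00_subalgebra]
        Z_subalgebra_minus[OF UZ_00_subalgebra] Z_subalgebra_one[OF UZ_00_subalgebra])
qed

lemma UZ_0_decomp: "UZ_0 = UZ_0pm Neg \<odot> UZ_00 \<odot> UZ_0pm Pos"
proof
  let ?A = "UZ_0pm Neg \<odot> UZ_00" and ?V = "range (hhat Pos)"
  note A = UZ_0_minus_subalgebra
  have V: "Z_subalgebra hull ?V = UZ_0pm Pos"
  proof
    show "Z_subalgebra hull ?V \<subseteq> UZ_0pm Pos"
      by (intro hull_minimal UZ_0pm_subalgebra) (auto simp: hhat_in_UZ_0pm)
    show "UZ_0pm Pos \<subseteq> Z_subalgebra hull ?V"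
      unfolding UZ_0pm_def by (rule hull_mono) auto
  qed
  have 1: "b * a \<in> ?A \<odot> ?V" if "b \<in> ?V" "a \<in> {hhat Neg k | k. k > 0}" for b a
  proof -
    have "hhat_Neg_below l i \<in> UZ_0pm Neg" for l i
      by (simp add: hhat_Neg_below_def hhat_in_UZ_0pm Z_subalgebra_zero[OF UZ_0pm_subalgebra])
    then have "hhat_Neg_below l i * central_binom i \<in> ?A" for l i
      by (intro prod_spanI central_binom_in_UZ_00)
    then have "hhat Pos i * hhat Neg j \<in> ?A \<odot> ?V" for i j
      unfolding hhat_Pos_Neg by (intro prod_span_sum prod_spanI[of _ ?A]) auto
    then show ?thesis using that by auto
  qed
  have 2: "b * a \<in> ?A \<odot> ?V" if "b \<in> ?V" "a \<in> UZ_0pm Neg" for b a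
    by (rule move_past_left[OF A 1 _ that(1)]) (use that(2) in \<open>simp_all add: UZ_0pm_def\<close>)
  have 3: "b * a \<in> ?A \<odot> ?V" if b: "b \<in> ?V" and a: "a \<in> ?A" for b a
    using a
  proof (induction rule: prod_span_induct)
    case (mult a z)
    from 2[OF b mult(1)] have "b * a * z \<in> ?A \<odot> ?V"
    proof (induction rule: prod_span_induct)
      case (mult a' v)
      have "v * z = z * v"
        using UZ_00_comm[OF \<open>z \<in> UZ_00\<close>] mult(2) hhat_in_UZ_0pm by (metis imageE)
      then have "a' * v * z = a' * z * v" by (simp add: mult.assoc)
      moreover have "z \<in> ?A"
        using subset_prod_span_right[OF UZ_0pm_subalgebra] \<open>z \<in> UZ_00\<close> by blast
      ultimately show ?case
        using prod_spanI[OF Z_subalgebra_mult[OF A mult(1)] mult(2)] by simp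
    qed (simp_all add: prod_span_zero left_diff_distrib prod_span_diff)
    then show ?case by (simp add: mult.assoc)
  qed (simp_all add: prod_span_zero right_diff_distrib prod_span_diff)
  have "Z_subalgebra (?A \<odot> UZ_0pm Pos)"
    by (rule prod_span_subalgebra[OF A UZ_0pm_subalgebra])
       (use move_hull_past_left[OF A 3] in \<open>simp add: V\<close>)
  moreover have "UZ_0pm Neg \<subseteq> ?A \<odot> UZ_0pm Pos" "UZ_00 \<subseteq> ?A \<odot> UZ_0pm Pos" "UZ_0pm Pos \<subseteq> ?A \<odot> UZ_0pm Pos"
    using subset_prod_span_left[OF UZ_00_subalgebra, of "UZ_0pm Neg"]
      subset_prod_span_right[OF UZ_0pm_subalgebra, of UZ_00 Neg]
      subset_prod_span_left[OF UZ_0pm_subalgebra, of ?A Pos] subset_prod_span_right[OF A, of "UZ_0pm Pos"]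
    by blast+
  ultimately show "UZ_0 \<subseteq> ?A \<odot> UZ_0pm Pos"
    unfolding UZ_0_def by (intro hull_minimal) auto
  show "?A \<odot> UZ_0pm Pos \<subseteq> UZ_0"
    by (intro prod_span_subset_subalgebra[OF UZ_0_subalgebra] UZ_0pm_subset UZ_00_subset)
qed

section \<open>The triangular decomposition\<close>

text \<open>The bracket of \<open>x_el Pos r\<close> with the negative mode
  \<open>s + n (r + s)\<close>. The two modes add up to \<open>(n + 1) (r + s)\<close>, which is
  zero, and gives a central term, exactly if \<open>r + s = 0\<close>.\<close>

definition mixed :: "int \<Rightarrow> int \<Rightarrow> nat \<Rightarrow> uhat"
  where "mixed r s n = h_el (int (Suc n) * (r + s)) + of_int (if r + s = 0 then r else 0) * c_el"

lemma of_int_c_central: "of_int n * c_el * u = u * (of_int n * c_el)"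
  by (metis c_central mult.assoc mult_of_int_commute)

lemma mixed_comm: "mixed r s i * mixed r s j = mixed r s j * mixed r s i"
proof -
  have "h_el (int (Suc i) * (r + s)) * h_el (int (Suc j) * (r + s)) = h_el (int (Suc j) * (r + s)) * h_el (int (Suc i) * (r + s))"
  proof (rule h_h_commute)
    have "int (Suc i) * (r + s) + int (Suc j) * (r + s) = int (Suc (Suc (i + j))) * (r + s)"
      by (simp add: algebra_simps)
    then show "int (Suc i) * (r + s) + int (Suc j) * (r + s) \<noteq> 0 \<or> int (Suc i) * (r + s) = 0"
      by (simp del: of_nat_Suc)
  qed
  then show ?thesis
    unfolding mixed_def
    by (simp only: distrib_left distrib_right add_ac of_int_c_central[of _ "h_el x" for x])
qed

interpretation mixed: straightening "mixed r s" "exp_of (mixed r s)"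
  "\<lambda>j. x_el Pos (r + int j * (r + s))" "\<lambda>j. x_el Neg (s + int j * (r + s))" for r s
proof (unfold straightening_def straightening_axioms_def, intro conjI allI)
  show "exp_series (mixed r s) (exp_of (mixed r s))"
    by (rule exp_series_exp_of[OF mixed_comm])
  fix i j
  show "x_el Pos (r + int i * (r + s)) * x_el Pos (r + int j * (r + s)) = x_el Pos (r + int j * (r + s)) * x_el Pos (r + int i * (r + s))"
    and "x_el Neg (s + int i * (r + s)) * x_el Neg (s + int j * (r + s)) = x_el Neg (s + int j * (r + s)) * x_el Neg (s + int i * (r + s))"
    by (rule x_x)+
  have "r + (s + int j * (r + s)) = int (Suc j) * (r + s)" by (simp add: algebra_simps)
  moreover have "int (Suc j) * (r + s) = 0 \<longleftrightarrow> r + s = 0" by (simp del: of_nat_Suc)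
  ultimately show "x_el Pos (r + int 0 * (r + s)) * x_el Neg (s + int j * (r + s)) =
      x_el Neg (s + int j * (r + s)) * x_el Pos (r + int 0 * (r + s)) + mixed r s j"
    using xp_xm[of r "s + int j * (r + s)"] by (simp add: mixed_def del: of_nat_Suc)
  have e: "int (Suc i) * (r + s) + (t + int j * (r + s)) = t + int (Suc (i + j)) * (r + s)" for t
    by (simp add: algebra_simps)
  have g: "mixed r s i * x_el e (t + int j * (r + s)) = x_el e (t + int j * (r + s)) * mixed r s i
      + of_int (2 * pm_sign e) * x_el e (t + int (Suc (i + j)) * (r + s))" for e t
  proof -
    define C where "C = of_int (if r + s = 0 then r else 0) * c_el"
    define h where "h = h_el (int (Suc i) * (r + s))"
    have "h * x_el e (t + int j * (r + s)) = x_el e (t + int j * (r + s)) * h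
        + of_int (2 * pm_sign e) * x_el e (t + int (Suc (i + j)) * (r + s))"
      unfolding h_def h_x e ..
    moreover have "C * u = u * C" for u unfolding C_def by (rule of_int_c_central)
    moreover have "mixed r s i = h + C" by (simp only: mixed_def h_def C_def)
    ultimately show ?thesis by (simp only: distrib_left distrib_right add_ac)
  qed
  show "mixed r s i * x_el Pos (r + int j * (r + s)) = x_el Pos (r + int j * (r + s)) * mixed r s i
      + 2 * x_el Pos (r + int (Suc (i + j)) * (r + s))"
    using g[of Pos r] by simp
  show "mixed r s i * x_el Neg (s + int j * (r + s)) = x_el Neg (s + int j * (r + s)) * mixed r s i
      - 2 * x_el Neg (s + int (Suc (i + j)) * (r + s))"
    using g[of Neg s] by simp
qed

lemma exp_mixed_0: "r + s = 0 \<Longrightarrow> exp_of (mixed r s) = Abs_fps (binomQ (h_el 0 + of_int r * c_el))"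
proof -
  assume rs: "r + s = 0"
  have "exp_series (mixed r s) (Abs_fps (binomQ (h_el 0 + of_int r * c_el)))"
  proof
    show "fps_deriv (Abs_fps (binomQ (h_el 0 + of_int r * c_el)))
        = Abs_fps (\<lambda>n. (- 1) ^ n * mixed r s n) * Abs_fps (binomQ (h_el 0 + of_int r * c_el))"
      unfolding fps_deriv_Abs_binomQ by (simp add: binom_exponent_def mixed_def rs)
  qed (simp_all add: mixed_comm)
  then show ?thesis by (rule mixed.K_unique[symmetric])
qed

lemma binomQ_h_c_mem: "binomQ (h_el 0 + of_int r * c_el) n \<in> UZ_0"
proof -
  have "binomQ (of_int r * c_el) k \<in> UZ_00" for k
    by (rule binomQ_of_int_mult_mem[OF UZ_00_subalgebra binomQ_in_UZ_00(2)])
  then have "binomQ (h_el 0 + of_int r * c_el) n \<in> UZ_00"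
    unfolding binomQ_add[OF of_int_c_central[symmetric]]
    by (intro Z_subalgebra_sum[OF UZ_00_subalgebra] Z_subalgebra_mult[OF UZ_00_subalgebra] binomQ_in_UZ_00)
  then show ?thesis using UZ_00_subset by blast
qed

lemma exp_mixed_mem: "exp_of (mixed r s) \<in> fps_over UZ_0"
proof (cases "r + s = 0")
  case True
  then show ?thesis by (simp add: exp_mixed_0 fps_over_def binomQ_h_c_mem)
next
  case False
  define e where "e = (if r + s > 0 then Pos else Neg)"
  have "int (Suc n) * (r + s) = pm_sign e * int (nat \<bar>r + s\<bar> * Suc n)" for n
    by (auto simp: e_def algebra_simps)
  then have "mixed r s = (\<lambda>n. h_el (pm_sign e * int (nat \<bar>r + s\<bar> * Suc n)))"
    using False by (simp only: mixed_def fun_eq_iff if_False of_int_0 mult_zero_left add_0_right) simp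
  then have "exp_of (mixed r s) \<in> fps_over (UZ_0pm e)"
    using exp_series_multiple_mem[of e "nat \<bar>r + s\<bar>" "exp_of (mixed r s)"] mixed.exp_series_axioms[of r s] False by simp
  then show ?thesis using UZ_0pm_subset by (auto simp: fps_over_def)
qed

lemma div_power_signed_series:
  assumes "\<And>n. f $ n = (- 1) ^ n * x_el e (t n)"
  shows "div_power f k \<in> fps_over (dp_span e k)"
proof (rule dp_span.div_power_fps)
  show "f $ i * f $ j = f $ j * f $ i" for i j
    unfolding assms by (simp add: minus_one_power_iff x_x)
  show "div_power (f $ i) k \<in> dp_span e k" for i k
    using div_power_of_int_mult[OF dp_span.graded_subring_axioms dp_span_single, of "(- 1) ^ i" e "t i" k]
    by (simp add: assms)
qed

lemma div_power_xi_mem: "div_power (mixed.\<xi> s r) k \<in> fps_over (UZ_pm Neg)"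
proof -
  have "div_power (mixed.\<xi> s r) k \<in> fps_over (dp_span Neg k)"
    by (rule div_power_signed_series) (simp add: mixed.\<xi>_def)
  then show ?thesis using dp_span_subset by (auto simp: fps_over_def)
qed

lemma div_power_eta_mem: "div_power (mixed.\<eta> r s) k \<in> fps_over (dp_span Pos k)"
  by (rule div_power_signed_series) (simp add: mixed.\<eta>_def)

definition lower :: "uhat set" where "lower = UZ_pm Neg \<odot> UZ_0"

lemma lower_subalgebra: "Z_subalgebra lower"
  unfolding lower_def by (rule prod_span_subalgebra[OF UZ_pm_subalgebra UZ_0_subalgebra UZ_0_past_Neg])

text \<open>The degree filtration of the positive part on which the exchange of positive and
  negative factors is organised.\<close>

definition dp_upto :: "nat \<Rightarrow> uhat set"
  where "dp_upto d = (\<Union>j\<le>d. dp_products Pos j)"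

lemma lower_dp_span: "j \<le> d \<Longrightarrow> lower \<odot> dp_span Pos j \<subseteq> lower \<odot> dp_upto d"
  unfolding dp_span_def prod_span_zspan by (rule prod_span_mono) (auto simp: dp_upto_def)

text \<open>The summand \<open>i\<close> of the straightening formula ends in a divided power of
  \<eta> of degree \<open>k - i\<close>, which gives the bound \<open>k\<close>.\<close>

lemma Pos_past_Neg_gen:
  "div_power (x_el Pos r) k * div_power (x_el Neg s) l \<in> lower \<odot> dp_upto k"
proof -
  have "((if i \<le> l then div_power (mixed.\<xi> s r) (l - i) else 0) * exp_of (mixed r s) * div_power (mixed.\<eta> r s) (k - i)) $ n
      \<in> lower \<odot> dp_upto k" for i n
  proof -
    let ?D = "if i \<le> l then div_power (mixed.\<xi> s r) (l - i) else 0"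
    have "?D $ a \<in> UZ_pm Neg" for a
      using fps_overD[OF div_power_xi_mem] by (simp add: Z_subalgebra_zero[OF UZ_pm_subalgebra])
    then have "(?D * exp_of (mixed r s)) $ a \<in> lower" for a
      unfolding fps_mult_nth lower_def
      by (intro prod_span_sum prod_spanI fps_overD[OF exp_mixed_mem])
    then have "(?D * exp_of (mixed r s) * div_power (mixed.\<eta> r s) (k - i)) $ n \<in> lower \<odot> dp_span Pos (k - i)"
      unfolding fps_mult_nth[of "?D * exp_of (mixed r s)"]
      by (intro prod_span_sum prod_spanI[of _ lower] fps_overD[OF div_power_eta_mem])
    then show ?thesis using lower_dp_span[of "k - i" k] by auto
  qed
  then show ?thesis
    using mixed.div_power_straighten[of r s k l] by (simp add: prod_span_sum)
qed

text \<open>Strong induction on \<open>d\<close>. A product with a proper splitting consists of a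
  first factor and a rest, both of degree below \<open>d\<close>. The rest passes the negative
  factor by induction; the first factor then has to pass the resulting element of
  \<open>lower\<close>, which is again covered by the induction hypothesis (\<open>x_lower\<close>).
  A single factor of full degree is handled by the straightening formula.\<close>

lemma dp_upto_past_Neg: "c \<in> dp_upto d \<Longrightarrow> a \<in> UZ_pm Neg \<Longrightarrow> c * a \<in> lower \<odot> dp_upto d"
proof (induction d arbitrary: c a rule: less_induct)
  case (less d)
  have x_lower: "div_power (x_el Pos r) j * p \<in> lower \<odot> dp_upto j" if "j < d" "p \<in> lower" for r j p
    using that(2) unfolding lower_def[of] 
  proof (induction rule: prod_span_induct)
    case (mult a b)
    have "div_power (x_el Pos r) j \<in> dp_upto j" using dp_products_single by (auto simp: dp_upto_def)
    from less.IH[OF that(1) this mult(1)] have "div_power (x_el Pos r) j * a * b \<in> lower \<odot> dp_upto j"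
    proof (induction rule: prod_span_induct)
      case (mult p v)
      then obtain i where i: "i \<le> j" "v \<in> dp_products Pos i" by (auto simp: dp_upto_def)
      have "UZ_0 \<subseteq> lower" unfolding lower_def by (rule subset_prod_span_right[OF UZ_pm_subalgebra])
      then have "v * b \<in> lower \<odot> dp_upto j"
        using dp_products_past_UZ_0[OF i(2) \<open>b \<in> UZ_0\<close>] prod_span_mono[OF _ subset_refl] lower_dp_span[OF i(1)] by blast
      then have "p * (v * b) \<in> lower \<odot> dp_upto j" by (rule prod_span_mult_left[OF lower_subalgebra mult(1)])
      then show ?case by (simp add: mult.assoc)
    qed (simp_all add: prod_span_zero left_diff_distrib prod_span_diff)
    then show ?case by (simp add: mult.assoc lower_def)
  qed (simp_all add: prod_span_zero right_diff_distrib prod_span_diff)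
  have gen: "prod_list (map (\<lambda>(r, j). div_power (x_el Pos r) j) ps) * div_power (x_el Neg s) l \<in> lower \<odot> dp_upto d"
    if "sum_list (map snd ps) \<le> d" for ps s l
    using that
  proof (induction ps)
    case Nil
    have "div_power (x_el Neg s) l \<in> lower"
      using subset_prod_span_left[OF UZ_0_subalgebra, of "UZ_pm Neg"] dp_span_single dp_span_subset unfolding lower_def by blast
    moreover have "1 \<in> dp_upto d" using dp_products_one by (auto simp: dp_upto_def)
    ultimately show ?case using prod_spanI[of _ lower 1] by simp
  next
    case (Cons p ps)
    obtain r j where p: "p = (r, j)" by fastforce
    let ?rest = "prod_list (map (\<lambda>(r, j). div_power (x_el Pos r) j) ps)"
    have sum: "j + sum_list (map snd ps) \<le> d" using Cons.prems p by simp
    \<comment> \<open>A part of degree 0 is equal to 1; in the last case both parts have positive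
      degree, hence degree below \<open>d\<close>.\<close>
    consider "j = 0" | "sum_list (map snd ps) = 0" | "j < d" "sum_list (map snd ps) < d" "j > 0"
      using sum by linarith
    then show ?case
    proof cases
      case 1
      then show ?thesis using Cons p by simp
    next
      case 2
      then have "?rest = 1" by (induction ps) auto
      then show ?thesis
        using Pos_past_Neg_gen[of r j s l] sum prod_span_mono[OF subset_refl, of "dp_upto j" "dp_upto d" lower]
        by (force simp: p dp_upto_def)
    next
      case 3
      have "?rest \<in> dp_products Pos (sum_list (map snd ps))" by (auto simp: dp_products_def)
      then have rest: "?rest \<in> dp_upto (sum_list (map snd ps))" by (auto simp: dp_upto_def)
      have "div_power (x_el Neg s) l \<in> UZ_pm Neg" using dp_span_single dp_span_subset by blast
      from less.IH[OF 3(2) rest this]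
      have "div_power (x_el Pos r) j * (?rest * div_power (x_el Neg s) l) \<in> lower \<odot> dp_upto d"
      proof (induction rule: prod_span_induct)
        case (mult q v)
        from x_lower[OF 3(1) mult(1), of r] have "div_power (x_el Pos r) j * q * v \<in> lower \<odot> dp_upto d"
        proof (induction rule: prod_span_induct)
          case (mult q' v')
          obtain i where i: "i \<le> sum_list (map snd ps)" "v \<in> dp_products Pos i"
            using \<open>v \<in> dp_upto _\<close> by (auto simp: dp_upto_def)
          obtain i' where i': "i' \<le> j" "v' \<in> dp_products Pos i'"
            using mult(2) by (auto simp: dp_upto_def)
          have "v' * v \<in> dp_upto d"
            using dp_products_mult[OF i'(2) i(2)] i(1) i'(1) sum unfolding dp_upto_def by force
          then show ?case using prod_spanI[OF mult(1)] by (simp add: mult.assoc)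
        qed (simp_all add: prod_span_zero left_diff_distrib prod_span_diff)
        then show ?case by (simp add: mult.assoc)
      qed (simp_all add: prod_span_zero right_diff_distrib prod_span_diff)
      then show ?thesis by (simp add: p mult.assoc)
    qed
  qed
  have "b * a \<in> lower \<odot> dp_upto d" if "b \<in> dp_upto d" "a \<in> {div_power (x_el Neg r) k | r k. True}" for b a
    using that gen by (fastforce simp: dp_upto_def dp_products_def)
  then show ?case
    by (rule move_past_left[OF lower_subalgebra _ less.prems(2)[unfolded UZ_pm_def] less.prems(1)])
qed

lemma Pos_past_lower: "c \<in> UZ_pm Pos \<Longrightarrow> p \<in> lower \<Longrightarrow> c * p \<in> lower \<odot> UZ_pm Pos"
proof -
  assume c: "c \<in> UZ_pm Pos" and p: "p \<in> lower"
  have up: "dp_upto d \<subseteq> UZ_pm Pos" for d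
    unfolding dp_upto_def using dp_products_subset by blast
  have ca: "c * a \<in> lower \<odot> UZ_pm Pos" if "a \<in> UZ_pm Neg" for a
  proof -
    have "c \<in> zspan (\<Union>k. dp_products Pos k)" using c UZ_pm_dp_products by blast
    then show ?thesis
    proof induction
      case (base c)
      then obtain d where "c \<in> dp_upto d" by (auto simp: dp_upto_def)
      then show ?case
        using dp_upto_past_Neg[OF _ that] prod_span_mono[OF subset_refl up] by blast
    qed (simp_all add: prod_span_zero left_diff_distrib prod_span_diff)
  qed
  have "UZ_0 \<subseteq> lower" unfolding lower_def by (rule subset_prod_span_right[OF UZ_pm_subalgebra])
  then have vb: "v * b \<in> lower \<odot> UZ_pm Pos" if "v \<in> UZ_pm Pos" "b \<in> UZ_0" for v b
    using Pos_past_UZ_0[OF that] prod_span_mono[OF _ subset_refl] by blast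
  from p show ?thesis
    unfolding lower_def[of]
  proof (induction rule: prod_span_induct)
    case (mult a b)
    from ca[OF mult(1)] have "c * a * b \<in> lower \<odot> UZ_pm Pos"
    proof (induction rule: prod_span_induct)
      case (mult q v)
      then show ?case
        using prod_span_mult_left[OF lower_subalgebra mult(1) vb[OF mult(2) \<open>b \<in> UZ_0\<close>]] by (simp add: mult.assoc)
    qed (simp_all add: prod_span_zero left_diff_distrib prod_span_diff)
    then show ?case by (simp add: mult.assoc lower_def)
  qed (simp_all add: prod_span_zero right_diff_distrib prod_span_diff)
qed

lemma UZ_pm_subset: "UZ_pm e \<subseteq> UZ"
  unfolding UZ_pm_def UZ_def by (rule hull_mono) blast

text \<open>In the straightening formula for \<open>k = l = n\<close> the last summand is the
  coefficient \<open>n\<close> of the Cartan series, and all other summands involve only earlier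
  coefficients. Solving for it recovers the Cartan part from the generators of
  \<open>UZ\<close>.\<close>

lemma exp_mixed_in_UZ: "exp_of (mixed r s) $ n \<in> UZ"
proof (induction n rule: less_induct)
  case (less n)
  let ?D = "\<lambda>i. if i \<le> n then div_power (mixed.\<xi> s r) (n - i) else 0"
  let ?t = "\<lambda>i. (?D i * exp_of (mixed r s) * div_power (mixed.\<eta> r s) (n - i)) $ i"
  have t: "?t i \<in> UZ" if "i < n" for i
  proof -
    have "?D i $ a \<in> UZ" for a
      using fps_overD[OF div_power_xi_mem] UZ_pm_subset by (simp add: Z_subalgebra_zero[OF UZ_subalgebra]) blast
    moreover have "div_power (mixed.\<eta> r s) (n - i) $ a \<in> UZ" for a
      using fps_overD[OF div_power_eta_mem] UZ_pm_subset dp_span_subset by blast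
    ultimately show ?thesis
      unfolding fps_mult_nth using that
      by (intro Z_subalgebra_sum[OF UZ_subalgebra] Z_subalgebra_mult[OF UZ_subalgebra] less) auto
  qed
  have "div_power (x_el Pos r) n * div_power (x_el Neg s) n = (\<Sum>i=0..n. ?t i)"
    using mixed.div_power_straighten[of r s n n] by simp
  also have "\<dots> = (\<Sum>i<n. ?t i) + exp_of (mixed r s) $ n"
    by (simp add: atLeast0AtMost lessThan_Suc_atMost[symmetric])
  finally have "exp_of (mixed r s) $ n = div_power (x_el Pos r) n * div_power (x_el Neg s) n - (\<Sum>i<n. ?t i)"
    by (simp add: eq_diff_eq add.commute)
  moreover have "div_power (x_el e r) n \<in> UZ" for e r
    using dp_span_single dp_span_subset UZ_pm_subset by blast
  ultimately show ?case
    using t by (auto intro!: Z_subalgebra_diff[OF UZ_subalgebra] Z_subalgebra_mult[OF UZ_subalgebra]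
        Z_subalgebra_sum[OF UZ_subalgebra])
qed

text \<open>The modes \<open>r = 0\<close> and \<open>s = 1\<close> or \<open>s = -1\<close> produce
  the \<open>hhat\<close>; the modes \<open>r\<close> and \<open>-r\<close> produce the binomials of
  \<open>h_el 0 + r c\<close>. Those of \<open>c_el\<close> follow from \<open>r = 0\<close> and
  \<open>r = 1\<close> by writing \<open>c = (h_0 + c) + (- h_0)\<close>.\<close>

lemma UZ_0_in_UZ: "UZ_0 \<subseteq> UZ"
proof -
  have "hhat e n \<in> UZ" for e n
  proof -
    have "mixed 0 (pm_sign e) = cartan e"
      using pm_sign_cases[of e] by (auto simp: fun_eq_iff mixed_def cartan_def mult.commute)
    then have "Abs_fps (hhat e) = exp_of (mixed 0 (pm_sign e))"
      using mixed.K_unique[of 0 "pm_sign e" "Abs_fps (hhat e)"] exp_series_hhat by simp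
    then show ?thesis using exp_mixed_in_UZ[of 0 "pm_sign e" n] by (metis fps_nth_Abs_fps)
  qed
  then have "UZ_0pm e \<subseteq> UZ" for e
    unfolding UZ_0pm_def by (intro hull_minimal UZ_subalgebra) auto
  moreover have hrc: "binomQ (h_el 0 + of_int r * c_el) n \<in> UZ" for r n
    using exp_mixed_in_UZ[of r "- r" n] by (simp add: exp_mixed_0)
  have h: "binomQ (h_el 0) n \<in> UZ" and hc: "binomQ (h_el 0 + c_el) n \<in> UZ" for n
    using hrc[of 0 n] hrc[of 1 n] by simp_all
  have "(h_el 0 + c_el) * - h_el 0 = - h_el 0 * (h_el 0 + c_el)"
    using c_central[of "h_el 0"] by (simp add: algebra_simps)
  from binomQ_add[OF this]
  have "binomQ c_el n = (\<Sum>i=0..n. binomQ (h_el 0 + c_el) i * binomQ (- h_el 0) (n - i))" for n by simp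
  then have "binomQ c_el n \<in> UZ" for n
    by (auto intro!: Z_subalgebra_sum[OF UZ_subalgebra] Z_subalgebra_mult[OF UZ_subalgebra] hc
        binomQ_minus_mem[OF UZ_subalgebra] h)
  then have "UZ_00 \<subseteq> UZ"
    unfolding UZ_00_def using h by (intro hull_minimal UZ_subalgebra) auto
  ultimately show ?thesis
    unfolding UZ_0_def by (intro hull_minimal UZ_subalgebra) auto
qed

theorem UZ_decomp: "UZ = UZ_pm Neg \<odot> UZ_0 \<odot> UZ_pm Pos"
proof
  have sub: "Z_subalgebra (lower \<odot> UZ_pm Pos)"
    by (rule prod_span_subalgebra[OF lower_subalgebra UZ_pm_subalgebra Pos_past_lower])
  have "UZ_pm Pos \<subseteq> lower \<odot> UZ_pm Pos" "UZ_pm Neg \<subseteq> lower \<odot> UZ_pm Pos"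
    using subset_prod_span_right[OF lower_subalgebra] subset_prod_span_left[OF UZ_pm_subalgebra, of lower]
      subset_prod_span_left[OF UZ_0_subalgebra, of "UZ_pm Neg"] unfolding lower_def by blast+
  moreover have "div_power (x_el e r) k \<in> UZ_pm e" for e r k
    using dp_span_single dp_span_subset by blast
  ultimately have "div_power (x_el e r) k \<in> lower \<odot> UZ_pm Pos" for e r k
    by (cases e) blast+
  then have "UZ \<subseteq> lower \<odot> UZ_pm Pos"
    unfolding UZ_def by (intro hull_minimal sub) auto
  then show "UZ \<subseteq> UZ_pm Neg \<odot> UZ_0 \<odot> UZ_pm Pos" by (simp add: lower_def)
  show "UZ_pm Neg \<odot> UZ_0 \<odot> UZ_pm Pos \<subseteq> UZ"
    by (intro prod_span_subset_subalgebra[OF UZ_subalgebra] UZ_pm_subset UZ_0_in_UZ)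
qed

section \<open>Integral bases of the factors\<close>

lemma sorted_list_of_set_subset:
  "finite A \<Longrightarrow> B \<subseteq> A \<Longrightarrow> sorted_list_of_set B = filter (\<lambda>x. x \<in> B) (sorted_list_of_set A)"
  by (rule sorted_distinct_set_unique) (auto simp: finite_subset sorted_wrt_filter)

lemma prod_list_sorted_superset:
  assumes "finite A" "B \<subseteq> A" "\<And>x. x \<in> A \<Longrightarrow> x \<notin> B \<Longrightarrow> f x = (1 :: 'a::monoid_mult)"
  shows "prod_list (map f (sorted_list_of_set B)) = prod_list (map f (sorted_list_of_set A))"
proof -
  have "prod_list (map f (filter (\<lambda>x. x \<in> B) l)) = prod_list (map f l)" if "set l \<subseteq> A" for l
    using that assms(3) by (induction l) auto
  then show ?thesis
    unfolding sorted_list_of_set_subset[OF assms(1,2)] using assms(1) by simp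
qed

lemma commute_prod_list:
  "(\<And>x. x \<in> set l \<Longrightarrow> a * f x = f x * (a :: 'a::monoid_mult)) \<Longrightarrow> a * prod_list (map f l) = prod_list (map f l) * a"
proof (induction l)
  case (Cons x l)
  have "a * f x = f x * a" and "a * prod_list (map f l) = prod_list (map f l) * a"
    using Cons by simp_all
  then have "a * (f x * prod_list (map f l)) = f x * prod_list (map f l) * a" by (metis mult.assoc)
  then show ?case by simp
qed simp

definition monomial_of :: "('i::linorder \<Rightarrow> nat \<Rightarrow> 'a::monoid_mult) \<Rightarrow> ('i \<Rightarrow>\<^sub>0 nat) \<Rightarrow> 'a"
  where "monomial_of f k = prod_list (map (\<lambda>r. f r (Poly_Mapping.lookup k r)) (sorted_list_of_set (Poly_Mapping.keys k)))"

text \<open>Common frame for divided powers, where \<open>c\<close> is a binomial coefficient, and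
  ordinary powers, where \<open>c\<close> is 1.\<close>

locale commuting_powers =
  fixes f :: "'i::linorder \<Rightarrow> nat \<Rightarrow> 'a::ring_1" and c :: "nat \<Rightarrow> nat \<Rightarrow> nat"
  assumes f_comm: "f r i * f s j = f s j * f r i" and f_0: "f r 0 = 1"
    and f_mult: "f r i * f r j = of_nat (c i j) * f r (i + j)"
begin

lemma monomial_of_superset:
  "finite A \<Longrightarrow> Poly_Mapping.keys k \<subseteq> A \<Longrightarrow>
    monomial_of f k = prod_list (map (\<lambda>r. f r (Poly_Mapping.lookup k r)) (sorted_list_of_set A))"
  unfolding monomial_of_def by (rule prod_list_sorted_superset) (auto simp: in_keys_iff f_0)

lemma monomial_of_0: "monomial_of f 0 = 1"
  by (simp add: monomial_of_def)

lemma monomial_of_single: "monomial_of f (Poly_Mapping.single r j) = f r j"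
  using monomial_of_superset[of "{r}" "Poly_Mapping.single r j"] by simp

lemma monomial_of_mult: "\<exists>n. monomial_of f k * monomial_of f k' = of_nat n * monomial_of f (k + k')"
proof -
  let ?A = "Poly_Mapping.keys k \<union> Poly_Mapping.keys k'"
  have "\<exists>n. prod_list (map (\<lambda>r. f r (g r)) l) * prod_list (map (\<lambda>r. f r (h r)) l)
      = of_nat n * prod_list (map (\<lambda>r. f r (g r + h r)) l)" for l g h
  proof (induction l)
    case Nil
    show ?case by (rule exI[of _ 1]) simp
  next
    case (Cons r l)
    let ?G = "prod_list (map (\<lambda>r. f r (g r)) l)" and ?H = "prod_list (map (\<lambda>r. f r (h r)) l)"
      and ?S = "prod_list (map (\<lambda>r. f r (g r + h r)) l)"
    obtain n where n: "?G * ?H = of_nat n * ?S" using Cons by blast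
    have fG: "f r (h r) * ?G = ?G * f r (h r)" by (rule commute_prod_list) (rule f_comm)
    have "f r (g r) * ?G * (f r (h r) * ?H) = f r (g r) * (?G * f r (h r)) * ?H"
      by (simp only: mult.assoc)
    also have "\<dots> = f r (g r) * f r (h r) * (?G * ?H)"
      unfolding fG[symmetric] by (simp only: mult.assoc)
    also have "\<dots> = of_nat (c (g r) (h r)) * (f r (g r + h r) * (of_nat n * ?S))"
      by (simp only: f_mult n mult.assoc)
    also have "\<dots> = of_nat (c (g r) (h r) * n) * (f r (g r + h r) * ?S)"
      by (simp only: mult_of_nat_left_commute[of "f r (g r + h r)"] of_nat_mult mult.assoc)
    finally show ?case unfolding list.map prod_list.Cons by (rule exI)
  qed
  moreover have "Poly_Mapping.keys (k + k') \<subseteq> ?A" by (rule Poly_Mapping.keys_add)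
  ultimately show ?thesis
    using monomial_of_superset[of ?A] by (simp add: lookup_add)
qed

lemma hull_monomials:
  assumes K: "0 \<in> K" "\<And>k k'. k \<in> K \<Longrightarrow> k' \<in> K \<Longrightarrow> k + k' \<in> K"
    and keys: "\<And>k r. k \<in> K \<Longrightarrow> r \<in> Poly_Mapping.keys k \<Longrightarrow> r \<in> R"
    and single: "\<And>r j. r \<in> R \<Longrightarrow> Poly_Mapping.single r j \<in> K"
  shows "Z_subalgebra hull {f r j | r j. r \<in> R} = zspan (monomial_of f ` K)"
proof
  have "a * b \<in> zspan (monomial_of f ` K)" if "a \<in> zspan (monomial_of f ` K)" "b \<in> zspan (monomial_of f ` K)" for a b
  proof (rule zspan_mult[OF _ that])
    fix a b assume "a \<in> monomial_of f ` K" "b \<in> monomial_of f ` K"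
    then obtain k k' where k: "k \<in> K" "k' \<in> K" "a = monomial_of f k" "b = monomial_of f k'" by auto
    obtain n where "a * b = of_nat n * monomial_of f (k + k')" using monomial_of_mult k by blast
    then show "a * b \<in> zspan (monomial_of f ` K)"
      using K(2)[OF k(1,2)] by (simp add: zspan_of_nat zspan.base)
  qed
  then have "Z_subalgebra (zspan (monomial_of f ` K))"
    using K(1) monomial_of_0 by (auto simp: Z_subalgebra_def intro: zspan.intros)
  moreover have "{f r j | r j. r \<in> R} \<subseteq> zspan (monomial_of f ` K)"
    using single monomial_of_single by (auto intro!: zspan.base) (metis image_eqI)
  ultimately show "Z_subalgebra hull {f r j | r j. r \<in> R} \<subseteq> zspan (monomial_of f ` K)"
    by (intro hull_minimal)
  have "monomial_of f k \<in> Z_subalgebra hull {f r j | r j. r \<in> R}" if "k \<in> K" for k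
    unfolding monomial_of_def
    by (rule Z_subalgebra_prod_list[OF Z_subalgebra_hull]) (use keys[OF that] in \<open>auto intro!: hull_inc\<close>)
  then show "zspan (monomial_of f ` K) \<subseteq> Z_subalgebra hull {f r j | r j. r \<in> R}"
    by (intro zspan_subset_subalgebra Z_subalgebra_hull) auto
qed

end

interpretation x_powers: commuting_powers "\<lambda>r j. div_power (x_el e r) j" "\<lambda>i j. (i + j) choose i" for e
proof
  fix r s i j
  have "div_power (x_el e s) j * x_el e r = x_el e r * div_power (x_el e s) j" by (rule div_power_commute[OF x_x])
  then show "div_power (x_el e r) i * div_power (x_el e s) j = div_power (x_el e s) j * div_power (x_el e r) i"
    by (rule div_power_commute[OF sym])
qed (simp_all add: div_power_mult_div_power)

interpretation hhat_powers: commuting_powers "\<lambda>l j. hhat e l ^ j" "\<lambda>i j. 1" for e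
proof
  fix r s i j
  have "hhat e s ^ j * hhat e r = hhat e r * hhat e s ^ j" by (rule power_commuting_commutes[OF hhat_commute])
  then show "hhat e r ^ i * hhat e s ^ j = hhat e s ^ j * hhat e r ^ i"
    by (rule power_commuting_commutes[OF sym])
qed (simp_all add: power_add)

lemma UZ_pm_span: "UZ_pm e = zspan (range (x_monomial e))"
proof -
  have "x_monomial e = monomial_of (\<lambda>r j. div_power (x_el e r) j)"
    by (simp add: fun_eq_iff x_monomial_def monomial_of_def)
  then show ?thesis
    using x_powers.hull_monomials[of UNIV UNIV e] by (simp add: UZ_pm_def)
qed

lemma UZ_0pm_span: "UZ_0pm e = zspan (hhat_monomial e ` pos_exponents)"
proof -
  have m: "hhat_monomial e = monomial_of (\<lambda>r j. hhat e r ^ j)"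
    by (simp add: fun_eq_iff hhat_monomial_def monomial_of_def)
  have "Z_subalgebra hull {hhat e r ^ j | r j. r \<in> {0<..}} = zspan (monomial_of (\<lambda>r j. hhat e r ^ j) ` pos_exponents)"
  proof (rule hhat_powers.hull_monomials)
    show "k + k' \<in> pos_exponents" if "k \<in> pos_exponents" "k' \<in> pos_exponents" for k k'
      using that Poly_Mapping.keys_add[of k k'] by (auto simp: pos_exponents_def)
    show "r \<in> {0<..}" if "k \<in> pos_exponents" "r \<in> Poly_Mapping.keys k" for k r
      using that by (cases "r = 0") (auto simp: pos_exponents_def)
  qed (auto simp: pos_exponents_def)
  moreover have "Z_subalgebra hull {hhat e r ^ j | r j. r \<in> {0<..}} = UZ_0pm e"
  proof
    show "Z_subalgebra hull {hhat e r ^ j | r j. r \<in> {0<..}} \<subseteq> UZ_0pm e"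
      by (intro hull_minimal UZ_0pm_subalgebra)
        (auto intro!: Z_subalgebra_power[OF UZ_0pm_subalgebra] hhat_in_UZ_0pm)
    have "hhat e k \<in> {hhat e r ^ j | r j. r \<in> {0<..}}" if "k > 0" for k
      using that by (metis (mono_tags, lifting) greaterThan_iff mem_Collect_eq power_one_right)
    then show "UZ_0pm e \<subseteq> Z_subalgebra hull {hhat e r ^ j | r j. r \<in> {0<..}}"
      unfolding UZ_0pm_def by (intro hull_mono) blast
  qed
  ultimately show ?thesis by (simp add: m)
qed

lemma UZ_00_span: "UZ_00 = zspan (range binom_monomial)"
proof
  have hc: "binomQ (h_el 0) k * binomQ c_el l = binomQ c_el l * binomQ (h_el 0) k" for k l
    by (rule binomQ_commute[OF c_central, symmetric])
  have b: "binomQ (h_el 0) k * binomQ c_el l \<in> range binom_monomial" for k l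
    by (rule range_eqI[of _ _ "(k, l)"]) (simp add: binom_monomial_def)
  have bb: "binomQ a k * binomQ a l \<in> zspan (range (binomQ a))" for k l and a :: uhat
    unfolding binomQ_mult by (intro zspan_sum zspan_of_nat zspan.base) simp
  have "u * v \<in> zspan (range binom_monomial)"
    if "u \<in> zspan (range binom_monomial)" "v \<in> zspan (range binom_monomial)" for u v
  proof (rule zspan_mult[OF _ that])
    fix u v assume "u \<in> range binom_monomial" "v \<in> range binom_monomial"
    then obtain k l k' l' where u: "u = binomQ (h_el 0) k * binomQ c_el l" and v: "v = binomQ (h_el 0) k' * binomQ c_el l'"
      by (auto simp: binom_monomial_def)
    have "u * v = binomQ (h_el 0) k * (binomQ c_el l * binomQ (h_el 0) k') * binomQ c_el l'"
      by (simp add: u v mult.assoc)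
    also have "\<dots> = (binomQ (h_el 0) k * binomQ (h_el 0) k') * (binomQ c_el l * binomQ c_el l')"
      by (simp only: hc[symmetric] mult.assoc)
    also have "\<dots> \<in> zspan (range binom_monomial)"
      by (rule zspan_mult[OF _ bb bb]) (auto intro: zspan.base b)
    finally show "u * v \<in> zspan (range binom_monomial)" .
  qed
  moreover have "1 \<in> range binom_monomial" using b[of 0 0] by simp
  ultimately have "Z_subalgebra (zspan (range binom_monomial))"
    by (auto simp: Z_subalgebra_def intro: zspan.intros)
  moreover have "binomQ (h_el 0) k \<in> range binom_monomial" "binomQ c_el k \<in> range binom_monomial" for k
    using b[of k 0] b[of 0 k] by simp_all
  ultimately show "UZ_00 \<subseteq> zspan (range binom_monomial)"
    unfolding UZ_00_def by (intro hull_minimal) (auto intro: zspan.base)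
  show "zspan (range binom_monomial) \<subseteq> UZ_00"
    by (intro zspan_subset_subalgebra UZ_00_subalgebra)
       (auto simp: binom_monomial_def intro!: Z_subalgebra_mult[OF UZ_00_subalgebra] binomQ_in_UZ_00)
qed

section \<open>Linear independence of the basis\<close>

instantiation poly_mapping :: (comm_monoid_add, field_char_0) rat_algebra_1
begin

definition scaleQ_poly_mapping :: "rat \<Rightarrow> ('a \<Rightarrow>\<^sub>0 'b) \<Rightarrow> ('a \<Rightarrow>\<^sub>0 'b)"
  where "scaleQ_poly_mapping q p = Poly_Mapping.single 0 (of_rat q) * p"

instance
proof
  fix p q :: rat and a b :: "'a \<Rightarrow>\<^sub>0 'b"
  show "q *\<^sub>Q (a + b) = q *\<^sub>Q a + q *\<^sub>Q b" by (simp add: scaleQ_poly_mapping_def distrib_left)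
  show "(p + q) *\<^sub>Q a = p *\<^sub>Q a + q *\<^sub>Q a"
    by (simp add: scaleQ_poly_mapping_def of_rat_add single_add distrib_right)
  show "p *\<^sub>Q q *\<^sub>Q a = (p * q) *\<^sub>Q a"
    by (simp add: scaleQ_poly_mapping_def of_rat_mult mult_single flip: mult.assoc)
  show "1 *\<^sub>Q a = a" by (simp add: scaleQ_poly_mapping_def)
  show "(q *\<^sub>Q a) * b = q *\<^sub>Q (a * b)" by (simp add: scaleQ_poly_mapping_def mult.assoc)
  show "a * (q *\<^sub>Q b) = q *\<^sub>Q (a * b)" by (simp add: scaleQ_poly_mapping_def mult.left_commute)
qed

end

lemma lookup_scaleQ: "Poly_Mapping.lookup (q *\<^sub>Q p) m = of_rat q * Poly_Mapping.lookup p m"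
  by (simp add: scaleQ_poly_mapping_def Poly_Mapping.map.rep_eq when_def flip: mult_map_scale_conv_mult)

text \<open>The power sums \<open>p\<^sub>n\<^sub>+\<^sub>1\<close> from the elementary symmetric functions \<open>X\<^sub>n\<close>, by Newton's identities.\<close>

fun newton :: "(nat \<Rightarrow> 'p::comm_ring_1) \<Rightarrow> nat \<Rightarrow> 'p" where
  "newton X n = (- 1) ^ n * (of_nat (Suc n) * X (Suc n) - (\<Sum>i<n. (- 1) ^ i * newton X i * X (n - i)))"

declare newton.simps [simp del]

lemma newton_identity:
  assumes "X 0 = 1"
  shows "of_nat (Suc n) * X (Suc n) = (\<Sum>i=0..n. (- 1) ^ i * newton X i * X (n - i))"
proof -
  have "(- 1) ^ n * newton X n = of_nat (Suc n) * X (Suc n) - (\<Sum>i<n. (- 1) ^ i * newton X i * X (n - i))"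
    by (subst newton.simps) (simp add: minus_one_power_iff)
  then show ?thesis
    by (simp add: atLeast0AtMost lessThan_Suc_atMost[symmetric] assms)
qed

section \<open>Monomials in variables named by the generators, and the evaluation of each
  block\<close>

type_synonym gen_poly = "(gen \<Rightarrow>\<^sub>0 nat) \<Rightarrow>\<^sub>0 rat"

definition gen_monom :: "(gen \<Rightarrow>\<^sub>0 nat) \<Rightarrow> gen_poly"
  where "gen_monom m = Poly_Mapping.single m 1"

lemma gen_monom_mult: "gen_monom m * gen_monom m' = gen_monom (m + m')"
  by (simp add: gen_monom_def mult_single)

lemma gen_monom_0 [simp]: "gen_monom 0 = 1"
  by (simp add: gen_monom_def)

definition gen_var :: "gen \<Rightarrow> gen_poly"
  where "gen_var g = gen_monom (Poly_Mapping.single g 1)"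

lemma gen_var_power: "gen_var g ^ k = gen_monom (Poly_Mapping.single g k)"
  by (induction k) (simp_all add: gen_var_def gen_monom_mult flip: single_add)

definition hvar :: "pm \<Rightarrow> nat \<Rightarrow> gen_poly"
  where "hvar e l = (if l = 0 then 1 else gen_var (Gen_h (pm_sign e * int l)))"

lemma hvar_0: "hvar e 0 = 1"
  by (simp add: hvar_def)

text \<open>The nonzero Cartan modes become the power sums for which the \<open>hhat\<close> are
  variables; \<open>newton\<close> counts from 0, whence the \<open>- 1\<close>. The zero mode and
  \<open>c\<close> become numbers, left open so that they can be adapted to a given linear
  relation.\<close>

definition gen_eval :: "nat \<Rightarrow> nat \<Rightarrow> gen \<Rightarrow> gen_poly"
  where "gen_eval n n' g = (case g of Gen_x e r \<Rightarrow> gen_var g | Gen_c \<Rightarrow> of_nat n'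
    | Gen_h r \<Rightarrow> if r = 0 then of_nat n else if r > 0 then newton (hvar Pos) (nat r - 1)
        else newton (hvar Neg) (nat (- r) - 1))"

definition x_block :: "pm \<Rightarrow> nat" where "x_block e = (case e of Neg \<Rightarrow> 0 | Pos \<Rightarrow> 4)"
definition h_block :: "pm \<Rightarrow> nat" where "h_block e = (case e of Neg \<Rightarrow> 1 | Pos \<Rightarrow> 3)"

lemma word_pairs_of_nat: "(of_nat n, of_nat n) \<in> word_pairs \<psi> b"
  by (induction n) (simp_all add: word_pairs_zero word_pairs_one word_pairs.add)

lemma word_pairs_div_power: "(u, p) \<in> word_pairs \<psi> b \<Longrightarrow> (div_power u k, div_power p k) \<in> word_pairs \<psi> b"
  unfolding div_power_def by (intro word_pairs.scale word_pairs_power)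

lemma word_pairs_binomQ: "(u, p) \<in> word_pairs \<psi> b \<Longrightarrow> (binomQ u k, binomQ p k) \<in> word_pairs \<psi> b"
  unfolding binomQ_def
  by (intro word_pairs.scale word_pairs_prod_list word_pairs_diff word_pairs_of_nat)

lemma word_pairs_minus_one_power: "((- 1) ^ n, (- 1) ^ n) \<in> word_pairs \<psi> b"
  by (rule word_pairs_power) (use word_pairs_diff[OF word_pairs_zero word_pairs_one, of \<psi> b] in simp)

lemma word_pairs_cartan: "(cartan e i, newton (hvar e) i) \<in> word_pairs (gen_eval n n') (h_block e)"
proof -
  have "(uhat_gen (Gen_h (pm_sign e * int (Suc i))), gen_eval n n' (Gen_h (pm_sign e * int (Suc i))))
      \<in> word_pairs (gen_eval n n') (h_block e)"
    by (rule word_pairs_gen) (cases e; simp add: h_block_def)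
  moreover have "gen_eval n n' (Gen_h (pm_sign e * int (Suc i))) = newton (hvar e) i"
    by (cases e) (simp_all add: gen_eval_def nat_add_distrib)
  ultimately show ?thesis by (simp add: cartan_def h_el_def)
qed

text \<open>The \<open>hhat\<close> and the variables obey the same recursion, and it determines
  both, because the factor in front of the new term can be divided out.\<close>

lemma word_pairs_hhat: "(hhat e k, hvar e k) \<in> word_pairs (gen_eval n n') (h_block e)"
proof (induction k rule: less_induct)
  case (less k)
  show ?case
  proof (cases k)
    case 0
    then show ?thesis by (simp add: hvar_def word_pairs_one)
  next
    case (Suc j)
    have "(\<Sum>i=0..j. (- 1) ^ i * cartan e i * hhat e (j - i), \<Sum>i=0..j. (- 1) ^ i * newton (hvar e) i * hvar e (j - i))
        \<in> word_pairs (gen_eval n n') (h_block e)"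
      by (intro word_pairs_sum word_pairs_mult word_pairs_minus_one_power word_pairs_cartan less)
         (auto simp: Suc)
    then have "(of_nat (Suc j) * hhat e (Suc j), of_nat (Suc j) * hvar e (Suc j)) \<in> word_pairs (gen_eval n n') (h_block e)"
      by (simp only: hhat_Suc newton_identity[of "hvar e", OF hvar_0])
    then have "((1 / of_nat (Suc j)) *\<^sub>Q (of_nat (Suc j) * hhat e (Suc j)), (1 / of_nat (Suc j)) *\<^sub>Q (of_nat (Suc j) * hvar e (Suc j)))
      \<in> word_pairs (gen_eval n n') (h_block e)"
      by (rule word_pairs.scale)
    then show ?thesis
      by (simp add: Suc of_nat_scaleQ scaleQ_scaleQ scaleQ_one del: of_nat_Suc)
  qed
qed

definition exponent_monom :: "('i \<Rightarrow> gen) \<Rightarrow> ('i \<Rightarrow>\<^sub>0 nat) \<Rightarrow> gen \<Rightarrow>\<^sub>0 nat"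
  where "exponent_monom \<gamma> k = (\<Sum>r\<in>Poly_Mapping.keys k. Poly_Mapping.single (\<gamma> r) (Poly_Mapping.lookup k r))"

lemma lookup_exponent_monom:
  assumes "inj \<gamma>"
  shows "Poly_Mapping.lookup (exponent_monom \<gamma> k) (\<gamma> r) = Poly_Mapping.lookup k r"
  using assms by (auto simp: exponent_monom_def lookup_sum lookup_single when_def inj_eq in_keys_iff)

lemma lookup_exponent_monom_notin:
  "g \<notin> \<gamma> ` Poly_Mapping.keys k \<Longrightarrow> Poly_Mapping.lookup (exponent_monom \<gamma> k) g = 0"
  by (auto simp: exponent_monom_def lookup_sum lookup_single when_def intro!: sum.neutral)

lemma prod_list_gen_monom: "prod_list (map (\<lambda>r. gen_monom (f r)) l) = gen_monom (sum_list (map f l))"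
  by (induction l) (simp_all add: gen_monom_mult)

lemma word_pairs_hhat_monomial:
  assumes "k \<in> pos_exponents"
  shows "(hhat_monomial e k, gen_monom (exponent_monom (\<lambda>l. Gen_h (pm_sign e * int l)) k))
    \<in> word_pairs (gen_eval n n') (h_block e)"
proof -
  let ?l = "sorted_list_of_set (Poly_Mapping.keys k)"
  have "(hhat_monomial e k, prod_list (map (\<lambda>l. hvar e l ^ Poly_Mapping.lookup k l) ?l)) \<in> word_pairs (gen_eval n n') (h_block e)"
    unfolding hhat_monomial_def by (intro word_pairs_prod_list word_pairs_power word_pairs_hhat)
  also have "map (\<lambda>l. hvar e l ^ Poly_Mapping.lookup k l) ?l
      = map (\<lambda>l. gen_monom (Poly_Mapping.single (Gen_h (pm_sign e * int l)) (Poly_Mapping.lookup k l))) ?l"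
    using assms by (auto simp: hvar_def gen_var_power pos_exponents_def)
  finally show ?thesis
    by (simp add: prod_list_gen_monom exponent_monom_def sum_list_distinct_conv_sum_set)
qed

definition x_coeff :: "(int \<Rightarrow>\<^sub>0 nat) \<Rightarrow> rat"
  where "x_coeff k = (\<Prod>r\<in>Poly_Mapping.keys k. 1 / fact (Poly_Mapping.lookup k r))"

lemma x_coeff_nonzero: "x_coeff k \<noteq> 0"
  by (simp add: x_coeff_def)

lemma word_pairs_x_monomial:
  "(x_monomial e k, x_coeff k *\<^sub>Q gen_monom (exponent_monom (Gen_x e) k)) \<in> word_pairs (gen_eval n n') (x_block e)"
proof -
  let ?l = "sorted_list_of_set (Poly_Mapping.keys k)"
  have "(x_el e r, gen_var (Gen_x e r)) \<in> word_pairs (gen_eval n n') (x_block e)" for r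
    using word_pairs_gen[of "Gen_x e r" "x_block e" "gen_eval n n'"]
    by (cases e) (simp_all add: x_el_def gen_eval_def x_block_def)
  then have "(x_monomial e k, prod_list (map (\<lambda>r. div_power (gen_var (Gen_x e r)) (Poly_Mapping.lookup k r)) ?l))
      \<in> word_pairs (gen_eval n n') (x_block e)"
    unfolding x_monomial_def by (intro word_pairs_prod_list word_pairs_div_power)
  also have "prod_list (map (\<lambda>r. div_power (gen_var (Gen_x e r)) (Poly_Mapping.lookup k r)) l)
      = prod_list (map (\<lambda>r. 1 / fact (Poly_Mapping.lookup k r)) l)
        *\<^sub>Q prod_list (map (\<lambda>r. gen_monom (Poly_Mapping.single (Gen_x e r) (Poly_Mapping.lookup k r))) l)" for l
    by (induction l) (simp_all add: scaleQ_one div_power_def gen_var_power mult_scaleQ_left mult_scaleQ_right scaleQ_scaleQ mult.commute)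
  also have "prod_list (map (\<lambda>r. 1 / fact (Poly_Mapping.lookup k r)) ?l) = x_coeff k"
    using prod.distinct_set_conv_list[of ?l "\<lambda>r. 1 / fact (Poly_Mapping.lookup k r) :: rat"]
    by (simp add: x_coeff_def)
  finally show ?thesis
    by (simp add: prod_list_gen_monom exponent_monom_def sum_list_distinct_conv_sum_set)
qed

lemma word_pairs_binom_monomial:
  "(binom_monomial (a, b), of_nat ((n choose a) * (n' choose b))) \<in> word_pairs (gen_eval n n') 2"
proof -
  have "(h_el 0, of_nat n) \<in> word_pairs (gen_eval n n') 2" "(c_el, of_nat n') \<in> word_pairs (gen_eval n n') 2"
    using word_pairs_gen[of "Gen_h 0" 2 "gen_eval n n'"] word_pairs_gen[of Gen_c 2 "gen_eval n n'"]
    by (simp_all add: h_el_def c_el_def gen_eval_def)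
  then have "(binomQ (h_el 0) a * binomQ c_el b, binomQ (of_nat n) a * binomQ (of_nat n') b) \<in> word_pairs (gen_eval n n') 2"
    by (intro word_pairs_mult word_pairs_binomQ)
  then show ?thesis by (simp add: binom_monomial_def binomQ_of_nat)
qed

type_synonym basis_index = "(int \<Rightarrow>\<^sub>0 nat) \<times> (nat \<Rightarrow>\<^sub>0 nat) \<times> (nat \<times> nat) \<times> (nat \<Rightarrow>\<^sub>0 nat) \<times> (int \<Rightarrow>\<^sub>0 nat)"

definition basis_indices :: "basis_index set"
  where "basis_indices = UNIV \<times> pos_exponents \<times> UNIV \<times> pos_exponents \<times> UNIV"

definition basis_elem :: "basis_index \<Rightarrow> uhat"
  where "basis_elem = (\<lambda>(k, l, p, l', k').
    x_monomial Neg k * hhat_monomial Neg l * binom_monomial p * hhat_monomial Pos l' * x_monomial Pos k')"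

text \<open>The pair \<open>p\<close> leaves no trace in the monomial, since binomials are evaluated
  to numbers; it is kept apart in \<open>index_binom\<close>.\<close>

definition index_monom :: "basis_index \<Rightarrow> gen \<Rightarrow>\<^sub>0 nat"
  where "index_monom = (\<lambda>(k, l, p, l', k'). exponent_monom (Gen_x Neg) k
    + exponent_monom (\<lambda>l. Gen_h (pm_sign Neg * int l)) l
    + exponent_monom (\<lambda>l. Gen_h (pm_sign Pos * int l)) l' + exponent_monom (Gen_x Pos) k')"

definition index_binom :: "basis_index \<Rightarrow> nat \<times> nat"
  where "index_binom = (\<lambda>(k, l, p, l', k'). p)"

definition index_coeff :: "basis_index \<Rightarrow> rat"
  where "index_coeff = (\<lambda>(k, l, p, l', k'). x_coeff k * x_coeff k')"

lemma symbol_basis_elem: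
  assumes "i \<in> basis_indices"
  shows "symbol (gen_eval n n') (basis_elem i) = (index_coeff i *
    of_nat ((n choose fst (index_binom i)) * (n' choose snd (index_binom i)))) *\<^sub>Q gen_monom (index_monom i)"
proof -
  obtain k l a b l' k' where i: "i = (k, l, (a, b), l', k')" by (metis prod.exhaust)
  have l: "l \<in> pos_exponents" "l' \<in> pos_exponents" using assms by (auto simp: i basis_indices_def)
  note w = word_pairs_x_monomial[of Neg, unfolded x_block_def pm.case]
    word_pairs_hhat_monomial[OF l(1), of Neg, unfolded h_block_def pm.case]
    word_pairs_binom_monomial word_pairs_hhat_monomial[OF l(2), of Pos, unfolded h_block_def pm.case]
    word_pairs_x_monomial[of Pos, unfolded x_block_def pm.case]
  have "symbol (gen_eval n n') (basis_elem i) =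
      x_coeff k *\<^sub>Q gen_monom (exponent_monom (Gen_x Neg) k)
      * gen_monom (exponent_monom (\<lambda>l. Gen_h (pm_sign Neg * int l)) l)
      * of_nat ((n choose a) * (n' choose b))
      * gen_monom (exponent_monom (\<lambda>l. Gen_h (pm_sign Pos * int l)) l')
      * x_coeff k' *\<^sub>Q gen_monom (exponent_monom (Gen_x Pos) k')"
    unfolding i basis_elem_def prod.case by (rule symbol_blocks[OF w])
  then show ?thesis
    by (simp add: i index_coeff_def index_binom_def index_monom_def gen_monom_mult
        mult_scaleQ_left mult_scaleQ_right scaleQ_scaleQ of_nat_scaleQ mult_ac add_ac
        flip: of_nat_mult)
qed

text \<open>The four families of variables are disjoint: as \<open>pos_exponents\<close> excludes
  the index 0, the two Cartan families cannot meet in \<open>Gen_h 0\<close>.\<close>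

lemma index_monom_inj:
  assumes "i \<in> basis_indices" "j \<in> basis_indices" "index_monom i = index_monom j" "index_binom i = index_binom j"
  shows "i = j"
proof -
  have inj: "inj (Gen_x e)" "inj (\<lambda>l. Gen_h (pm_sign e * int l))" for e
    by (cases e; simp add: inj_def)+
  have pos: "m > 0" if "l \<in> pos_exponents" "m \<in> Poly_Mapping.keys l" for l m
    using that by (cases m) (auto simp: pos_exponents_def)
  obtain k1 l1 p1 l1' k1' where i: "i = (k1, l1, p1, l1', k1')" by (metis prod.exhaust)
  obtain k2 l2 p2 l2' k2' where j: "j = (k2, l2, p2, l2', k2')" by (metis prod.exhaust)
  have x: "Poly_Mapping.lookup (index_monom (k, l, p, l', k')) (Gen_x Neg r) = Poly_Mapping.lookup k r"
    "Poly_Mapping.lookup (index_monom (k, l, p, l', k')) (Gen_x Pos r) = Poly_Mapping.lookup k' r" for k l p l' k' r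
    by (simp_all add: index_monom_def lookup_add lookup_exponent_monom inj lookup_exponent_monom_notin image_iff)
  have h: "Poly_Mapping.lookup (index_monom (k, l, p, l', k')) (Gen_h (pm_sign Neg * int m)) = Poly_Mapping.lookup l m"
    "Poly_Mapping.lookup (index_monom (k, l, p, l', k')) (Gen_h (pm_sign Pos * int m)) = Poly_Mapping.lookup l' m"
    if m: "m > 0" and l: "l \<in> pos_exponents" "l' \<in> pos_exponents" for k l p l' k' m
  proof -
    have n: "Gen_h (pm_sign Neg * int m) \<notin> (\<lambda>l. Gen_h (pm_sign Pos * int l)) ` Poly_Mapping.keys l'"
      "Gen_h (pm_sign Pos * int m) \<notin> (\<lambda>l. Gen_h (pm_sign Neg * int l)) ` Poly_Mapping.keys l"
      using m pos[OF l(1)] pos[OF l(2)] by auto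
    have z: "Poly_Mapping.lookup (exponent_monom (\<lambda>l. Gen_h (pm_sign Pos * int l)) l') (Gen_h (pm_sign Neg * int m)) = 0"
      "Poly_Mapping.lookup (exponent_monom (\<lambda>l. Gen_h (pm_sign Neg * int l)) l) (Gen_h (pm_sign Pos * int m)) = 0"
      by (rule lookup_exponent_monom_notin[OF n(1)], rule lookup_exponent_monom_notin[OF n(2)])
    have xz: "Poly_Mapping.lookup (exponent_monom (Gen_x e) k) (Gen_h n) = 0" for e k n
      by (rule lookup_exponent_monom_notin) auto
    show
      "Poly_Mapping.lookup (index_monom (k, l, p, l', k')) (Gen_h (pm_sign Neg * int m)) = Poly_Mapping.lookup l m"
      "Poly_Mapping.lookup (index_monom (k, l, p, l', k')) (Gen_h (pm_sign Pos * int m)) = Poly_Mapping.lookup l' m"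
      by (simp_all only: index_monom_def prod.case lookup_add z xz lookup_exponent_monom[OF inj(2)] add_0_left add_0_right)
  qed
  have l: "l1 \<in> pos_exponents" "l1' \<in> pos_exponents" "l2 \<in> pos_exponents" "l2' \<in> pos_exponents"
    using assms(1,2) by (auto simp: i j basis_indices_def)
  have 0: "Poly_Mapping.lookup l 0 = 0" if "l \<in> pos_exponents" for l
    using that by (simp add: pos_exponents_def in_keys_iff)
  have "k1 = k2" "k1' = k2'"
    using x[of k1 l1 p1 l1' k1'] x[of k2 l2 p2 l2' k2'] assms(3) by (auto simp: i j intro!: poly_mapping_eqI)
  moreover have "Poly_Mapping.lookup l1 m = Poly_Mapping.lookup l2 m" "Poly_Mapping.lookup l1' m = Poly_Mapping.lookup l2' m" for m
    using h[of m l1 l1' k1 p1 k1'] h[of m l2 l2' k2 p2 k2'] l 0 assms(3)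
    by (cases "m = 0"; simp add: i j)+
  then have "l1 = l2" "l1' = l2'" by (auto intro!: poly_mapping_eqI)
  ultimately show ?thesis using assms(4) by (simp add: i j index_binom_def)
qed

text \<open>Among the terms with nonzero coefficient choose \<open>i\<close> with the least sum of
  its two binomial exponents \<open>n\<close> and \<open>n'\<close>, and evaluate
  \<open>h_el 0\<close> at \<open>n\<close> and \<open>c_el\<close> at \<open>n'\<close>.\<close>

theorem basis_elem_independent:
  assumes A: "finite A" "A \<subseteq> basis_indices" and 0: "(\<Sum>i\<in>A. q i *\<^sub>Q basis_elem i) = 0"
  shows "\<forall>i\<in>A. q i = 0"
proof (rule ccontr)
  define w where "w i = fst (index_binom i) + snd (index_binom i)" for i
  define B where "B = {i \<in> A. q i \<noteq> 0}"
  assume "\<not> (\<forall>i\<in>A. q i = 0)"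
  then obtain i0 where "i0 \<in> A" "q i0 \<noteq> 0" by blast
  then have "finite B" "i0 \<in> B" using A by (simp_all add: B_def)
  then have "finite B" "B \<noteq> {}" by auto
  then obtain i where i: "i \<in> B" "\<And>j. j \<in> B \<Longrightarrow> w i \<le> w j"
    using ex_min_if_finite[of "w ` B"] by (metis (no_types, lifting) finite_imageI image_iff image_is_empty not_le)
  define n n' where "n = fst (index_binom i)" and "n' = snd (index_binom i)"
  let ?c = "\<lambda>j. of_nat ((n choose fst (index_binom j)) * (n' choose snd (index_binom j))) :: rat"
  have sym_sum: "symbol \<psi> (sum f C) = (\<Sum>j\<in>C. symbol \<psi> (f j))" for \<psi> :: "gen \<Rightarrow> gen_poly" and f and C :: "basis_index set"
    by (induction C rule: infinite_finite_induct) (simp_all add: symbol_add)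
  have "0 = symbol (gen_eval n n') (\<Sum>j\<in>A. q j *\<^sub>Q basis_elem j)" by (simp add: 0)
  also have "\<dots> = (\<Sum>j\<in>A. (q j * (index_coeff j * ?c j)) *\<^sub>Q gen_monom (index_monom j))"
    unfolding sym_sum by (rule sum.cong) (use A in \<open>auto simp: symbol_scaleQ symbol_basis_elem scaleQ_scaleQ\<close>)
  finally have "0 = Poly_Mapping.lookup (\<Sum>j\<in>A. (q j * (index_coeff j * ?c j)) *\<^sub>Q gen_monom (index_monom j)) (index_monom i)"
    by (metis lookup_zero)
  also have "\<dots> = (\<Sum>j\<in>A. if j = i then q i * index_coeff i else 0)"
    unfolding lookup_sum
  proof (rule sum.cong)
    fix j assume j: "j \<in> A"
    show "Poly_Mapping.lookup ((q j * (index_coeff j * ?c j)) *\<^sub>Q gen_monom (index_monom j)) (index_monom i)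
        = (if j = i then q i * index_coeff i else 0)"
    proof (cases "j = i")
      case True
      then show ?thesis by (simp add: lookup_scaleQ gen_monom_def n_def n'_def)
    next
      case False
      \<comment> \<open>A binomial with larger lower entry vanishes at \<open>(n, n')\<close>. If
        both entries of \<open>j\<close> are at most those of \<open>i\<close>, minimality makes the
        pairs equal, and then the monomials must differ.\<close>
      have "q j = 0 \<or> ?c j = 0 \<or> index_monom j \<noteq> index_monom i"
      proof (rule ccontr)
        assume "\<not> ?thesis"
        then have nz: "q j \<noteq> 0" "?c j \<noteq> 0" "index_monom j = index_monom i" by auto
        then have "fst (index_binom j) \<le> n" "snd (index_binom j) \<le> n'"
          by (auto simp: not_le[symmetric] binomial_eq_0_iff)
        moreover have "w i \<le> w j" using i(2) j nz by (simp add: B_def)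
        ultimately have "index_binom j = index_binom i"
          by (simp add: w_def n_def n'_def prod_eq_iff)
        then have "j = i"
          using index_monom_inj[of j i] nz A(2) j i(1) by (auto simp: B_def)
        with False show False ..
      qed
      then show ?thesis using False by (auto simp: lookup_scaleQ gen_monom_def lookup_single when_def)
    qed
  qed simp
  also have "\<dots> = q i * index_coeff i" using A i(1) by (simp add: B_def)
  finally show False using i(1) x_coeff_nonzero by (auto simp: B_def index_coeff_def split: prod.splits)
qed

section \<open>Tensor products of free abelian groups\<close>

lemma free_lift_frag_of:
  assumes "comm_group K" "f p \<in> carrier K"
  shows "free_lift K f (frag_of p) = f p"
proof -
  interpret comm_group K by fact
  show ?thesis using assms(2) by (simp add: free_lift_def keys_frag_of int_pow_1)
qed

lemma group_hom_free_lift: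
  assumes "comm_group K" "f \<in> P \<rightarrow> carrier K"
  shows "group_hom (free_Abelian_group P) K (free_lift K f)"
  using free_lift_hom[OF assms] assms(1)
  by (simp add: group_hom_def group_hom_axioms_def comm_group.axioms(2))

lemma free_group_induct [consumes 1, case_names zero diff frag]:
  assumes "Poly_Mapping.keys x \<subseteq> S" "P 0"
    "\<And>x y. \<lbrakk>Poly_Mapping.keys x \<subseteq> S; Poly_Mapping.keys y \<subseteq> S; P x; P y\<rbrakk> \<Longrightarrow> P (x - y)"
    "\<And>a. a \<in> S \<Longrightarrow> P (frag_of a)"
  shows "P x"
  by (rule free_Abelian_group_induct[of x S P]) (use assms in auto)

lemma free_lift_unique:
  assumes K: "comm_group K" and h: "h \<in> hom (free_Abelian_group P) K" "h' \<in> hom (free_Abelian_group P) K"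
    and eq: "\<And>p. p \<in> P \<Longrightarrow> h (frag_of p) = h' (frag_of p)" and u: "Poly_Mapping.keys u \<subseteq> P"
  shows "h u = h' u"
proof -
  interpret K: comm_group K by fact
  interpret h: group_hom "free_Abelian_group P" K h
    using h(1) by (simp add: group_hom_def group_hom_axioms_def K.is_group)
  interpret h': group_hom "free_Abelian_group P" K h'
    using h(2) by (simp add: group_hom_def group_hom_axioms_def K.is_group)
  from u show ?thesis
  proof (induction rule: free_group_induct)
    case zero
    then show ?case using h.hom_one h'.hom_one by simp
  next
    case (diff x y)
    have d: "x - y = x \<otimes>\<^bsub>free_Abelian_group P\<^esub> inv\<^bsub>free_Abelian_group P\<^esub> y" using diff(2) by simp
    have c: "x \<in> carrier (free_Abelian_group P)" "y \<in> carrier (free_Abelian_group P)" using diff by simp_all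
    show ?case
      unfolding d using diff(3,4) c by (simp only: h.hom_mult h'.hom_mult h.hom_inv h'.hom_inv h.G.inv_closed)
  qed (rule eq)
qed

locale tensor_pair =
  fixes G :: "'a monoid" and H :: "'b monoid"
  assumes G: "comm_group G" and H: "comm_group H"
begin

sublocale G: comm_group G by (rule G)
sublocale H: comm_group H by (rule H)

abbreviation "F \<equiv> free_Abelian_group (carrier G \<times> carrier H)"

sublocale F: comm_group F by (rule abelian_free_Abelian_group)

lemma frag_in_F: "a \<in> carrier G \<Longrightarrow> b \<in> carrier H \<Longrightarrow> frag_of (a, b) \<in> carrier F"
  by simp

lemma relators_carrier: "tensor_relators G H \<subseteq> carrier F"
proof
  fix u assume "u \<in> tensor_relators G H"
  then obtain p q r where u: "u = frag_of p - frag_of q - frag_of r"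
    and pqr: "p \<in> carrier G \<times> carrier H" "q \<in> carrier G \<times> carrier H" "r \<in> carrier G \<times> carrier H"
    by cases auto
  have "frag_of p \<in> carrier F" "frag_of q \<in> carrier F" "frag_of r \<in> carrier F"
    using pqr by (simp_all only: frag_of_in_free_Abelian_group)
  then have "frag_of p \<otimes>\<^bsub>F\<^esub> inv\<^bsub>F\<^esub> (frag_of q) \<otimes>\<^bsub>F\<^esub> inv\<^bsub>F\<^esub> (frag_of r) \<in> carrier F"
    by (intro F.m_closed F.inv_closed)
  then show "u \<in> carrier F" using pqr by (simp add: u keys_frag_of)
qed

lemma kernel_subgroup: "subgroup (tensor_kernel G H) F"
  unfolding tensor_kernel_def by (rule F.generate_is_subgroup[OF relators_carrier])

sublocale N: normal "tensor_kernel G H" F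
  by (rule F.subgroup_imp_normal[OF kernel_subgroup])

lemma tensor_comm_group: "comm_group (G \<boxtimes> H)"
  unfolding tensor_def by (rule F.abelian_FactGroup[OF kernel_subgroup])

sublocale T: comm_group "G \<boxtimes> H" by (rule tensor_comm_group)

definition coset where "coset z = tensor_kernel G H #>\<^bsub>F\<^esub> z"

lemma coset_hom: "coset \<in> hom F (G \<boxtimes> H)"
  using N.r_coset_hom_Mod unfolding coset_def tensor_def by simp

sublocale C: group_hom F "G \<boxtimes> H" coset
  using coset_hom by (simp add: group_hom_def group_hom_axioms_def T.is_group F.is_group)

lemma coset_frag: "coset (frag_of (a, b)) = pure_tensor G H a b"
  by (simp add: coset_def pure_tensor_def)

lemma pure_tensor_closed: "a \<in> carrier G \<Longrightarrow> b \<in> carrier H \<Longrightarrow> pure_tensor G H a b \<in> carrier (G \<boxtimes> H)"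
  using C.hom_closed[OF frag_in_F] by (simp add: coset_frag)

lemma coset_kernel: "z \<in> tensor_kernel G H \<Longrightarrow> coset z = \<one>\<^bsub>G \<boxtimes> H\<^esub>"
  unfolding coset_def tensor_def FactGroup_def
  using F.coset_join2[OF _ kernel_subgroup] subgroup.mem_carrier[OF kernel_subgroup] by simp

lemma coset_relator:
  assumes "frag_of p - frag_of q - frag_of r \<in> tensor_relators G H"
    and pqr: "p \<in> carrier G \<times> carrier H" "q \<in> carrier G \<times> carrier H" "r \<in> carrier G \<times> carrier H"
  shows "coset (frag_of p) = coset (frag_of q) \<otimes>\<^bsub>G \<boxtimes> H\<^esub> coset (frag_of r)"
proof -
  let ?u = "frag_of p - frag_of q - frag_of r"
  have u: "?u \<in> tensor_kernel G H"
    using assms(1) unfolding tensor_kernel_def by (rule generate.incl)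
  have c: "?u \<in> carrier F" using relators_carrier assms(1) by blast
  have q: "frag_of q \<in> carrier F" "frag_of r \<in> carrier F"
    using pqr by (simp_all only: frag_of_in_free_Abelian_group)
  have "frag_of p = ?u \<otimes>\<^bsub>F\<^esub> (frag_of q \<otimes>\<^bsub>F\<^esub> frag_of r)" by simp
  then have "coset (frag_of p) = coset ?u \<otimes>\<^bsub>G \<boxtimes> H\<^esub> (coset (frag_of q) \<otimes>\<^bsub>G \<boxtimes> H\<^esub> coset (frag_of r))"
    using C.hom_mult[OF c F.m_closed[OF q]] C.hom_mult[OF q] by simp
  then show ?thesis using coset_kernel[OF u] C.hom_closed[OF q(1)] C.hom_closed[OF q(2)] by simp
qed

lemma pure_tensor_left:
  "a \<in> carrier G \<Longrightarrow> a' \<in> carrier G \<Longrightarrow> b \<in> carrier H \<Longrightarrow>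
    pure_tensor G H (a \<otimes>\<^bsub>G\<^esub> a') b = pure_tensor G H a b \<otimes>\<^bsub>G \<boxtimes> H\<^esub> pure_tensor G H a' b"
  using coset_relator[OF tensor_relators.left] by (simp add: coset_frag)

lemma pure_tensor_right:
  "a \<in> carrier G \<Longrightarrow> b \<in> carrier H \<Longrightarrow> b' \<in> carrier H \<Longrightarrow>
    pure_tensor G H a (b \<otimes>\<^bsub>H\<^esub> b') = pure_tensor G H a b \<otimes>\<^bsub>G \<boxtimes> H\<^esub> pure_tensor G H a b'"
  using coset_relator[OF tensor_relators.right] by (simp add: coset_frag)

lemma pure_tensor_hom_left: "b \<in> carrier H \<Longrightarrow> (\<lambda>a. pure_tensor G H a b) \<in> hom G (G \<boxtimes> H)"
  by (rule homI) (simp_all add: pure_tensor_closed pure_tensor_left)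

lemma pure_tensor_hom_right: "a \<in> carrier G \<Longrightarrow> pure_tensor G H a \<in> hom H (G \<boxtimes> H)"
  by (rule homI) (simp_all add: pure_tensor_closed pure_tensor_right)

lemma tensor_subgroup_UNIV:
  assumes S: "subgroup S (G \<boxtimes> H)"
    and pure: "\<And>a b. a \<in> carrier G \<Longrightarrow> b \<in> carrier H \<Longrightarrow> pure_tensor G H a b \<in> S"
  shows "S = carrier (G \<boxtimes> H)"
proof
  show "S \<subseteq> carrier (G \<boxtimes> H)" using S by (rule subgroup.subset)
  show "carrier (G \<boxtimes> H) \<subseteq> S"
  proof
    fix X assume "X \<in> carrier (G \<boxtimes> H)"
    then obtain z where z: "z \<in> carrier F" and X: "X = coset z"
      by (auto simp: tensor_def carrier_FactGroup coset_def)
    from z have "Poly_Mapping.keys z \<subseteq> carrier G \<times> carrier H" by simp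
    then have "coset z \<in> S"
    proof (induction rule: free_group_induct)
      case zero
      then show ?case using C.hom_one S by (simp add: subgroup.one_closed)
    next
      case (diff x y)
      have cxy: "x \<in> carrier F" "y \<in> carrier F" using diff(1,2) by simp_all
      have "coset (x \<otimes>\<^bsub>F\<^esub> inv\<^bsub>F\<^esub> y) = coset x \<otimes>\<^bsub>G \<boxtimes> H\<^esub> inv\<^bsub>G \<boxtimes> H\<^esub> coset y"
        using cxy by (simp only: C.hom_mult C.hom_inv F.inv_closed)
      then have "coset (x - y) = coset x \<otimes>\<^bsub>G \<boxtimes> H\<^esub> inv\<^bsub>G \<boxtimes> H\<^esub> coset y" using diff(2) by simp
      then show ?case using diff(3,4) S by (simp add: subgroup.m_closed subgroup.m_inv_closed)
    next
      case (frag p)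
      then show ?case using pure by (cases p) (auto simp: coset_frag)
    qed
    then show "X \<in> S" by (simp add: X)
  qed
qed

text \<open>The relators lie in the kernel of the extension to the free group, so this extension is
  constant on each coset, and \<open>the_elem\<close> returns its value.\<close>

lemma tensor_lift_hom:
  assumes K: "comm_group K"
    and f: "\<And>a b. \<lbrakk>a \<in> carrier G; b \<in> carrier H\<rbrakk> \<Longrightarrow> f a b \<in> carrier K"
    and left: "\<And>a a' b. \<lbrakk>a \<in> carrier G; a' \<in> carrier G; b \<in> carrier H\<rbrakk> \<Longrightarrow>
      f (a \<otimes>\<^bsub>G\<^esub> a') b = f a b \<otimes>\<^bsub>K\<^esub> f a' b"
    and right: "\<And>a b b'. \<lbrakk>a \<in> carrier G; b \<in> carrier H; b' \<in> carrier H\<rbrakk> \<Longrightarrow>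
      f a (b \<otimes>\<^bsub>H\<^esub> b') = f a b \<otimes>\<^bsub>K\<^esub> f a b'"
  shows "tensor_lift K f \<in> hom (G \<boxtimes> H) K"
proof -
  interpret K: comm_group K by fact
  let ?l = "free_lift K (\<lambda>(a, b). f a b)"
  have fc: "(\<lambda>(a, b). f a b) \<in> carrier G \<times> carrier H \<rightarrow> carrier K" using f by auto
  interpret l: group_hom F K ?l by (rule group_hom_free_lift[OF K fc])
  have of: "?l (frag_of p) = (\<lambda>(a, b). f a b) p" if "p \<in> carrier G \<times> carrier H" for p
    using free_lift_frag_of[OF K, of "\<lambda>(a, b). f a b" p] that by (cases p) (simp add: f)
  have d: "?l (frag_of p - frag_of q - frag_of r) = \<one>\<^bsub>K\<^esub>"
    if pqr: "p \<in> carrier G \<times> carrier H" "q \<in> carrier G \<times> carrier H" "r \<in> carrier G \<times> carrier H"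
      and eq: "(\<lambda>(a, b). f a b) p = (\<lambda>(a, b). f a b) q \<otimes>\<^bsub>K\<^esub> (\<lambda>(a, b). f a b) r"
      and c: "frag_of p - frag_of q - frag_of r \<in> carrier F" for p q r
  proof -
    let ?u = "frag_of p - frag_of q - frag_of r"
    have q: "frag_of q \<in> carrier F" "frag_of r \<in> carrier F"
      using pqr by (simp_all only: frag_of_in_free_Abelian_group)
    have "?l (frag_of p) = ?l (?u \<otimes>\<^bsub>F\<^esub> (frag_of q \<otimes>\<^bsub>F\<^esub> frag_of r))" by simp
    also have "\<dots> = ?l ?u \<otimes>\<^bsub>K\<^esub> ?l (frag_of p)"
      using l.hom_mult[OF c F.m_closed[OF q]] l.hom_mult[OF q] of[OF pqr(1)] of[OF pqr(2)] of[OF pqr(3)] eq by simp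
    finally have "?l (frag_of p) = ?l ?u \<otimes>\<^bsub>K\<^esub> ?l (frag_of p)" .
    moreover have "?l (frag_of p) \<in> carrier K" using of[OF pqr(1)] pqr(1) by (cases p) (simp add: f)
    ultimately show ?thesis using K.r_cancel_one'[of "?l (frag_of p)" "?l ?u"] l.hom_closed[OF c] by metis
  qed
  have "tensor_relators G H \<subseteq> kernel F K ?l"
  proof
    fix u assume u: "u \<in> tensor_relators G H"
    then have c: "u \<in> carrier F" using relators_carrier by blast
    from u have "?l u = \<one>\<^bsub>K\<^esub>"
    proof cases
      case (left a a' b)
      then show ?thesis using d[of "(a \<otimes>\<^bsub>G\<^esub> a', b)" "(a, b)" "(a', b)"] c assms(3) by auto
    next
      case (right a b b')
      then show ?thesis using d[of "(a, b \<otimes>\<^bsub>H\<^esub> b')" "(a, b)" "(a, b')"] c assms(4) by auto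
    qed
    with c show "u \<in> kernel F K ?l" by (simp only: kernel_def mem_Collect_eq)
  qed
  then have ker: "tensor_kernel G H \<subseteq> kernel F K ?l"
    unfolding tensor_kernel_def by (rule F.generate_subgroup_incl[OF _ l.subgroup_kernel])
  have lift: "tensor_lift K f (coset z) = ?l z" if z: "z \<in> carrier F" for z
  proof -
    have "?l ` coset z = {?l z}"
    proof
      show "?l ` coset z \<subseteq> {?l z}"
      proof
        fix y assume "y \<in> ?l ` coset z"
        then obtain u where u: "u \<in> tensor_kernel G H" and y: "y = ?l (u \<otimes>\<^bsub>F\<^esub> z)"
          unfolding coset_def r_coset_def by blast
        have "u \<in> carrier F" "?l u = \<one>\<^bsub>K\<^esub>" using u ker by (auto simp: kernel_def)
        then show "y \<in> {?l z}" unfolding y using l.hom_mult[of u z] l.hom_closed[OF z] z by simp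
      qed
      have "\<one>\<^bsub>F\<^esub> \<otimes>\<^bsub>F\<^esub> z \<in> coset z"
        unfolding coset_def r_coset_def using subgroup.one_closed[OF kernel_subgroup] by blast
      then show "{?l z} \<subseteq> ?l ` coset z" using z by force
    qed
    then show ?thesis by (simp add: tensor_lift_def)
  qed
  have C: "carrier (G \<boxtimes> H) = coset ` carrier F"
    by (simp add: tensor_def carrier_FactGroup coset_def[abs_def])
  show ?thesis
  proof (rule homI)
    fix X assume "X \<in> carrier (G \<boxtimes> H)"
    then obtain z where z: "z \<in> carrier F" "X = coset z" using C by blast
    show "tensor_lift K f X \<in> carrier K" unfolding z(2) lift[OF z(1)] by (rule l.hom_closed[OF z(1)])
  next
    fix X Y assume X: "X \<in> carrier (G \<boxtimes> H)" and Y: "Y \<in> carrier (G \<boxtimes> H)"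
    from X obtain y where y: "y \<in> carrier F" "X = coset y" unfolding C by (rule imageE)
    from Y obtain z where "z \<in> carrier F" "Y = coset z" unfolding C by (rule imageE)
    note z = y(1) this(1) y(2) this(2)
    have e: "coset y \<otimes>\<^bsub>G \<boxtimes> H\<^esub> coset z = coset (y \<otimes>\<^bsub>F\<^esub> z)"
      by (rule C.hom_mult[OF z(1,2), symmetric])
    show "tensor_lift K f (X \<otimes>\<^bsub>G \<boxtimes> H\<^esub> Y) = tensor_lift K f X \<otimes>\<^bsub>K\<^esub> tensor_lift K f Y"
      unfolding z(3,4) e lift[OF F.m_closed[OF z(1,2)]] lift[OF z(1)] lift[OF z(2)]
      by (rule l.hom_mult[OF z(1,2)])
  qed
qed

lemmas tensor_lift_pure = tensor_lift_pure_tensor[OF _ _ _ _ G.is_group H.is_group]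

end

text \<open>Surjectivity and injectivity of the map from the free abelian group on \<open>I\<close>.
  In contrast to \<open>is_Z_basis\<close> this makes sense for tensor products, which do not lie in
  a ring.\<close>

definition free_basis :: "'a monoid \<Rightarrow> ('i \<Rightarrow> 'a) \<Rightarrow> 'i set \<Rightarrow> bool"
  where "free_basis K b I \<longleftrightarrow> comm_group K \<and> b \<in> I \<rightarrow> carrier K \<and>
    carrier K \<subseteq> free_lift K b ` {u. Poly_Mapping.keys u \<subseteq> I} \<and> inj_on (free_lift K b) {u. Poly_Mapping.keys u \<subseteq> I}"

lemma free_basis_generates:
  assumes B: "free_basis K b I" and S: "subgroup S K" and b: "b ` I \<subseteq> S"
  shows "S = carrier K"
proof
  interpret K: comm_group K using B by (simp add: free_basis_def)
  have bc: "b \<in> I \<rightarrow> carrier K" using B by (simp add: free_basis_def)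
  interpret l: group_hom "free_Abelian_group I" K "free_lift K b"
    by (rule group_hom_free_lift[OF K.comm_group_axioms bc])
  show "S \<subseteq> carrier K" using S by (rule subgroup.subset)
  show "carrier K \<subseteq> S"
  proof
    fix x assume "x \<in> carrier K"
    then obtain u where u: "Poly_Mapping.keys u \<subseteq> I" "x = free_lift K b u" using B by (auto simp: free_basis_def)
    from u(1) have "free_lift K b u \<in> S"
    proof (induction rule: free_group_induct)
      case zero
      then show ?case using l.hom_one S by (simp add: subgroup.one_closed)
    next
      case (diff x y)
      have cxy: "x \<in> carrier (free_Abelian_group I)" "y \<in> carrier (free_Abelian_group I)"
        using diff(1,2) by simp_all
      have "free_lift K b (x \<otimes>\<^bsub>free_Abelian_group I\<^esub> inv\<^bsub>free_Abelian_group I\<^esub> y)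
          = free_lift K b x \<otimes>\<^bsub>K\<^esub> inv\<^bsub>K\<^esub> free_lift K b y"
        using cxy by (simp only: l.hom_mult l.hom_inv l.G.inv_closed)
      then have "free_lift K b (x - y) = free_lift K b x \<otimes>\<^bsub>K\<^esub> inv\<^bsub>K\<^esub> free_lift K b y" using diff(2) by simp
      then show ?case using diff(3,4) S by (simp add: subgroup.m_closed subgroup.m_inv_closed)
    next
      case (frag i)
      then show ?case using b bc free_lift_frag_of[OF K.comm_group_axioms, of b i] by auto
    qed
    then show "x \<in> S" by (simp add: u)
  qed
qed

definition frag_tensor :: "('i \<Rightarrow>\<^sub>0 int) \<Rightarrow> ('j \<Rightarrow>\<^sub>0 int) \<Rightarrow> ('i \<times> 'j \<Rightarrow>\<^sub>0 int)"
  where "frag_tensor u v = frag_extend (\<lambda>i. frag_extend (\<lambda>j. frag_of (i, j)) v) u"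

lemma frag_tensor_left: "frag_tensor (u + u') v = frag_tensor u v + frag_tensor u' v"
  by (simp add: frag_tensor_def frag_extend_add)

lemma frag_tensor_right: "frag_tensor u (v + v') = frag_tensor u v + frag_tensor u v'"
  unfolding frag_tensor_def frag_extend_add
  by (simp only: frag_extend_def[of _ u] frag_cmul_distrib2 sum.distrib)

lemma frag_tensor_frag_of: "frag_tensor (frag_of i) (frag_of j) = frag_of (i, j)"
  by (simp add: frag_tensor_def)

lemma keys_frag_tensor: "Poly_Mapping.keys (frag_tensor u v) \<subseteq> Poly_Mapping.keys u \<times> Poly_Mapping.keys v"
proof -
  have "Poly_Mapping.keys (frag_extend (\<lambda>j. frag_of (i, j)) v) \<subseteq> {i} \<times> Poly_Mapping.keys v" for i
    using keys_frag_extend[of "\<lambda>j. frag_of (i, j)" v] by (auto simp: keys_frag_of)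
  then show ?thesis
    using keys_frag_extend[of "\<lambda>i. frag_extend (\<lambda>j. frag_of (i, j)) v" u] unfolding frag_tensor_def by fastforce
qed

lemma free_basis_coordinates:
  assumes B: "free_basis K e A"
  shows "\<exists>c. (\<forall>x\<in>carrier K. Poly_Mapping.keys (c x) \<subseteq> A \<and> free_lift K e (c x) = x)
      \<and> (\<forall>x\<in>carrier K. \<forall>y\<in>carrier K. c (x \<otimes>\<^bsub>K\<^esub> y) = c x + c y) \<and> (\<forall>i\<in>A. c (e i) = frag_of i)"
proof -
  interpret K: comm_group K using B by (simp add: free_basis_def)
  have ec: "e \<in> A \<rightarrow> carrier K" using B by (simp add: free_basis_def)
  interpret l: group_hom "free_Abelian_group A" K "free_lift K e"
    by (rule group_hom_free_lift[OF K.comm_group_axioms ec])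
  define c where "c = inv_into {u. Poly_Mapping.keys u \<subseteq> A} (free_lift K e)"
  have inj: "inj_on (free_lift K e) {u. Poly_Mapping.keys u \<subseteq> A}" using B by (simp add: free_basis_def)
  have im: "x \<in> free_lift K e ` {u. Poly_Mapping.keys u \<subseteq> A}" if "x \<in> carrier K" for x
    using B that by (auto simp: free_basis_def)
  have c: "Poly_Mapping.keys (c x) \<subseteq> A" "free_lift K e (c x) = x" if "x \<in> carrier K" for x
    using inv_into_into[OF im[OF that]] f_inv_into_f[OF im[OF that]] by (simp_all add: c_def)
  have cu: "c (free_lift K e u) = u" if "Poly_Mapping.keys u \<subseteq> A" for u
    using inv_into_f_f[OF inj] that by (simp add: c_def)
  have "c (x \<otimes>\<^bsub>K\<^esub> y) = c x + c y" if "x \<in> carrier K" "y \<in> carrier K" for x y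
  proof -
    have "free_lift K e (c x \<otimes>\<^bsub>free_Abelian_group A\<^esub> c y) = x \<otimes>\<^bsub>K\<^esub> y"
      using c[OF that(1)] c[OF that(2)] l.hom_mult[of "c x" "c y"] by simp
    moreover have "c x \<otimes>\<^bsub>free_Abelian_group A\<^esub> c y \<in> carrier (free_Abelian_group A)"
      using c that by (intro l.G.m_closed) simp_all
    ultimately show ?thesis using cu[of "c x + c y"] by simp
  qed
  moreover have "c (e i) = frag_of i" if "i \<in> A" for i
    using cu[of "frag_of i"] free_lift_frag_of[OF K.comm_group_axioms, of e i] funcset_mem[OF ec that] that
      by (simp add: keys_frag_of)
  ultimately show ?thesis by (intro exI[of _ c] conjI ballI c) simp_all
qed

lemma hom_vimage_subgroup:
  assumes "comm_group K" "group L" "h \<in> hom K L" and S: "subgroup S L"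
  shows "subgroup {x \<in> carrier K. h x \<in> S} K"
proof -
  interpret K: comm_group K by fact
  interpret h: group_hom K L h
    using assms by (simp add: group_hom_def group_hom_axioms_def K.is_group)
  show ?thesis
  proof (rule K.subgroupI)
    have "\<one>\<^bsub>K\<^esub> \<in> {x \<in> carrier K. h x \<in> S}" by (simp add: subgroup.one_closed[OF S])
    then show "{x \<in> carrier K. h x \<in> S} \<noteq> {}" by blast
  qed (auto simp: subgroup.m_closed[OF S] subgroup.m_inv_closed[OF S])
qed

text \<open>The coordinates in the two factors define a biadditive map to the free group on
  \<open>I \<times> J\<close>; its lift \<open>M\<close> is a left inverse of the map in question,
  which gives independence. Generation is shown one factor at a time: for a fixed second argument
  the first arguments whose pure tensor lies in the image form a subgroup, and likewise with the
  roles exchanged.\<close>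

lemma free_basis_tensor:
  assumes BG: "free_basis G b I" and BH: "free_basis H d J"
  shows "free_basis (G \<boxtimes> H) (\<lambda>(i, j). pure_tensor G H (b i) (d j)) (I \<times> J)"
proof -
  interpret tensor_pair G H
    using BG BH by (simp add: tensor_pair_def free_basis_def)
  let ?P = "\<lambda>(i, j). pure_tensor G H (b i) (d j)" and ?FF = "free_Abelian_group (I \<times> J)"
  have bc: "b \<in> I \<rightarrow> carrier G" and dc: "d \<in> J \<rightarrow> carrier H" using BG BH by (simp_all add: free_basis_def)
  have Pc: "?P \<in> I \<times> J \<rightarrow> carrier (G \<boxtimes> H)" using bc dc by (auto intro!: pure_tensor_closed)
  interpret L: group_hom ?FF "G \<boxtimes> H" "free_lift (G \<boxtimes> H) ?P"
    by (rule group_hom_free_lift[OF tensor_comm_group Pc])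
  obtain cG where cG: "\<And>x. x \<in> carrier G \<Longrightarrow> Poly_Mapping.keys (cG x) \<subseteq> I"
      "\<And>x y. x \<in> carrier G \<Longrightarrow> y \<in> carrier G \<Longrightarrow> cG (x \<otimes>\<^bsub>G\<^esub> y) = cG x + cG y" "\<And>i. i \<in> I \<Longrightarrow> cG (b i) = frag_of i"
    using free_basis_coordinates[OF BG] by metis
  obtain cH where cH: "\<And>x. x \<in> carrier H \<Longrightarrow> Poly_Mapping.keys (cH x) \<subseteq> J"
      "\<And>x y. x \<in> carrier H \<Longrightarrow> y \<in> carrier H \<Longrightarrow> cH (x \<otimes>\<^bsub>H\<^esub> y) = cH x + cH y" "\<And>i. i \<in> J \<Longrightarrow> cH (d i) = frag_of i"
    using free_basis_coordinates[OF BH] by metis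
  define M where "M = tensor_lift ?FF (\<lambda>x y. frag_tensor (cG x) (cH y))"
  have tc: "Poly_Mapping.keys (frag_tensor (cG x) (cH y)) \<subseteq> I \<times> J" if "x \<in> carrier G" "y \<in> carrier H" for x y
    using keys_frag_tensor[of "cG x" "cH y"] cG(1)[OF that(1)] cH(1)[OF that(2)] by blast
  have M: "M \<in> hom (G \<boxtimes> H) ?FF"
    unfolding M_def
    by (rule tensor_lift_hom[OF abelian_free_Abelian_group])
       (simp_all add: tc cG(2) cH(2) frag_tensor_left frag_tensor_right)
  have Mp: "M (pure_tensor G H x y) = frag_tensor (cG x) (cH y)" if "x \<in> carrier G" "y \<in> carrier H" for x y
    unfolding M_def
    by (rule tensor_lift_pure[OF abelian_free_Abelian_group _ _ _ that])
       (simp_all add: tc cG(2) cH(2) frag_tensor_left frag_tensor_right)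
  have Minv: "M (free_lift (G \<boxtimes> H) ?P u) = u" if u: "Poly_Mapping.keys u \<subseteq> I \<times> J" for u
  proof -
    have "(M \<circ> free_lift (G \<boxtimes> H) ?P) u = (\<lambda>x. x) u"
    proof (rule free_lift_unique[OF abelian_free_Abelian_group _ _ _ u])
      show "M \<circ> free_lift (G \<boxtimes> H) ?P \<in> hom ?FF ?FF" by (rule hom_compose[OF L.homh M])
      show "(\<lambda>x. x) \<in> hom ?FF ?FF" by (rule homI) simp_all
      fix p assume p: "p \<in> I \<times> J"
      then obtain i j where ij: "p = (i, j)" "i \<in> I" "j \<in> J" by auto
      have bij: "b i \<in> carrier G" "d j \<in> carrier H" using bc dc ij by auto
      moreover have "free_lift (G \<boxtimes> H) ?P (frag_of p) = pure_tensor G H (b i) (d j)"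
        using free_lift_frag_of[OF tensor_comm_group, of ?P p] pure_tensor_closed[OF bij] by (simp add: ij)
      ultimately show "(M \<circ> free_lift (G \<boxtimes> H) ?P) (frag_of p) = frag_of p"
        by (simp add: Mp cG(3) cH(3) ij frag_tensor_frag_of)
    qed
    then show ?thesis by simp
  qed
  have inj: "inj_on (free_lift (G \<boxtimes> H) ?P) {u. Poly_Mapping.keys u \<subseteq> I \<times> J}"
    by (rule inj_on_inverseI[of _ M]) (simp add: Minv)
  let ?S = "free_lift (G \<boxtimes> H) ?P ` carrier ?FF"
  have S: "subgroup ?S (G \<boxtimes> H)" by (rule L.img_is_subgroup)
  have bd: "pure_tensor G H (b i) (d j) \<in> ?S" if "i \<in> I" "j \<in> J" for i j
  proof
    show "pure_tensor G H (b i) (d j) = free_lift (G \<boxtimes> H) ?P (frag_of (i, j))"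
      using free_lift_frag_of[OF tensor_comm_group, of ?P "(i, j)"] funcset_mem[OF Pc, of "(i, j)"] that by simp
  qed (use that in simp)
  have bH: "pure_tensor G H (b i) y \<in> ?S" if i: "i \<in> I" and y: "y \<in> carrier H" for i y
  proof -
    have bi: "b i \<in> carrier G" using bc i by auto
    have "{y \<in> carrier H. pure_tensor G H (b i) y \<in> ?S} = carrier H"
      by (rule free_basis_generates[OF BH hom_vimage_subgroup[OF H T.is_group pure_tensor_hom_right[OF bi] S]])
         (use dc bd i in auto)
    then show ?thesis using y by blast
  qed
  have GH: "pure_tensor G H x y \<in> ?S" if x: "x \<in> carrier G" and y: "y \<in> carrier H" for x y
  proof -
    have "{x \<in> carrier G. pure_tensor G H x y \<in> ?S} = carrier G"
      by (rule free_basis_generates[OF BG hom_vimage_subgroup[OF G T.is_group pure_tensor_hom_left[OF y] S]])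
         (use bc bH y in auto)
    then show ?thesis using x by blast
  qed
  have "carrier ?FF = {u. Poly_Mapping.keys u \<subseteq> I \<times> J}" by auto
  moreover have "?S = carrier (G \<boxtimes> H)" by (rule tensor_subgroup_UNIV[OF S GH])
  ultimately have "carrier (G \<boxtimes> H) = free_lift (G \<boxtimes> H) ?P ` {u. Poly_Mapping.keys u \<subseteq> I \<times> J}" by simp
  then show ?thesis using inj Pc tensor_comm_group by (simp add: free_basis_def)
qed

text \<open>The source of the isomorphisms between free groups in the theorem: it only remains to
  compare values on a basis.\<close>

lemma free_basis_iso:
  assumes B: "free_basis K b I" and B': "free_basis K' b' I"
    and f: "f \<in> hom K K'" and fb: "\<And>i. i \<in> I \<Longrightarrow> f (b i) = b' i"
  shows "f \<in> iso K K'"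
proof -
  have K: "comm_group K" and K': "comm_group K'" and bc: "b \<in> I \<rightarrow> carrier K" and bc': "b' \<in> I \<rightarrow> carrier K'"
    using B B' by (simp_all add: free_basis_def)
  let ?U = "{u. Poly_Mapping.keys u \<subseteq> I}"
  have hom: "free_lift K b \<in> hom (free_Abelian_group I) K" "free_lift K' b' \<in> hom (free_Abelian_group I) K'"
    using free_lift_hom K K' bc bc' by blast+
  have fl: "f (free_lift K b u) = free_lift K' b' u" if "u \<in> ?U" for u
  proof -
    have "(f \<circ> free_lift K b) u = free_lift K' b' u"
    proof (rule free_lift_unique[OF K' hom_compose[OF hom(1) f] hom(2)])
      fix i assume i: "i \<in> I"
      then have "free_lift K b (frag_of i) = b i" "free_lift K' b' (frag_of i) = b' i"
        using bc bc' free_lift_frag_of[OF K, of b i] free_lift_frag_of[OF K', of b' i] by auto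
      then show "(f \<circ> free_lift K b) (frag_of i) = free_lift K' b' (frag_of i)" using fb[OF i] by simp
    qed (use that in simp)
    then show ?thesis by simp
  qed
  have car: "carrier K = free_lift K b ` ?U" "carrier K' = free_lift K' b' ` ?U"
    using B B' hom_carrier[OF hom(1)] hom_carrier[OF hom(2)] by (auto simp: free_basis_def subset_iff image_subset_iff)
  have inj: "inj_on (free_lift K' b') ?U" using B' by (simp add: free_basis_def)
  have "f ` carrier K = carrier K'" unfolding car image_image by (rule image_cong) (simp_all add: fl)
  moreover have "inj_on f (carrier K)"
    unfolding car
  proof (rule inj_onI, clarify)
    fix u v assume uv: "Poly_Mapping.keys u \<subseteq> I" "Poly_Mapping.keys v \<subseteq> I"
      and "f (free_lift K b u) = f (free_lift K b v)"
    then have "u = v" using inj fl by (auto simp: inj_on_def)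
    then show "free_lift K b u = free_lift K b v" by simp
  qed
  ultimately show ?thesis using f by (simp add: iso_def bij_betw_def)
qed

section \<open>Additive groups of subrings and multiplication maps\<close>

lemma comm_group_add_grp:
  assumes "0 \<in> S" "\<And>a b. a \<in> S \<Longrightarrow> b \<in> S \<Longrightarrow> a + b \<in> S" "\<And>a. a \<in> S \<Longrightarrow> - a \<in> S"
  shows "comm_group (add_grp S)"
proof (rule comm_groupI)
  fix x assume "x \<in> carrier (add_grp S)"
  then show "\<exists>y\<in>carrier (add_grp S). y \<otimes>\<^bsub>add_grp S\<^esub> x = \<one>\<^bsub>add_grp S\<^esub>"
    using assms(3) by (intro bexI[of _ "- x"]) (simp_all add: add_grp_def)
qed (use assms in \<open>auto simp: add_grp_def add_ac\<close>)

lemma add_grp_simps [simp]: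
  "carrier (add_grp S) = S" "x \<otimes>\<^bsub>add_grp S\<^esub> y = x + y" "\<one>\<^bsub>add_grp S\<^esub> = 0"
  by (simp_all add: add_grp_def)

lemma comm_group_add_grp_subalgebra: "Z_subalgebra S \<Longrightarrow> comm_group (add_grp S)"
  by (rule comm_group_add_grp) (auto intro: Z_subalgebra_intros)

lemma comm_group_add_grp_UNIV: "comm_group (add_grp UNIV)"
  by (rule comm_group_add_grp) auto

lemma free_lift_add_grp:
  fixes b :: "'i \<Rightarrow> 'a::ring_1"
  assumes S: "Z_subalgebra S" and b: "b ` I \<subseteq> S" and u: "Poly_Mapping.keys u \<subseteq> I"
  shows "free_lift (add_grp S) b u = (\<Sum>i\<in>Poly_Mapping.keys u. of_int (Poly_Mapping.lookup u i) * b i)"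
proof -
  have K: "comm_group (add_grp S)" by (rule comm_group_add_grp_subalgebra[OF S])
  let ?s = "\<lambda>u. \<Sum>i\<in>Poly_Mapping.keys u. of_int (Poly_Mapping.lookup u i) * b i"
  have sup: "?s u = (\<Sum>i\<in>A. of_int (Poly_Mapping.lookup u i) * b i)" if "finite A" "Poly_Mapping.keys u \<subseteq> A" for u A
    by (rule sum.mono_neutral_left) (use that in \<open>auto simp: in_keys_iff\<close>)
  show ?thesis
  proof (rule free_lift_unique[OF K _ _ _ u])
    show "free_lift (add_grp S) b \<in> hom (free_Abelian_group I) (add_grp S)"
      by (rule free_lift_hom[OF K]) (use b in auto)
    show "?s \<in> hom (free_Abelian_group I) (add_grp S)"
    proof (rule homI)
      fix x assume "x \<in> carrier (free_Abelian_group I)"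
      then show "?s x \<in> carrier (add_grp S)"
        using b by (auto intro!: Z_subalgebra_intros[OF S])
    next
      fix x y :: "'i \<Rightarrow>\<^sub>0 int"
      let ?A = "Poly_Mapping.keys x \<union> Poly_Mapping.keys y"
      have "?s (x + y) = ?s x + ?s y"
        unfolding sup[of ?A "x + y", OF _ Poly_Mapping.keys_add, simplified]
          sup[of ?A x, simplified] sup[of ?A y, simplified]
        by (simp add: lookup_add distrib_right sum.distrib)
      then show "?s (x \<otimes>\<^bsub>free_Abelian_group I\<^esub> y) = ?s x \<otimes>\<^bsub>add_grp S\<^esub> ?s y" by simp
    qed
    fix i assume "i \<in> I"
    then show "free_lift (add_grp S) b (frag_of i) = ?s (frag_of i)"
      using free_lift_frag_of[OF K, of b i] b by (auto simp: keys_frag_of)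
  qed
qed

lemma free_basis_add_grp:
  fixes b :: "'i \<Rightarrow> 'a::ring_1"
  assumes S: "Z_subalgebra S" and span: "S = zspan (b ` I)"
    and indep: "\<And>A n. finite A \<Longrightarrow> A \<subseteq> I \<Longrightarrow> (\<Sum>i\<in>A. of_int (n i) * b i) = 0 \<Longrightarrow> \<forall>i\<in>A. n i = 0"
  shows "free_basis (add_grp S) b I"
proof -
  have bS: "b ` I \<subseteq> S" unfolding span by (auto intro: zspan.base)
  have K: "comm_group (add_grp S)" by (rule comm_group_add_grp_subalgebra[OF S])
  have hom: "free_lift (add_grp S) b (x - y) = free_lift (add_grp S) b x - free_lift (add_grp S) b y"
    if xy: "Poly_Mapping.keys x \<subseteq> I" "Poly_Mapping.keys y \<subseteq> I" for x y
  proof -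
    have xy': "Poly_Mapping.keys (x - y) \<subseteq> I" using xy keys_diff[of x y] by blast
    let ?A = "Poly_Mapping.keys x \<union> Poly_Mapping.keys y"
    have sup: "free_lift (add_grp S) b u = (\<Sum>i\<in>?A. of_int (Poly_Mapping.lookup u i) * b i)"
      if "Poly_Mapping.keys u \<subseteq> ?A" "Poly_Mapping.keys u \<subseteq> I" for u
      unfolding free_lift_add_grp[OF S bS that(2)]
      by (rule sum.mono_neutral_left) (use that in \<open>auto simp: in_keys_iff\<close>)
    show ?thesis
      using sup[OF keys_diff xy'] sup[OF _ xy(1)] sup[OF _ xy(2)]
      by (simp add: lookup_minus left_diff_distrib sum_subtractf)
  qed
  have "S \<subseteq> free_lift (add_grp S) b ` {u. Poly_Mapping.keys u \<subseteq> I}"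
  proof
    fix s assume "s \<in> S"
    then have "s \<in> zspan (b ` I)" using span by simp
    then show "s \<in> free_lift (add_grp S) b ` {u. Poly_Mapping.keys u \<subseteq> I}"
    proof induction
      case zero
      have "free_lift (add_grp S) b 0 = 0" by (simp add: free_lift_add_grp[OF S bS])
      then show ?case by (intro image_eqI[of _ _ 0]) simp_all
    next
      case (base a)
      then obtain i where i: "i \<in> I" "a = b i" by auto
      then have "free_lift (add_grp S) b (frag_of i) = a"
        using free_lift_frag_of[OF K, of b i] bS by auto
      then show ?case using i by (intro image_eqI[of _ _ "frag_of i"]) (simp_all add: keys_frag_of)
    next
      case (diff x y)
      then obtain u v where uv: "Poly_Mapping.keys u \<subseteq> I" "Poly_Mapping.keys v \<subseteq> I"
        "x = free_lift (add_grp S) b u" "y = free_lift (add_grp S) b v" by auto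
      then show ?case using hom[OF uv(1,2)] keys_diff[of u v] by (intro image_eqI[of _ _ "u - v"]) auto
    qed
  qed
  moreover have "inj_on (free_lift (add_grp S) b) {u. Poly_Mapping.keys u \<subseteq> I}"
  proof (rule inj_onI, clarify)
    fix u v assume uv: "Poly_Mapping.keys u \<subseteq> I" "Poly_Mapping.keys v \<subseteq> I"
      and "free_lift (add_grp S) b u = free_lift (add_grp S) b v"
    then have 0: "free_lift (add_grp S) b (u - v) = 0" by (simp add: hom)
    have k: "Poly_Mapping.keys (u - v) \<subseteq> I" using uv keys_diff[of u v] by blast
    have "\<forall>i\<in>Poly_Mapping.keys (u - v). Poly_Mapping.lookup (u - v) i = 0"
      by (rule indep[OF _ k]) (use 0 free_lift_add_grp[OF S bS k] in simp_all)
    then have "Poly_Mapping.lookup (u - v) i = 0" for i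
      by (cases "i \<in> Poly_Mapping.keys (u - v)") (simp_all add: in_keys_iff)
    then show "u = v" by (intro poly_mapping_eqI) (simp add: lookup_minus)
  qed
  ultimately show ?thesis using K bS by (auto simp: free_basis_def)
qed

lemma tensor_mult_hom:
  assumes G: "comm_group G" and H: "comm_group H"
    and f: "f \<in> hom G (add_grp UNIV)" and g: "g \<in> hom H (add_grp UNIV)"
  shows "tensor_mult f g \<in> hom (G \<boxtimes> H) (add_grp UNIV)"
    and "a \<in> carrier G \<Longrightarrow> b \<in> carrier H \<Longrightarrow> tensor_mult f g (pure_tensor G H a b) = f a * g b"
proof -
  interpret tensor_pair G H using G H by (simp add: tensor_pair_def)
  show "tensor_mult f g \<in> hom (G \<boxtimes> H) (add_grp UNIV)"
    unfolding tensor_mult_def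
    by (rule tensor_lift_hom[OF comm_group_add_grp_UNIV])
       (use f g in \<open>simp_all add: hom_def distrib_left distrib_right\<close>)
  show "tensor_mult f g (pure_tensor G H a b) = f a * g b" if "a \<in> carrier G" "b \<in> carrier H"
    unfolding tensor_mult_def
    by (rule tensor_lift_pure[OF comm_group_add_grp_UNIV _ _ _ that])
       (use f g in \<open>simp_all add: hom_def distrib_left distrib_right\<close>)
qed

lemma tensor_map_hom:
  assumes G: "comm_group G" and H: "comm_group H" and G': "comm_group G'" and H': "comm_group H'"
    and f: "f \<in> hom G G'" and g: "g \<in> hom H H'"
  shows "tensor_map G' H' f g \<in> hom (G \<boxtimes> H) (G' \<boxtimes> H')"
    and "a \<in> carrier G \<Longrightarrow> b \<in> carrier H \<Longrightarrow>
      tensor_map G' H' f g (pure_tensor G H a b) = pure_tensor G' H' (f a) (g b)"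
proof -
  interpret tensor_pair G H using G H by (simp add: tensor_pair_def)
  interpret T': tensor_pair G' H' using G' H' by (simp add: tensor_pair_def)
  have fc: "f a \<in> carrier G'" if "a \<in> carrier G" for a using f that by (auto simp: hom_def)
  have gc: "g a \<in> carrier H'" if "a \<in> carrier H" for a using g that by (auto simp: hom_def)
  have fm: "f (a \<otimes>\<^bsub>G\<^esub> b) = f a \<otimes>\<^bsub>G'\<^esub> f b" if "a \<in> carrier G" "b \<in> carrier G" for a b
    using f that by (auto simp: hom_def)
  have gm: "g (a \<otimes>\<^bsub>H\<^esub> b) = g a \<otimes>\<^bsub>H'\<^esub> g b" if "a \<in> carrier H" "b \<in> carrier H" for a b
    using g that by (auto simp: hom_def)
  show "tensor_map G' H' f g \<in> hom (G \<boxtimes> H) (G' \<boxtimes> H')"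
    unfolding tensor_map_def
    by (rule tensor_lift_hom[OF T'.tensor_comm_group])
       (simp_all add: fc gc fm gm T'.pure_tensor_closed T'.pure_tensor_left T'.pure_tensor_right)
  show "tensor_map G' H' f g (pure_tensor G H a b) = pure_tensor G' H' (f a) (g b)"
    if "a \<in> carrier G" "b \<in> carrier H"
    unfolding tensor_map_def
    by (rule tensor_lift_pure[OF T'.tensor_comm_group _ _ _ that])
       (simp_all add: fc gc fm gm T'.pure_tensor_closed T'.pure_tensor_left T'.pure_tensor_right)
qed

text \<open>Multiplication maps are constructed with values in the whole ring; the values on a basis
  show that they land in \<open>S\<close>.\<close>

lemma hom_add_grp_subset:
  assumes f: "f \<in> hom K (add_grp UNIV)" and B: "free_basis K b I" and S: "Z_subalgebra S"
    and fb: "\<And>i. i \<in> I \<Longrightarrow> f (b i) \<in> S"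
  shows "f \<in> hom K (add_grp S)"
proof -
  interpret K: comm_group K using B by (simp add: free_basis_def)
  interpret f: group_hom K "add_grp UNIV" f
    using f by (simp add: group_hom_def group_hom_axioms_def K.is_group comm_group.axioms(2)[OF comm_group_add_grp_UNIV])
  have f1: "f \<one>\<^bsub>K\<^esub> = 0" using f.hom_one by simp
  have fm: "f (x \<otimes>\<^bsub>K\<^esub> y) = f x + f y" if "x \<in> carrier K" "y \<in> carrier K" for x y
    using f.hom_mult[OF that] by simp
  have fi: "f (inv\<^bsub>K\<^esub> x) = - f x" if "x \<in> carrier K" for x
    using fm[of "inv\<^bsub>K\<^esub> x" x] that f1 by (simp add: eq_neg_iff_add_eq_0)
  have sub: "subgroup {x \<in> carrier K. f x \<in> S} K"
  proof (rule K.subgroupI)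
    have "\<one>\<^bsub>K\<^esub> \<in> {x \<in> carrier K. f x \<in> S}" by (simp add: f1 Z_subalgebra_zero[OF S] del: f.hom_one)
    then show "{x \<in> carrier K. f x \<in> S} \<noteq> {}" by blast
  qed (auto simp: fm fi Z_subalgebra_add[OF S] Z_subalgebra_minus[OF S] simp del: f.hom_inv f.hom_mult)
  have bc: "b \<in> I \<rightarrow> carrier K" using B by (simp add: free_basis_def)
  have "{x \<in> carrier K. f x \<in> S} = carrier K"
    by (rule free_basis_generates[OF B sub]) (use bc fb in auto)
  then have "\<And>x. x \<in> carrier K \<Longrightarrow> f x \<in> S" by blast
  then show ?thesis by (intro homI) (simp_all add: fm)
qed

section \<open>Extension of scalars\<close>

text \<open>The rationals are not free over the integers, so bases are of no use here. Instead,
  common denominators show that every element of the tensor product is a single pure tensor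
  \<open>q \<otimes> s\<close>. If its image is zero, then \<open>q = 0\<close> or
  \<open>s = 0\<close>, because nonzero rationals act invertibly.\<close>

lemma rat_tensor_iso:
  fixes S :: "'a::rat_algebra_1 set"
  assumes S: "Z_subalgebra S" and gen: "\<And>u. \<exists>q s. s \<in> S \<and> u = q *\<^sub>Q s"
  shows "tensor_lift (add_grp UNIV) (*\<^sub>Q) \<in> iso (add_grp (UNIV :: rat set) \<boxtimes> add_grp S) (add_grp UNIV)"
proof -
  let ?Q = "add_grp (UNIV :: rat set)" and ?S = "add_grp S"
  interpret tensor_pair ?Q ?S
    by (simp add: tensor_pair_def comm_group_add_grp_UNIV comm_group_add_grp_subalgebra[OF S])
  let ?f = "tensor_lift (add_grp (UNIV :: 'a set)) (*\<^sub>Q)" and ?p = "pure_tensor ?Q ?S"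
  have f: "?f \<in> hom (?Q \<boxtimes> ?S) (add_grp UNIV)"
    by (rule tensor_lift_hom[OF comm_group_add_grp_UNIV]) (simp_all add: scaleQ_add_left scaleQ_add_right)
  have fp: "?f (?p q s) = q *\<^sub>Q s" if "s \<in> S" for q s
    by (rule tensor_lift_pure[OF comm_group_add_grp_UNIV]) (use that in \<open>simp_all add: scaleQ_add_left scaleQ_add_right\<close>)
  interpret f: group_hom "?Q \<boxtimes> ?S" "add_grp UNIV" ?f
    using f by (simp add: group_hom_def group_hom_axioms_def T.is_group comm_group.axioms(2)[OF comm_group_add_grp_UNIV])
  have pr: "?p q (s + t) = ?p q s \<otimes>\<^bsub>?Q \<boxtimes> ?S\<^esub> ?p q t" if "s \<in> S" "t \<in> S" for q s t
    using pure_tensor_right[of q s t] that by simp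
  have pl: "?p (q + r) s = ?p q s \<otimes>\<^bsub>?Q \<boxtimes> ?S\<^esub> ?p r s" if "s \<in> S" for q r s
    using pure_tensor_left[of q r s] that by simp
  have pc: "?p q s \<in> carrier (?Q \<boxtimes> ?S)" if "s \<in> S" for q s
    using pure_tensor_closed[of q s] that by simp
  have p0: "?p q 0 = \<one>\<^bsub>?Q \<boxtimes> ?S\<^esub>" for q
    using pr[of 0 0 q] pc[of 0 q] Z_subalgebra_zero[OF S] T.r_cancel_one' by simp
  have p0': "?p 0 s = \<one>\<^bsub>?Q \<boxtimes> ?S\<^esub>" if "s \<in> S" for s
    using pl[of s 0 0] pc[of s 0] that T.r_cancel_one' by simp
  have nat: "?p (of_nat n * q) s = ?p q (of_nat n * s)" if "s \<in> S" for n q s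
  proof (induction n)
    case 0
    then show ?case using that by (simp add: p0 p0')
  next
    case (Suc n)
    have "of_nat n * s \<in> S" by (intro Z_subalgebra_mult[OF S] Z_subalgebra_of_nat[OF S] that)
    then show ?case using that Suc by (simp add: distrib_right pl pr)
  qed
  have neg: "?p (- q) s = ?p q (- s)" if "s \<in> S" for q s
  proof -
    have ms: "- s \<in> S" using that by (rule Z_subalgebra_minus[OF S])
    have "?p (- q) s \<otimes>\<^bsub>?Q \<boxtimes> ?S\<^esub> ?p q s = ?p q (- s) \<otimes>\<^bsub>?Q \<boxtimes> ?S\<^esub> ?p q s"
      using pl[OF that, of "- q" q] pr[OF ms that, of q] by (simp add: p0 p0' that)
    then show ?thesis using pc that ms by simp
  qed
  have int: "?p (of_int n * q) s = ?p q (of_int n * s)" if "s \<in> S" for n q s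
  proof (cases n rule: int_cases2)
    case (nonpos k)
    then show ?thesis
      using neg[OF that, of "of_nat k * q"] nat[OF Z_subalgebra_minus[OF S that], of k q] by simp
  qed (use nat that in simp)
  have "{X \<in> carrier (?Q \<boxtimes> ?S). \<exists>q s. s \<in> S \<and> X = ?p q s} = carrier (?Q \<boxtimes> ?S)"
  proof (rule tensor_subgroup_UNIV[OF T.subgroupI])
    show "{X \<in> carrier (?Q \<boxtimes> ?S). \<exists>q s. s \<in> S \<and> X = ?p q s} \<noteq> {}"
      using pc[OF Z_subalgebra_zero[OF S]] Z_subalgebra_zero[OF S] by blast
  next
    fix X assume "X \<in> {X \<in> carrier (?Q \<boxtimes> ?S). \<exists>q s. s \<in> S \<and> X = ?p q s}"
    then obtain q s where X: "X = ?p q s" "s \<in> S" by auto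
    have "?p q (- s) \<otimes>\<^bsub>?Q \<boxtimes> ?S\<^esub> X = \<one>\<^bsub>?Q \<boxtimes> ?S\<^esub>"
      using pr[of "- s" s q] X Z_subalgebra_minus[OF S] by (simp add: p0)
    then have "inv\<^bsub>?Q \<boxtimes> ?S\<^esub> X = ?p q (- s)"
      using X pc Z_subalgebra_minus[OF S] by (intro T.inv_equality) auto
    then show "inv\<^bsub>?Q \<boxtimes> ?S\<^esub> X \<in> {X \<in> carrier (?Q \<boxtimes> ?S). \<exists>q s. s \<in> S \<and> X = ?p q s}"
      using pc Z_subalgebra_minus[OF S X(2)] by auto
  next
    fix X Y assume "X \<in> {X \<in> carrier (?Q \<boxtimes> ?S). \<exists>q s. s \<in> S \<and> X = ?p q s}" "Y \<in> {X \<in> carrier (?Q \<boxtimes> ?S). \<exists>q s. s \<in> S \<and> X = ?p q s}"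
    then obtain q s r t where X: "X = ?p q s" "s \<in> S" and Y: "Y = ?p r t" "t \<in> S" by auto
    obtain a b where ab: "quotient_of q = (a, b)" by fastforce
    obtain a' b' where ab': "quotient_of r = (a', b')" by fastforce
    have b: "b > 0" "b' > 0" using ab ab' quotient_of_denom_pos by blast+
    define d where "d = (1 / of_int (b * b') :: rat)"
    have q: "q = of_int (a * b') * d" "r = of_int (a' * b) * d"
      using quotient_of_div[OF ab] quotient_of_div[OF ab'] b by (simp_all add: d_def)
    have m: "of_int (a * b') * s \<in> S" "of_int (a' * b) * t \<in> S"
      by (intro Z_subalgebra_mult[OF S] Z_subalgebra_of_int[OF S] X Y)+
    have "X = ?p d (of_int (a * b') * s)" "Y = ?p d (of_int (a' * b) * t)"
      unfolding X(1) Y(1) q by (rule int[OF X(2)], rule int[OF Y(2)])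
    then have "X \<otimes>\<^bsub>?Q \<boxtimes> ?S\<^esub> Y = ?p d (of_int (a * b') * s + of_int (a' * b) * t)"
      using pr[OF m] by simp
    then show "X \<otimes>\<^bsub>?Q \<boxtimes> ?S\<^esub> Y \<in> {X \<in> carrier (?Q \<boxtimes> ?S). \<exists>q s. s \<in> S \<and> X = ?p q s}"
      using pc Z_subalgebra_add[OF S m] by auto
  qed (use pc in auto)
  then have pure: "\<exists>q s. s \<in> S \<and> X = ?p q s" if "X \<in> carrier (?Q \<boxtimes> ?S)" for X
    using that by blast
  have "\<forall>X\<in>carrier (?Q \<boxtimes> ?S). ?f X = \<one>\<^bsub>add_grp UNIV\<^esub> \<longrightarrow> X = \<one>\<^bsub>?Q \<boxtimes> ?S\<^esub>"
  proof (intro ballI impI)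
    fix X assume "X \<in> carrier (?Q \<boxtimes> ?S)" "?f X = \<one>\<^bsub>add_grp UNIV\<^esub>"
    then obtain q s where X: "s \<in> S" "X = ?p q s" "q *\<^sub>Q s = 0" using pure fp by fastforce
    have "q = 0 \<or> s = 0" using X(3) scaleQ_cancel_left[of q s 0] by auto
    then show "X = \<one>\<^bsub>?Q \<boxtimes> ?S\<^esub>" using X p0 p0' by auto
  qed
  moreover have "UNIV \<subseteq> ?f ` carrier (?Q \<boxtimes> ?S)"
  proof
    fix u :: 'a
    obtain q s where "s \<in> S" "u = q *\<^sub>Q s" using gen by blast
    then show "u \<in> ?f ` carrier (?Q \<boxtimes> ?S)" using fp pc by (intro image_eqI[of _ _ "?p q s"]) auto
  qed
  ultimately show ?thesis unfolding f.iso_iff by simp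
qed

section \<open>Rational independence and integral bases\<close>

text \<open>Independence over the rationals, since the evaluation of divided powers brings in
  inverse factorials; integral relations are a special case.\<close>

definition independentQ :: "('i \<Rightarrow> 'a::rat_algebra_1) \<Rightarrow> 'i set \<Rightarrow> bool"
  where "independentQ b I \<longleftrightarrow>
    (\<forall>A q. finite A \<longrightarrow> A \<subseteq> I \<longrightarrow> (\<Sum>i\<in>A. q i *\<^sub>Q b i) = 0 \<longrightarrow> (\<forall>i\<in>A. q i = 0))"

lemma independentQD:
  "independentQ b I \<Longrightarrow> finite A \<Longrightarrow> A \<subseteq> I \<Longrightarrow> (\<Sum>i\<in>A. q i *\<^sub>Q b i) = 0 \<Longrightarrow> i \<in> A \<Longrightarrow> q i = 0"
  by (simp add: independentQ_def)

text \<open>Serves both for another bracketing of the index set and for the bases of the single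
  factors, which are the subfamilies with all other exponents equal to 0.\<close>

lemma independentQ_reindex:
  assumes b: "independentQ b I" and inj: "inj_on \<rho> J" and sub: "\<rho> ` J \<subseteq> I"
  shows "independentQ (\<lambda>j. b (\<rho> j)) J"
  unfolding independentQ_def
proof (intro allI impI)
  fix A q assume A: "finite A" "A \<subseteq> J" and 0: "(\<Sum>j\<in>A. q j *\<^sub>Q b (\<rho> j)) = 0"
  have inj': "inj_on \<rho> A" using inj A(2) by (rule inj_on_subset)
  define q' where "q' i = q (inv_into A \<rho> i)" for i
  have q': "q' (\<rho> j) = q j" if "j \<in> A" for j
    using that inv_into_f_f[OF inj'] by (simp add: q'_def)
  have "(\<Sum>i\<in>\<rho> ` A. q' i *\<^sub>Q b i) = (\<Sum>j\<in>A. q j *\<^sub>Q b (\<rho> j))"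
    by (simp add: sum.reindex[OF inj'] q')
  with 0 have "(\<Sum>i\<in>\<rho> ` A. q' i *\<^sub>Q b i) = 0" by simp
  moreover have "finite (\<rho> ` A)" "\<rho> ` A \<subseteq> I" using A sub by auto
  ultimately have "\<forall>i\<in>\<rho> ` A. q' i = 0" by (intro ballI) (rule independentQD[OF b])
  then show "\<forall>j\<in>A. q j = 0" using q' by simp
qed

lemma independentQ_integers:
  assumes b: "independentQ b I" and A: "finite A" "A \<subseteq> I" and 0: "(\<Sum>i\<in>A. of_int (n i) * b i) = 0"
  shows "\<forall>i\<in>A. n i = 0"
proof -
  have "(\<Sum>i\<in>A. (of_int (n i) :: rat) *\<^sub>Q b i) = 0" using 0 by (simp add: of_int_scaleQ)
  then have "\<forall>i\<in>A. (of_int (n i) :: rat) = 0" by (intro ballI) (rule independentQD[OF b A])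
  then show ?thesis by simp
qed

lemma independentQ_inj_on:
  assumes b: "independentQ b I"
  shows "inj_on b I"
proof (rule inj_onI, rule ccontr)
  fix i j assume ij: "i \<in> I" "j \<in> I" "b i = b j" "i \<noteq> j"
  have "(\<Sum>k\<in>{i, j}. of_int (if k = i then 1 else - 1) * b k) = 0" using ij by simp
  then have "\<forall>k\<in>{i, j}. (if k = i then 1 else - 1 :: int) = 0"
    by (rule independentQ_integers[OF b, rotated 2]) (use ij in auto)
  then show False by simp
qed

lemma is_Z_basisI:
  assumes b: "independentQ b I" and M: "M = zspan (b ` I)"
  shows "is_Z_basis b I M"
proof -
  interpret module scaleZ by (rule module_scaleZ)
  have inj: "inj_on b I" by (rule independentQ_inj_on[OF b])
  have "\<not> dependent (b ` I)"
  proof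
    assume "dependent (b ` I)"
    then obtain t u v where t: "finite t" "t \<subseteq> b ` I" "(\<Sum>v\<in>t. of_int (u v) * v) = 0" "v \<in> t" "u v \<noteq> 0"
      unfolding dependent_explicit by blast
    then obtain A where A: "A \<subseteq> I" "finite A" "t = b ` A"
      using finite_subset_image[of t b I] by blast
    have "(\<Sum>i\<in>A. of_int (u (b i)) * b i) = 0"
      using t(3) unfolding A(3) by (simp add: sum.reindex[OF inj_on_subset[OF inj A(1)]])
    then have "\<forall>i\<in>A. u (b i) = 0" by (rule independentQ_integers[OF b A(2,1)])
    then show False using t(4,5) A(3) by auto
  qed
  then show ?thesis using inj M by (simp add: is_Z_basis_def span_scaleZ)
qed

lemma free_basisI:
  "Z_subalgebra S \<Longrightarrow> independentQ b I \<Longrightarrow> S = zspan (b ` I) \<Longrightarrow> free_basis (add_grp S) b I"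
  by (rule free_basis_add_grp) (use independentQ_integers in blast)+

lemma zspan_prod_span: "zspan (f ` I) \<odot> zspan (g ` J) = zspan ((\<lambda>(i, j). f i * g j) ` (I \<times> J))"
proof -
  have "{a * b | a b. a \<in> f ` I \<and> b \<in> g ` J} = (\<lambda>(i, j). f i * g j) ` (I \<times> J)" by auto
  then show ?thesis by (simp add: prod_span_zspan prod_span_zspan_left) (simp add: prod_span_def)
qed

section \<open>The basis of the integral form\<close>

type_synonym cartan_index = "(nat \<Rightarrow>\<^sub>0 nat) \<times> (nat \<times> nat) \<times> (nat \<Rightarrow>\<^sub>0 nat)"

definition cartan_indices :: "cartan_index set"
  where "cartan_indices = pos_exponents \<times> UNIV \<times> pos_exponents"

definition cartan_elem :: "cartan_index \<Rightarrow> uhat"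
  where "cartan_elem = (\<lambda>(l, p, l'). hhat_monomial Neg l * (binom_monomial p * hhat_monomial Pos l'))"

text \<open>The basis again, indexed along the bracketing of the tensor products in the theorem.\<close>

definition nested_indices :: "((int \<Rightarrow>\<^sub>0 nat) \<times> cartan_index \<times> (int \<Rightarrow>\<^sub>0 nat)) set"
  where "nested_indices = UNIV \<times> cartan_indices \<times> UNIV"

definition nested_elem :: "(int \<Rightarrow>\<^sub>0 nat) \<times> cartan_index \<times> (int \<Rightarrow>\<^sub>0 nat) \<Rightarrow> uhat"
  where "nested_elem = (\<lambda>(k, t, k'). x_monomial Neg k * (cartan_elem t * x_monomial Pos k'))"

definition flatten :: "(int \<Rightarrow>\<^sub>0 nat) \<times> cartan_index \<times> (int \<Rightarrow>\<^sub>0 nat) \<Rightarrow> basis_index"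
  where "flatten = (\<lambda>(k, (l, p, l'), k'). (k, l, p, l', k'))"

lemma basis_elem_flatten: "basis_elem (flatten i) = nested_elem i"
  by (simp add: basis_elem_def flatten_def nested_elem_def cartan_elem_def split: prod.split)
     (simp add: mult.assoc)

lemma flatten_image: "flatten ` nested_indices = basis_indices"
  by (auto simp: flatten_def nested_indices_def cartan_indices_def basis_indices_def image_iff split: prod.split)

lemma zero_pos_exponents: "0 \<in> pos_exponents"
  by (simp add: pos_exponents_def)

lemma monomial_0: "x_monomial e 0 = 1" "hhat_monomial e 0 = 1" "binom_monomial (0, 0) = 1"
  by (simp_all add: x_monomial_def hhat_monomial_def binom_monomial_def)

lemma independentQ_basis_elem: "independentQ basis_elem basis_indices"
  unfolding independentQ_def using basis_elem_independent by blast

lemma independentQ_nested: "independentQ nested_elem nested_indices"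
proof -
  have "inj_on flatten nested_indices" by (auto simp: inj_on_def flatten_def)
  then show ?thesis
    using independentQ_reindex[OF independentQ_basis_elem, of flatten] flatten_image
    by (simp add: basis_elem_flatten)
qed

lemma independentQ_x_monomial: "independentQ (x_monomial e) UNIV"
proof (cases e)
  case Pos
  show ?thesis
    using independentQ_reindex[OF independentQ_nested, of "\<lambda>k. (0, (0, (0, 0), 0), k)" UNIV]
    by (simp add: Pos nested_elem_def cartan_elem_def monomial_0 nested_indices_def cartan_indices_def
        zero_pos_exponents image_subset_iff inj_on_def)
next
  case Neg
  show ?thesis
    using independentQ_reindex[OF independentQ_nested, of "\<lambda>k. (k, (0, (0, 0), 0), 0)" UNIV]
    by (simp add: Neg nested_elem_def cartan_elem_def monomial_0 nested_indices_def cartan_indices_def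
        zero_pos_exponents image_subset_iff inj_on_def)
qed

lemma independentQ_cartan: "independentQ cartan_elem cartan_indices"
  using independentQ_reindex[OF independentQ_nested, of "\<lambda>t. (0, t, 0)" cartan_indices]
  by (simp add: nested_elem_def monomial_0 nested_indices_def image_subset_iff inj_on_def)

lemma independentQ_hhat_monomial: "independentQ (hhat_monomial e) pos_exponents"
proof (cases e)
  case Pos
  show ?thesis
    using independentQ_reindex[OF independentQ_cartan, of "\<lambda>l. (0, (0, 0), l)" pos_exponents]
    by (simp add: Pos cartan_elem_def monomial_0 cartan_indices_def zero_pos_exponents image_subset_iff inj_on_def)
next
  case Neg
  show ?thesis
    using independentQ_reindex[OF independentQ_cartan, of "\<lambda>l. (l, (0, 0), 0)" pos_exponents]
    by (simp add: Neg cartan_elem_def monomial_0 cartan_indices_def zero_pos_exponents image_subset_iff inj_on_def)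
qed

lemma independentQ_binom_monomial: "independentQ binom_monomial UNIV"
  using independentQ_reindex[OF independentQ_cartan, of "\<lambda>p. (0, p, 0)" UNIV]
  by (simp add: cartan_elem_def monomial_0 cartan_indices_def zero_pos_exponents image_subset_iff inj_on_def)

lemma UZ_0_span: "UZ_0 = zspan (cartan_elem ` cartan_indices)"
proof -
  have "UZ_0 = UZ_0pm Neg \<odot> (UZ_00 \<odot> UZ_0pm Pos)" by (simp add: UZ_0_decomp prod_span_assoc)
  also have "\<dots> = zspan ((\<lambda>(l, t). hhat_monomial Neg l * (case t of (p, l') \<Rightarrow> binom_monomial p * hhat_monomial Pos l'))
      ` (pos_exponents \<times> UNIV \<times> pos_exponents))"
    by (simp only: UZ_0pm_span UZ_00_span zspan_prod_span)
  also have "(\<lambda>(l, t). hhat_monomial Neg l * (case t of (p, l') \<Rightarrow> binom_monomial p * hhat_monomial Pos l')) = cartan_elem"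
    by (auto simp: cartan_elem_def fun_eq_iff)
  finally show ?thesis by (simp only: cartan_indices_def)
qed

lemma UZ_span: "UZ = zspan (nested_elem ` nested_indices)"
proof -
  have "UZ = UZ_pm Neg \<odot> (UZ_0 \<odot> UZ_pm Pos)" by (simp add: UZ_decomp prod_span_assoc)
  also have "\<dots> = zspan ((\<lambda>(k, t). x_monomial Neg k * (case t of (t, k') \<Rightarrow> cartan_elem t * x_monomial Pos k'))
      ` (UNIV \<times> cartan_indices \<times> UNIV))"
    by (simp only: UZ_pm_span UZ_0_span zspan_prod_span)
  also have "(\<lambda>(k, t). x_monomial Neg k * (case t of (t, k') \<Rightarrow> cartan_elem t * x_monomial Pos k')) = nested_elem"
    by (auto simp: nested_elem_def fun_eq_iff)
  finally show ?thesis by (simp only: nested_indices_def)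
qed

lemma free_basis_UZ_pm: "free_basis (add_grp (UZ_pm e)) (x_monomial e) UNIV"
  and free_basis_UZ_0pm: "free_basis (add_grp (UZ_0pm e)) (hhat_monomial e) pos_exponents"
  and free_basis_UZ_00: "free_basis (add_grp UZ_00) binom_monomial UNIV"
  and free_basis_UZ_0: "free_basis (add_grp UZ_0) cartan_elem cartan_indices"
  and free_basis_UZ: "free_basis (add_grp UZ) nested_elem nested_indices"
  by (rule free_basisI, rule UZ_pm_subalgebra UZ_0pm_subalgebra UZ_00_subalgebra UZ_0_subalgebra UZ_subalgebra,
      rule independentQ_x_monomial independentQ_hhat_monomial independentQ_binom_monomial independentQ_cartan
        independentQ_nested,
      rule UZ_pm_span UZ_0pm_span UZ_00_span UZ_0_span UZ_span)+

lemma common_denominator: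
  "\<exists>d m n. q = of_int m * d \<and> r = of_int n * (d :: rat)"
proof -
  obtain a b where ab: "quotient_of q = (a, b)" by fastforce
  obtain a' b' where ab': "quotient_of r = (a', b')" by fastforce
  have "b > 0" "b' > 0" using ab ab' quotient_of_denom_pos by blast+
  then have "q = of_int (a * b') * (1 / of_int (b * b'))" "r = of_int (a' * b) * (1 / of_int (b * b'))"
    using quotient_of_div[OF ab] quotient_of_div[OF ab'] by simp_all
  then show ?thesis by blast
qed

text \<open>Rational multiples of elements of \<open>UZ\<close> are closed under sums by common
  denominators, so only the generators of the algebra need attention; \<open>h_el\<close> and
  \<open>c_el\<close> lie in \<open>UZ\<close> as combinations of commutators.\<close>

lemma UZ_generates: "\<exists>q s. s \<in> UZ \<and> u = q *\<^sub>Q s"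
proof (induction u rule: uhat_gen_induct)
  case (gen g)
  have x: "x_el e r \<in> UZ" for e r
    using dp_span_single[of e r 1] dp_span_subset[of e 1] UZ_pm_subset[of e] by auto
  have comm: "x_el Pos r * x_el Neg s - x_el Neg s * x_el Pos r \<in> UZ" for r s
    by (intro Z_subalgebra_diff[OF UZ_subalgebra] Z_subalgebra_mult[OF UZ_subalgebra] x)
  have h: "h_el r \<in> UZ" for r
  proof -
    have "h_el r = x_el Pos r * x_el Neg 0 - x_el Neg 0 * x_el Pos r"
      using xp_xm[of r 0] by auto
    then show ?thesis using comm[of r 0] by (simp only:)
  qed
  have c: "c_el \<in> UZ"
  proof -
    have "c_el = (x_el Pos 1 * x_el Neg (- 1) - x_el Neg (- 1) * x_el Pos 1) - h_el 0"
      using xp_xm[of 1 "- 1"] by simp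
    then show ?thesis using Z_subalgebra_diff[OF UZ_subalgebra comm[of 1 "- 1"] h[of 0]] by (simp only:)
  qed
  have "uhat_gen g \<in> UZ" using x h c by (cases g) (simp_all add: x_el_def h_el_def c_el_def)
  then show ?case by (intro exI[of _ 1] exI[of _ "uhat_gen g"]) (simp add: scaleQ_one)
next
  case one
  show ?case
    by (intro exI[of _ 1] exI[of _ "1 :: uhat"]) (simp add: scaleQ_one Z_subalgebra_one[OF UZ_subalgebra])
next
  case (add u v)
  then obtain q s r t where st: "s \<in> UZ" "t \<in> UZ" "u = q *\<^sub>Q s" "v = r *\<^sub>Q t" by blast
  obtain d m n where d: "q = of_int m * d" "r = of_int n * (d :: rat)" using common_denominator by blast
  have "u + v = d *\<^sub>Q (of_int m * s + of_int n * t)"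
    by (simp add: st d of_int_scaleQ scaleQ_add_right scaleQ_scaleQ mult.commute)
  moreover have "of_int m * s + of_int n * t \<in> UZ"
    by (intro Z_subalgebra_add[OF UZ_subalgebra] Z_subalgebra_mult[OF UZ_subalgebra] Z_subalgebra_of_int[OF UZ_subalgebra] st)
  ultimately show ?case by blast
next
  case (mult u v)
  then obtain q s r t where st: "s \<in> UZ" "t \<in> UZ" "u = q *\<^sub>Q s" "v = r *\<^sub>Q t" by blast
  then have "u * v = (q * r) *\<^sub>Q (s * t)" by (simp add: mult_scaleQ_left mult_scaleQ_right scaleQ_scaleQ mult.commute[of r q])
  then show ?case using Z_subalgebra_mult[OF UZ_subalgebra st(1,2)] by blast
next
  case (scale q u)
  then obtain r s where s: "s \<in> UZ" "u = r *\<^sub>Q s" by blast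
  have "q *\<^sub>Q u = (q * r) *\<^sub>Q s" by (simp only: s(2) scaleQ_scaleQ)
  with s(1) show ?case by (intro exI conjI)
qed

lemma integral_form_UZ: "integral_form UZ"
  unfolding integral_form_def
proof (intro conjI)
  have "is_Z_basis nested_elem nested_indices UZ" by (rule is_Z_basisI[OF independentQ_nested UZ_span])
  then have "is_Z_basis (\<lambda>b. b) (nested_elem ` nested_indices) UZ"
    unfolding is_Z_basis_def by (simp only: image_ident inj_on_id2 simp_thms)
  then show "\<exists>B. is_Z_basis (\<lambda>b. b) B UZ" by (rule exI)
  show "Z_subalgebra UZ" by (rule UZ_subalgebra)
  show "tensor_lift (add_grp UNIV) (*\<^sub>Q) \<in> iso (add_grp (UNIV :: rat set) \<boxtimes> add_grp UZ) (add_grp UNIV)"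
    by (rule rat_tensor_iso[OF UZ_subalgebra UZ_generates])
qed

text \<open>Here the index set consists of tuples of basis elements rather than exponents. The
  exponents are mapped onto it by \<Phi>, and injectivity of the product on tuples follows from that
  of the composite \<open>basis_elem\<close>.\<close>

lemma Z_basis_products:
  "is_Z_basis (\<lambda>(b1, b2, b3, b4, b5). b1 * b2 * b3 * b4 * b5)
    (B_pm Neg \<times> B_0pm Neg \<times> B_00 \<times> B_0pm Pos \<times> B_pm Pos) UZ"
proof -
  let ?F = "\<lambda>(b1, b2, b3, b4, b5). b1 * b2 * b3 * b4 * b5 :: uhat"
  define \<Phi> where "\<Phi> = (\<lambda>(k, l, p, l', k'). (x_monomial Neg k, hhat_monomial Neg l, binom_monomial p,
    hhat_monomial Pos l', x_monomial Pos k'))"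
  have F: "?F \<circ> \<Phi> = basis_elem" by (auto simp: \<Phi>_def basis_elem_def fun_eq_iff)
  have im: "\<Phi> ` basis_indices = B_pm Neg \<times> B_0pm Neg \<times> B_00 \<times> B_0pm Pos \<times> B_pm Pos"
  proof (intro equalityI subsetI)
    fix t assume "t \<in> B_pm Neg \<times> B_0pm Neg \<times> B_00 \<times> B_0pm Pos \<times> B_pm Pos"
    then obtain k l p l' k' where "t = \<Phi> (k, l, p, l', k')" "l \<in> pos_exponents" "l' \<in> pos_exponents"
      unfolding \<Phi>_def B_pm_def B_0pm_def B_00_def by (elim SigmaE imageE) simp
    then show "t \<in> \<Phi> ` basis_indices"
      by (intro image_eqI[of t \<Phi> "(k, l, p, l', k')"]) (simp_all add: basis_indices_def)
  qed (auto simp: \<Phi>_def basis_indices_def B_pm_def B_0pm_def B_00_def)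
  have "UZ = zspan (basis_elem ` basis_indices)"
    unfolding UZ_span flatten_image[symmetric] image_image basis_elem_flatten ..
  then have "is_Z_basis basis_elem basis_indices UZ" by (rule is_Z_basisI[OF independentQ_basis_elem])
  then show ?thesis
    unfolding is_Z_basis_def im[symmetric] image_comp F
    by (elim conjE, intro conjI inj_on_imageI) (simp_all only: F)
qed

section \<open>The multiplication maps\<close>

lemma id_hom_add_grp: "id \<in> hom (add_grp S) (add_grp UNIV)" "id \<in> hom (add_grp S) (add_grp S)"
  by (simp_all add: hom_def)

lemma free_basis_comm_group: "free_basis K b I \<Longrightarrow> comm_group K"
  by (simp add: free_basis_def)

lemma free_basis_mem: "free_basis K b I \<Longrightarrow> i \<in> I \<Longrightarrow> b i \<in> carrier K"
  by (auto simp: free_basis_def)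

lemma tensor_mult_basis_hom:
  assumes G: "free_basis G b I" and H: "free_basis H d J"
    and f: "f \<in> hom G (add_grp UNIV)" and g: "g \<in> hom H (add_grp UNIV)"
  shows "tensor_mult f g \<in> hom (G \<boxtimes> H) (add_grp UNIV)"
    and "p \<in> I \<times> J \<Longrightarrow> tensor_mult f g ((\<lambda>(i, j). pure_tensor G H (b i) (d j)) p) = (\<lambda>(i, j). f (b i) * g (d j)) p"
  using tensor_mult_hom[OF free_basis_comm_group[OF G] free_basis_comm_group[OF H] f g]
    free_basis_mem[OF G] free_basis_mem[OF H] by auto

lemma multiplication_iso:
  assumes B: "free_basis K b I" and S: "free_basis (add_grp S) b' I" "Z_subalgebra S"
    and f: "f \<in> hom K (add_grp UNIV)" and fb: "\<And>i. i \<in> I \<Longrightarrow> f (b i) = b' i"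
  shows "f \<in> iso K (add_grp S)"
proof (rule free_basis_iso[OF B S(1) _ fb])
  show "f \<in> hom K (add_grp S)"
    by (rule hom_add_grp_subset[OF f B S(2)]) (use fb free_basis_mem[OF S(1)] in simp)
qed

abbreviation "cartan_tensor \<equiv> add_grp (UZ_0pm Neg) \<boxtimes> add_grp UZ_00 \<boxtimes> add_grp (UZ_0pm Pos)"

definition cartan_tensor_basis where
  "cartan_tensor_basis = (\<lambda>(l, t). pure_tensor (add_grp (UZ_0pm Neg)) (add_grp UZ_00 \<boxtimes> add_grp (UZ_0pm Pos))
    (hhat_monomial Neg l) ((\<lambda>(p, l'). pure_tensor (add_grp UZ_00) (add_grp (UZ_0pm Pos)) (binom_monomial p) (hhat_monomial Pos l')) t))"

lemma free_basis_cartan_tensor: "free_basis cartan_tensor cartan_tensor_basis cartan_indices"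
  unfolding cartan_tensor_basis_def cartan_indices_def
  by (rule free_basis_tensor[OF free_basis_UZ_0pm free_basis_tensor[OF free_basis_UZ_00 free_basis_UZ_0pm]])

abbreviation "cartan_mult \<equiv> tensor_mult id (tensor_mult id id)"

lemma cartan_mult:
  shows "cartan_mult \<in> hom cartan_tensor (add_grp UNIV)"
    and "t \<in> cartan_indices \<Longrightarrow> cartan_mult (cartan_tensor_basis t) = cartan_elem t"
proof -
  note 1 = tensor_mult_basis_hom[OF free_basis_UZ_00 free_basis_UZ_0pm[of Pos] id_hom_add_grp(1) id_hom_add_grp(1)]
  note 2 = tensor_mult_basis_hom[OF free_basis_UZ_0pm[of Neg]
    free_basis_tensor[OF free_basis_UZ_00 free_basis_UZ_0pm[of Pos]] id_hom_add_grp(1) 1(1)]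
  show "cartan_mult \<in> hom cartan_tensor (add_grp UNIV)" by (rule 2(1))
  show "cartan_mult (cartan_tensor_basis t) = cartan_elem t" if "t \<in> cartan_indices"
    using 2(2)[OF that[unfolded cartan_indices_def]] 1(2)[of "snd t"] that
    by (auto simp: cartan_tensor_basis_def cartan_elem_def cartan_indices_def)
qed

lemma cartan_mult_hom: "cartan_mult \<in> hom cartan_tensor (add_grp UZ_0)"
  by (rule hom_add_grp_subset[OF cartan_mult(1) free_basis_cartan_tensor UZ_0_subalgebra])
     (use cartan_mult(2) free_basis_mem[OF free_basis_UZ_0] in simp)

definition triple_basis where
  "triple_basis M b = (\<lambda>(k, t). pure_tensor (add_grp (UZ_pm Neg)) (M \<boxtimes> add_grp (UZ_pm Pos))
    (x_monomial Neg k) ((\<lambda>(t, k'). pure_tensor M (add_grp (UZ_pm Pos)) (b t) (x_monomial Pos k')) t))"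

lemma free_basis_triple:
  assumes "free_basis M b cartan_indices"
  shows "free_basis (add_grp (UZ_pm Neg) \<boxtimes> M \<boxtimes> add_grp (UZ_pm Pos)) (triple_basis M b) nested_indices"
  unfolding triple_basis_def nested_indices_def
  by (rule free_basis_tensor[OF free_basis_UZ_pm free_basis_tensor[OF assms free_basis_UZ_pm]])

text \<open>The middle factor is left abstract: it is \<open>add_grp UZ_0\<close> for three factors
  and \<open>cartan_tensor\<close> for five.\<close>

lemma triple_mult_iso:
  assumes M: "free_basis M b cartan_indices" and f: "f \<in> hom M (add_grp UNIV)"
    and fb: "\<And>t. t \<in> cartan_indices \<Longrightarrow> f (b t) = cartan_elem t"
  shows "tensor_mult id (tensor_mult f id) \<in> iso (add_grp (UZ_pm Neg) \<boxtimes> M \<boxtimes> add_grp (UZ_pm Pos)) (add_grp UZ)"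
proof -
  note 1 = tensor_mult_basis_hom[OF M free_basis_UZ_pm[of Pos] f id_hom_add_grp(1)]
  note 2 = tensor_mult_basis_hom[OF free_basis_UZ_pm[of Neg] free_basis_tensor[OF M free_basis_UZ_pm[of Pos]]
    id_hom_add_grp(1) 1(1)]
  show ?thesis
  proof (rule multiplication_iso[OF free_basis_triple[OF M] free_basis_UZ UZ_subalgebra 2(1)])
    fix i assume i: "i \<in> nested_indices"
    show "tensor_mult id (tensor_mult f id) (triple_basis M b i) = nested_elem i"
      using 2(2)[OF i[unfolded nested_indices_def]] 1(2)[of "snd i"] i fb
      by (auto simp: triple_basis_def nested_elem_def nested_indices_def)
  qed
qed

text \<open>Both sides are free on \<open>nested_indices\<close>, and the map matches the bases
  because \<open>cartan_mult\<close> sends the tensor basis of the Cartan part to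
  \<open>cartan_elem\<close>.\<close>

lemma triple_map_iso:
  "tensor_map (add_grp (UZ_pm Neg)) (add_grp UZ_0 \<boxtimes> add_grp (UZ_pm Pos)) id
      (tensor_map (add_grp UZ_0) (add_grp (UZ_pm Pos)) cartan_mult id)
    \<in> iso (add_grp (UZ_pm Neg) \<boxtimes> cartan_tensor \<boxtimes> add_grp (UZ_pm Pos))
        (add_grp (UZ_pm Neg) \<boxtimes> add_grp UZ_0 \<boxtimes> add_grp (UZ_pm Pos))"
proof -
  note comm = free_basis_comm_group[OF free_basis_UZ_pm] free_basis_comm_group[OF free_basis_cartan_tensor]
    free_basis_comm_group[OF free_basis_UZ_0]
  note 1 = tensor_map_hom[OF comm(2) comm(1)[of Pos] comm(3) comm(1)[of Pos] cartan_mult_hom id_hom_add_grp(2)]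
  have T: "comm_group (cartan_tensor \<boxtimes> add_grp (UZ_pm Pos))" "comm_group (add_grp UZ_0 \<boxtimes> add_grp (UZ_pm Pos))"
    using free_basis_tensor[OF free_basis_cartan_tensor free_basis_UZ_pm]
      free_basis_tensor[OF free_basis_UZ_0 free_basis_UZ_pm] free_basis_comm_group by blast+
  note 2 = tensor_map_hom[OF comm(1)[of Neg] T(1) comm(1)[of Neg] T(2) id_hom_add_grp(2) 1(1)]
  have pt: "pure_tensor cartan_tensor (add_grp (UZ_pm Pos)) (cartan_tensor_basis t) (x_monomial Pos k')
      \<in> carrier (cartan_tensor \<boxtimes> add_grp (UZ_pm Pos))" if "t \<in> cartan_indices" for t k'
    using free_basis_mem[OF free_basis_tensor[OF free_basis_cartan_tensor free_basis_UZ_pm], of "(t, k')" Pos] that by simp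
  show ?thesis
  proof (rule free_basis_iso[OF free_basis_triple[OF free_basis_cartan_tensor] free_basis_triple[OF free_basis_UZ_0] 2(1)])
    fix i assume "i \<in> nested_indices"
    then obtain k t k' where i: "i = (k, t, k')" "t \<in> cartan_indices" by (auto simp: nested_indices_def)
    have m: "x_monomial e k \<in> carrier (add_grp (UZ_pm e))" for e k
      by (rule free_basis_mem[OF free_basis_UZ_pm]) simp
    have t: "cartan_tensor_basis t \<in> carrier cartan_tensor"
      by (rule free_basis_mem[OF free_basis_cartan_tensor i(2)])
    show "tensor_map (add_grp (UZ_pm Neg)) (add_grp UZ_0 \<boxtimes> add_grp (UZ_pm Pos)) id
        (tensor_map (add_grp UZ_0) (add_grp (UZ_pm Pos)) cartan_mult id) (triple_basis cartan_tensor cartan_tensor_basis i)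
      = triple_basis (add_grp UZ_0) cartan_elem i"
      by (simp add: i triple_basis_def 2(2)[OF m pt[OF i(2)]] 1(2)[OF t m] cartan_mult(2)[OF i(2)])
  qed
qed

theorem theorem5p29:
  shows "integral_form UZ
    \<and> tensor_mult id (tensor_mult id id)
        \<in> iso (add_grp (UZ_pm Neg) \<boxtimes> add_grp UZ_0 \<boxtimes> add_grp (UZ_pm Pos)) (add_grp UZ)
    \<and> tensor_map (add_grp (UZ_pm Neg)) (add_grp UZ_0 \<boxtimes> add_grp (UZ_pm Pos))
          id
          (tensor_map (add_grp UZ_0) (add_grp (UZ_pm Pos)) (tensor_mult id (tensor_mult id id)) id)
        \<in> iso
            (add_grp (UZ_pm Neg)
              \<boxtimes> (add_grp (UZ_0pm Neg) \<boxtimes> add_grp UZ_00 \<boxtimes> add_grp (UZ_0pm Pos))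
              \<boxtimes> add_grp (UZ_pm Pos))
            (add_grp (UZ_pm Neg) \<boxtimes> add_grp UZ_0 \<boxtimes> add_grp (UZ_pm Pos))
    \<and> tensor_mult id (tensor_mult (tensor_mult id (tensor_mult id id)) id)
        \<in> iso
            (add_grp (UZ_pm Neg)
              \<boxtimes> (add_grp (UZ_0pm Neg) \<boxtimes> add_grp UZ_00 \<boxtimes> add_grp (UZ_0pm Pos))
              \<boxtimes> add_grp (UZ_pm Pos))
            (add_grp UZ)
    \<and> (\<forall>e. is_Z_basis (x_monomial e) UNIV (UZ_pm e))
    \<and> (\<forall>e. is_Z_basis (hhat_monomial e) pos_exponents (UZ_0pm e))
    \<and> is_Z_basis binom_monomial UNIV UZ_00
    \<and> is_Z_basis (\<lambda>(b1, b2, b3, b4, b5). b1 * b2 * b3 * b4 * b5)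
        (B_pm Neg \<times> B_0pm Neg \<times> B_00 \<times> B_0pm Pos \<times> B_pm Pos) UZ"
proof (intro conjI allI)
  show "integral_form UZ" by (rule integral_form_UZ)
  show "tensor_mult id (tensor_mult id id)
      \<in> iso (add_grp (UZ_pm Neg) \<boxtimes> add_grp UZ_0 \<boxtimes> add_grp (UZ_pm Pos)) (add_grp UZ)"
    by (rule triple_mult_iso[OF free_basis_UZ_0 id_hom_add_grp(1)]) simp
  show "tensor_mult id (tensor_mult cartan_mult id)
      \<in> iso (add_grp (UZ_pm Neg) \<boxtimes> cartan_tensor \<boxtimes> add_grp (UZ_pm Pos)) (add_grp UZ)"
    by (rule triple_mult_iso[OF free_basis_cartan_tensor cartan_mult])
  fix e
  show "is_Z_basis (x_monomial e) UNIV (UZ_pm e)"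
    by (rule is_Z_basisI[OF independentQ_x_monomial UZ_pm_span])
  show "is_Z_basis (hhat_monomial e) pos_exponents (UZ_0pm e)"
    by (rule is_Z_basisI[OF independentQ_hhat_monomial UZ_0pm_span])
  show "is_Z_basis binom_monomial UNIV UZ_00"
    by (rule is_Z_basisI[OF independentQ_binom_monomial UZ_00_span])
qed (rule triple_map_iso, rule Z_basis_products)

end
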